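(* Let $G_0$ be $SU(\infty,q)$, $SO(\infty,q)$, $Sp(\infty,q)$ ($q\leqq\infty$), $SO^*(\infty)$ or $Sp(\infty;\mathbb R)$, let $\mathcal F$ be a flag in $V$ compatible with $E$ (and $b$-isotropic except in the case of $SU(\infty,q)$), and consider a flag $\mathcal F^{(1)}\in\mathcal Z_{\mathcal F,E}$. Then the orbit $G_0(\mathcal F^{(1)})$ is open in $\mathcal Z_{\mathcal F,E}$ if and only if $\mathcal F^{(1)}$ is nondegenerate.
   Context: Setting. $V$ is a complex vector space with countable basis $E$. All groups consist of linear transformations of $V$ that fix all but finitely many elements of the basis used to define them, and are direct limits, with direct limit topology, of the corresponding finite-dimensional groups on spans $V_n$ of finite subsets $E_n$ exhausting $E$ (with $V_n$ nondegenerate for the relevant forms). Orthogonal groups $SO(-)$ over $\mathbb R$ mean identity components. The cases: - $SU(\infty,q)$: $E=\{\dots,e_{-2},e_{-1},e_1,\dots,e_q\}$ ($q<\infty$) or $\{\dots,e_{-1},e_1,e_2,\dots\}$ ($q=\infty$); hermitian form $h(e_i,e_j)=\delta_{i,j}$ ($i<0$), $-\delta_{i,j}$ ($i>0$); $G=SL(\infty;\mathbb C)$, $G_0$ the subgroup preserving $h$. - $SO(\infty,q)$: in terms of a basis $E'=\{e'_i\}$ indexed as for $SU(\infty,q)$, $G_0$ is defined by a symmetric bilinear form $b$ together with a hermitian form $h$, where $b(e'_i,e'_j)=h(e'_i,e'_j)=\delta_{i,j}$ ($i<0$), $-\delta_{i,j}$ ($i>0$); $G=SO(\infty;\mathbb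 C)$ is defined by $b$, and $G_0=SO(\infty;\mathbb C)\cap SU(\infty,q)$ with $SU(\infty,q)$ defined by $h$ (identity component). The basis used for flags is $E=\{e_i\}$, indexed in the same way, where $h(e_i,e_j)=\delta_{i,j}$ ($i<0$), $-\delta_{i,j}$ ($i>0$), and $b(e_i,e_j)=\delta_{i,j}$ for $i<-q$, $b(e_i,e_j)=\delta_{0,i+j}$ for $i\geqq -q$. - $Sp(\infty,q)$: $E$ as for $SU(\infty,2q)$, with $h$ as for $SU(\infty,2q)$ and $b$ antisymmetric bilinear with $b(e_{2i-1},e_{2i})=-1$ for $i>0$, $b(e_{2i+1},e_{2i})=+1$ for $i<0$, extended by antisymmetry, all other values $0$; $G=Sp(\infty;\mathbb C)$ preserves $b$, $G_0$ is the subgroup preserving $h$. - $SO^*(\infty)$ and $Sp(\infty;\mathbb R)$: $E=\{\dots,e_{-2},e_{-1},e_1,e_2,\dots\}$, $h(e_i,e_j)=\delta_{i,j}$ ($i<0$), $-\delta_{i,j}$ ($i>0$); for $SO^*(\infty)$, $b(e_i,e_j)=\delta_{i+j,0}$ and $G=SO(\infty;\mathbb C)$; for $Sp(\infty;\mathbb R)$, $b(e_i,e_j)=\delta_{i+j,0}$ ($i<0$), $-\delta_{i+j,0}$ ($i>0$) and $G=Sp(\infty;\mathbb C)$; $G_0$ is the subgroup of $G$ preserving $h$. Flags. A chain is a set of distinct subspaces of $V$ totally ordered by inclusion. A generalized flag is a chain $\mathcal F$ such that every member has an immediate successor or an immediate predecessor in $\mathcal F$, and $V\setminus\{0\}=\bigcup(F''\setminus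 F')$, the union over all pairs $(F',F'')$ in $\mathcal F$ with $F''$ the immediate successor of $F'$. A flag is a generalized flag whose set of proper subspaces is, as an ordered set, isomorphic to a subset of $\mathbb Z$. It is compatible with $E=\{e_\alpha\}$ if there is a strict partial order $\prec$ on the index set such that every such pair has the form $(\mathrm{Span}\{e_\beta\mid\beta\prec\alpha\},\mathrm{Span}\{e_\beta\mid\beta\preceq\alpha\})$ or $(0,\mathrm{Span}\{e_\beta\mid\beta\preceq\alpha\})$. It is $b$-isotropic if $b(F,F)=0$ for every proper subspace $F$ of $V$ in it. Flag manifold. $\mathcal Z_{\mathcal F,E}=G(\mathcal F)\cong G/Q$, $Q$ the ($G$-)stabilizer of $\mathcal F$; it is the direct limit of the finite-dimensional flag manifolds of the flags $\mathcal F\cap V_n$ in $V_n$, with direct limit topology. Nondegeneracy. $\mathcal F^{(1)}=(F^{(1)}_\alpha)\in\mathcal Z_{\mathcal F,E}$ is nondegenerate if for each $F^{(1)}_\alpha\in\mathcal F^{(1)}$ the restriction of $h$ to $F^{(1)}_\alpha$ is nondegenerate.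
   Formalization: For SO(∞,q), q≥1, the stated b, h on E contradict E'; E is fixed as e_i=e'_i (i<-q), e_{-i},e_i=(e'_{-i}±e'_i)/√2 (1≤i≤q), so b is as stated but h(e_i,e_j)=δ_{i+j,0} for |i|,|j|≤q. In compatibility, β⪯α means "not α≺β". *)

theory Defs
  imports "HOL-Analysis.Analysis" "HOL-Combinatorics.Permutations"
begin
datatype real_form = SU enat | SO enat | Sp enat | SO_star | Sp_R

definition q_indices :: "enat \<Rightarrow> int set" where
  "q_indices q = {i. i < 0 \<or> (0 < i \<and> enat (nat i) \<le> q)}"

fun indices :: "real_form \<Rightarrow> int set" where
  "indices (SU q) = q_indices q"
| "indices (SO q) = q_indices q"
| "indices (Sp q) = q_indices (2 * q)"
| "indices SO_star = q_indices \<infinity>"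
| "indices Sp_R = q_indices \<infinity>"

fun is_SU :: "real_form \<Rightarrow> bool" where
  "is_SU (SU q) = True" | "is_SU _ = False"

fun is_SO :: "real_form \<Rightarrow> bool" where
  "is_SO (SO q) = True" | "is_SO _ = False"

text \<open>The real forms whose complexification is \<open>Sp(\<infinity>;\<complex>)\<close>, which is defined by \<open>b\<close> alone;
  for the other ones the determinant is required to be 1.\<close>

fun symplectic :: "real_form \<Rightarrow> bool" where
  "symplectic (Sp q) = True" | "symplectic Sp_R = True" | "symplectic _ = False"

definition h_gram :: "int \<Rightarrow> int \<Rightarrow> complex" where
  "h_gram i j = (if i = j then if i < 0 then 1 else -1 else 0)"

definition Sp_half_gram :: "int \<Rightarrow> int \<Rightarrow> complex" where
  "Sp_half_gram i j =
     (if \<exists>k>0. i = 2 * k - 1 \<and> j = 2 * k then -1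
      else if \<exists>k<0. i = 2 * k + 1 \<and> j = 2 * k then 1 else 0)"

text \<open>Values of \<open>b\<close> on the basis in terms of which the group is defined; for \<open>SO(\<infinity>,q)\<close> this is
  the basis \<open>E'\<close>. There is no \<open>b\<close> for \<open>SU(\<infinity>,q)\<close>, and the value given here is never used.\<close>

fun b_gram :: "real_form \<Rightarrow> int \<Rightarrow> int \<Rightarrow> complex" where
  "b_gram (SU q) i j = 0"
| "b_gram (SO q) i j = h_gram i j"
| "b_gram (Sp q) i j = Sp_half_gram i j - Sp_half_gram j i"
| "b_gram SO_star i j = (if i + j = 0 then 1 else 0)"
| "b_gram Sp_R i j = (if i + j = 0 then if i < 0 then 1 else -1 else 0)"

text \<open>The whole type \<open>'v\<close> is the space \<open>V\<close>. The vectors \<open>def_basis D i\<close> with \<open>i \<in> indices (form D)\<close>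
  are the basis defining the group. The set \<open>exh D n\<close> consists of the indices of \<open>E\<^sub>n\<close>.\<close>

record 'v flag_data =
  form :: real_form
  scl :: "complex \<Rightarrow> 'v \<Rightarrow> 'v"
  def_basis :: "int \<Rightarrow> 'v"
  herm :: "'v \<Rightarrow> 'v \<Rightarrow> complex"
  bil :: "'v \<Rightarrow> 'v \<Rightarrow> complex"
  exh :: "nat \<Rightarrow> int set"

abbreviation Idx :: "'v flag_data \<Rightarrow> int set" where
  "Idx D \<equiv> indices (form D)"

abbreviation spn :: "'v::ab_group_add flag_data \<Rightarrow> 'v set \<Rightarrow> 'v set" where
  "spn D \<equiv> module.span (scl D)"

definition bilinear_form :: "(complex \<Rightarrow> 'v \<Rightarrow> 'v) \<Rightarrow> ('v::ab_group_add \<Rightarrow> 'v \<Rightarrow> complex) \<Rightarrow> bool" where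
  "bilinear_form s f \<longleftrightarrow>
     (\<forall>x. Vector_Spaces.linear s (*) (f x)) \<and> (\<forall>y. Vector_Spaces.linear s (*) (\<lambda>x. f x y))"

definition hermitian_form :: "(complex \<Rightarrow> 'v \<Rightarrow> 'v) \<Rightarrow> ('v::ab_group_add \<Rightarrow> 'v \<Rightarrow> complex) \<Rightarrow> bool" where
  "hermitian_form s f \<longleftrightarrow>
     (\<forall>y. Vector_Spaces.linear s (*) (\<lambda>x. f x y)) \<and> (\<forall>x y. f y x = cnj (f x y))"

definition nondegenerate_on :: "('v::zero \<Rightarrow> 'v \<Rightarrow> complex) \<Rightarrow> 'v set \<Rightarrow> bool" where
  "nondegenerate_on f X \<longleftrightarrow> (\<forall>x\<in>X. (\<forall>y\<in>X. f x y = 0) \<longrightarrow> x = 0)"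

text \<open>The basis \<open>E\<close> used for flags. It is the defining basis except for \<open>SO(\<infinity>,q)\<close>, where
  \<open>e\<^sub>i = e'\<^sub>i\<close> for \<open>i < -q\<close>, and \<open>e\<^sub>-\<^sub>i, e\<^sub>i = (e'\<^sub>-\<^sub>i \<plusminus> e'\<^sub>i)/\<surd>2\<close> for \<open>1 \<le> i \<le> q\<close>. This is the
  standard passage from \<open>E'\<close> to a basis with \<open>b(e\<^sub>i,e\<^sub>j) = \<delta>\<^sub>i\<^sub>j\<close> for \<open>i < -q\<close> and
  \<open>b(e\<^sub>i,e\<^sub>j) = \<delta>\<^sub>i\<^sub>+\<^sub>j\<^sub>,\<^sub>0\<close> for \<open>i \<ge> -q\<close>; see \<open>flag_basis_SO_gram\<close> below.

  Pitfall: \<open>h\<close> has the same values as \<open>b\<close> on this basis. For \<open>q \<ge> 1\<close> no basis with these values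
  of \<open>b\<close> can be \<open>h\<close>-orthogonal. Indeed let \<open>\<sigma>\<close> be the antilinear map with
  \<open>h(x,y) = b(x,\<sigma> y)\<close>. It fixes the basis \<open>E'\<close>, so \<open>\<sigma>\<^sup>2 = 1\<close>. But \<open>h(e\<^sub>\<plusminus>\<^sub>1,e\<^sub>\<plusminus>\<^sub>1) = \<mp>1\<close> together
  with \<open>h\<close>-orthogonality would give \<open>\<sigma> e\<^sub>1 = - e\<^sub>-\<^sub>1\<close> and \<open>\<sigma> e\<^sub>-\<^sub>1 = e\<^sub>1\<close>, so \<open>\<sigma>\<^sup>2 e\<^sub>1 = - e\<^sub>1\<close>.\<close>

definition SO_flag_basis :: "enat \<Rightarrow> (complex \<Rightarrow> 'v \<Rightarrow> 'v) \<Rightarrow> (int \<Rightarrow> 'v) \<Rightarrow> int \<Rightarrow> 'v::ab_group_add" where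
  "SO_flag_basis q s e' i =
     (if i < 0 \<and> q < enat (nat (- i)) then e' i
      else if i < 0 then s (1 / complex_of_real (sqrt 2)) (e' i + e' (- i))
      else s (1 / complex_of_real (sqrt 2)) (e' (- i) - e' i))"

definition flag_basis :: "'v::ab_group_add flag_data \<Rightarrow> int \<Rightarrow> 'v" where
  "flag_basis D =
     (case form D of SO q \<Rightarrow> SO_flag_basis q (scl D) (def_basis D) | _ \<Rightarrow> def_basis D)"

definition V_level :: "'v::ab_group_add flag_data \<Rightarrow> nat \<Rightarrow> 'v set" where
  "V_level D n = spn D (flag_basis D ` exh D n)"

definition flag_setting :: "'v::ab_group_add flag_data \<Rightarrow> bool" where
  "flag_setting D \<longleftrightarrow>
     vector_space (scl D) \<and>
     inj_on (def_basis D) (Idx D) \<and>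
     \<not> module.dependent (scl D) (def_basis D ` Idx D) \<and>
     spn D (def_basis D ` Idx D) = UNIV \<and>
     hermitian_form (scl D) (herm D) \<and>
     (\<forall>i\<in>Idx D. \<forall>j\<in>Idx D. herm D (def_basis D i) (def_basis D j) = h_gram i j) \<and>
     (\<not> is_SU (form D) \<longrightarrow>
        bilinear_form (scl D) (bil D) \<and>
        (\<forall>i\<in>Idx D. \<forall>j\<in>Idx D. bil D (def_basis D i) (def_basis D j) = b_gram (form D) i j)) \<and>
     incseq (exh D) \<and> (\<Union>n. exh D n) = Idx D \<and>
     (\<forall>n. finite (exh D n) \<and> nondegenerate_on (herm D) (V_level D n) \<and>
          (\<not> is_SU (form D) \<longrightarrow> nondegenerate_on (bil D) (V_level D n)))"

definition mat_entries :: "'v::ab_group_add flag_data \<Rightarrow> ('v \<Rightarrow> 'v) \<Rightarrow> int \<Rightarrow> int \<Rightarrow> complex" where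
  "mat_entries D g i j =
     (if i \<in> Idx D \<and> j \<in> Idx D
      then module.representation (scl D) (flag_basis D ` Idx D) (g (flag_basis D j)) (flag_basis D i)
      else 0)"

definition det_on :: "int set \<Rightarrow> (int \<Rightarrow> int \<Rightarrow> complex) \<Rightarrow> complex" where
  "det_on S A = (\<Sum>p | p permutes S. of_int (sign p) * (\<Prod>i\<in>S. A i (p i)))"

text \<open>\<open>G_level D n\<close> is \<open>SL(V\<^sub>n)\<close>, \<open>SO(V\<^sub>n,b)\<close> or \<open>Sp(V\<^sub>n,b)\<close>, acting on \<open>V\<close> by the identity on the
  remaining basis vectors. In the case of \<open>SO(\<infinity>,q)\<close>, nondegeneracy of \<open>b\<close> on \<open>V\<^sub>n\<close> forces \<open>E\<^sub>n\<close> to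
  contain with \<open>e\<^sub>i\<close>, \<open>\<bar>i\<bar> \<le> q\<close>, also \<open>e\<^sub>-\<^sub>i\<close>, so that it does not matter whether the vectors fixed are
  taken from \<open>E\<close> or from \<open>E'\<close>.\<close>

definition G_level :: "'v::ab_group_add flag_data \<Rightarrow> nat \<Rightarrow> ('v \<Rightarrow> 'v) set" where
  "G_level D n =
     {g. Vector_Spaces.linear (scl D) (scl D) g \<and> bij g \<and>
         (\<forall>i\<in>Idx D - exh D n. g (flag_basis D i) = flag_basis D i) \<and>
         g ` V_level D n = V_level D n \<and>
         (\<not> symplectic (form D) \<longrightarrow> det_on (exh D n) (mat_entries D g) = 1) \<and>
         (\<not> is_SU (form D) \<longrightarrow> (\<forall>x y. bil D (g x) (g y) = bil D x y))}"

definition G :: "'v::ab_group_add flag_data \<Rightarrow> ('v \<Rightarrow> 'v) set" where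
  "G D = (\<Union>n. G_level D n)"

definition h_preserving_level :: "'v::ab_group_add flag_data \<Rightarrow> nat \<Rightarrow> ('v \<Rightarrow> 'v) set" where
  "h_preserving_level D n = {g \<in> G_level D n. \<forall>x y. herm D (g x) (g y) = herm D x y}"

text \<open>Matrices carry the product topology of \<open>int \<Rightarrow> int \<Rightarrow> complex\<close>. Since only the entries with
  both indices in the finite set \<open>exh D n\<close> vary on \<open>G_level D n\<close>, this induces the usual topology.\<close>

definition level_topology :: "'v::ab_group_add flag_data \<Rightarrow> ('v \<Rightarrow> 'v) set \<Rightarrow> ('v \<Rightarrow> 'v) topology" where
  "level_topology D H = pullback_topology H (mat_entries D) euclidean"

definition group_topology ::
    "'v::ab_group_add flag_data \<Rightarrow> (nat \<Rightarrow> ('v \<Rightarrow> 'v) set) \<Rightarrow> ('v \<Rightarrow> 'v) topology" where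
  "group_topology D H =
     topology (\<lambda>U. U \<subseteq> (\<Union>n. H n) \<and> (\<forall>n. openin (level_topology D (H n)) (U \<inter> H n)))"

definition G0 :: "'v::ab_group_add flag_data \<Rightarrow> ('v \<Rightarrow> 'v) set" where
  "G0 D =
     (if is_SO (form D)
      then connected_component_of_set (group_topology D (h_preserving_level D)) id
      else (\<Union>n. h_preserving_level D n))"

definition successor_pair :: "'v set set \<Rightarrow> 'v set \<Rightarrow> 'v set \<Rightarrow> bool" where
  "successor_pair F X Y \<longleftrightarrow> X \<in> F \<and> Y \<in> F \<and> X \<subset> Y \<and> \<not> (\<exists>Z\<in>F. X \<subset> Z \<and> Z \<subset> Y)"

definition generalized_flag :: "'v::ab_group_add flag_data \<Rightarrow> 'v set set \<Rightarrow> bool" where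
  "generalized_flag D F \<longleftrightarrow>
     (\<forall>X\<in>F. module.subspace (scl D) X) \<and> chain\<^sub>\<subseteq> F \<and>
     (\<forall>X\<in>F. \<exists>Y. successor_pair F X Y \<or> successor_pair F Y X) \<and>
     UNIV - {0} = \<Union> {Y - X |X Y. successor_pair F X Y}"

definition flag :: "'v::ab_group_add flag_data \<Rightarrow> 'v set set \<Rightarrow> bool" where
  "flag D F \<longleftrightarrow> generalized_flag D F \<and>
     (\<exists>\<phi> :: 'v set \<Rightarrow> int. \<forall>X\<in>F - {UNIV}. \<forall>Y\<in>F - {UNIV}. X \<subset> Y \<longleftrightarrow> \<phi> X < \<phi> Y)"

text \<open>Here \<open>\<beta> \<preceq> \<alpha>\<close> means \<open>\<not> \<alpha> \<prec> \<beta>\<close>, that is, \<open>\<beta> \<prec> \<alpha>\<close> or \<open>\<beta>\<close> and \<open>\<alpha>\<close> are incomparable (possibly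
  equal), so that quotients of successive members may have any dimension.\<close>

definition compatible :: "'v::ab_group_add flag_data \<Rightarrow> 'v set set \<Rightarrow> bool" where
  "compatible D F \<longleftrightarrow>
     (\<exists>prec :: int \<Rightarrow> int \<Rightarrow> bool. irreflp_on (Idx D) prec \<and> transp_on (Idx D) prec \<and>
       (\<forall>X Y. successor_pair F X Y \<longrightarrow>
         (\<exists>\<alpha>\<in>Idx D.
           (X = spn D (flag_basis D ` {\<beta> \<in> Idx D. prec \<beta> \<alpha>}) \<or> X = {0}) \<and>
           Y = spn D (flag_basis D ` {\<beta> \<in> Idx D. \<not> prec \<alpha> \<beta>}))))"

definition b_isotropic :: "'v::ab_group_add flag_data \<Rightarrow> 'v set set \<Rightarrow> bool" where
  "b_isotropic D F \<longleftrightarrow> (\<forall>X\<in>F. X \<noteq> UNIV \<longrightarrow> (\<forall>x\<in>X. \<forall>y\<in>X. bil D x y = 0))"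

definition nondegenerate_flag :: "'v::ab_group_add flag_data \<Rightarrow> 'v set set \<Rightarrow> bool" where
  "nondegenerate_flag D F \<longleftrightarrow> (\<forall>X\<in>F. nondegenerate_on (herm D) X)"

definition act :: "('v \<Rightarrow> 'v) \<Rightarrow> 'v set set \<Rightarrow> 'v set set" where
  "act g F = (\<lambda>X. g ` X) ` F"

definition orbit :: "('v \<Rightarrow> 'v) set \<Rightarrow> 'v set set \<Rightarrow> 'v set set set" where
  "orbit H F = (\<lambda>g. act g F) ` H"

definition flag_manifold :: "'v::ab_group_add flag_data \<Rightarrow> 'v set set \<Rightarrow> 'v set set set" where
  "flag_manifold D F = orbit (G D) F"

definition restrict_flag :: "'v::ab_group_add flag_data \<Rightarrow> nat \<Rightarrow> 'v set set \<Rightarrow> 'v set set" where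
  "restrict_flag D n F = (\<lambda>X. X \<inter> V_level D n) ` F"

text \<open>The finite-dimensional flag manifold of \<open>F \<inter> V\<^sub>n\<close> with its topology as a homogeneous space of
  \<open>G_level D n\<close>.\<close>

definition fin_flag_topology :: "'v::ab_group_add flag_data \<Rightarrow> 'v set set \<Rightarrow> nat \<Rightarrow> 'v set set topology" where
  "fin_flag_topology D F n =
     topology (\<lambda>W. W \<subseteq> orbit (G_level D n) (restrict_flag D n F) \<and>
       openin (level_topology D (G_level D n)) {g \<in> G_level D n. act g (restrict_flag D n F) \<in> W})"

text \<open>The direct limit topology, where the flag manifold of \<open>F \<inter> V\<^sub>n\<close> is identified with the subset
  \<open>orbit (G_level D n) F\<close> of the flag manifold of \<open>F\<close> by intersecting with \<open>V\<^sub>n\<close>.\<close>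

definition flag_topology :: "'v::ab_group_add flag_data \<Rightarrow> 'v set set \<Rightarrow> 'v set set topology" where
  "flag_topology D F =
     topology (\<lambda>U. U \<subseteq> flag_manifold D F \<and>
       (\<forall>n. openin (fin_flag_topology D F n) (restrict_flag D n ` (U \<inter> orbit (G_level D n) F))))"

lemma flag_basis_SO_gram:
  assumes D: "flag_setting D" and SO: "form D = SO q" and i: "i \<in> Idx D" and j: "j \<in> Idx D"
  defines "c \<equiv> (if i < 0 \<and> q < enat (nat (- i)) then if i = j then 1 else 0
               else if i + j = 0 then 1 else (0::complex))"
  shows "bil D (flag_basis D i) (flag_basis D j) = c"
    and "herm D (flag_basis D i) (flag_basis D j) = c"
proof -
  let ?r = "1 / complex_of_real (sqrt 2)"
  have s2: "complex_of_real (sqrt 2) * complex_of_real (sqrt 2) = 2"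
    by (metis of_real_mult of_real_numeral real_sqrt_mult_self abs_numeral)
  have gen: "f (flag_basis D i) (flag_basis D j) = c"
    if add1: "\<And>x y z. f (x + y) z = f x z + f y z" and add2: "\<And>x y z. f z (x + y) = f z x + f z y"
      and diff1: "\<And>x y z. f (x - y) z = f x z - f y z" and diff2: "\<And>x y z. f z (x - y) = f z x - f z y"
      and sc1: "\<And>x z. f (scl D ?r x) z = ?r * f x z" and sc2: "\<And>x z. f z (scl D ?r x) = ?r * f z x"
      and gram: "\<And>i j. i \<in> Idx D \<Longrightarrow> j \<in> Idx D \<Longrightarrow> f (def_basis D i) (def_basis D j) = h_gram i j"
    for f :: "'a \<Rightarrow> 'a \<Rightarrow> complex"
  proof -
    have mem: "k \<in> Idx D \<longleftrightarrow> k < 0 \<or> (0 < k \<and> enat (nat k) \<le> q)" for k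
      by (simp add: SO q_indices_def)
    have E: "flag_basis D = SO_flag_basis q (scl D) (def_basis D)"
      by (simp add: flag_basis_def SO)
    have neg: "- k \<in> Idx D" if "k \<in> Idx D" "\<not> (k < 0 \<and> q < enat (nat (- k)))" for k
      using that unfolding mem by (cases "k < 0") auto
    consider "i < 0 \<and> q < enat (nat (- i))" "j < 0 \<and> q < enat (nat (- j))"
      | "i < 0 \<and> q < enat (nat (- i))" "\<not> (j < 0 \<and> q < enat (nat (- j)))"
      | "\<not> (i < 0 \<and> q < enat (nat (- i)))" "j < 0 \<and> q < enat (nat (- j))"
      | "\<not> (i < 0 \<and> q < enat (nat (- i)))" "\<not> (j < 0 \<and> q < enat (nat (- j)))"
      by blast
    then show ?thesis
    proof cases
      case 1
      then show ?thesis using i j by (simp add: E SO_flag_basis_def gram c_def h_gram_def)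
    next
      case 2
      then have "i \<noteq> j" "i \<noteq> - j" using j unfolding mem by auto
      then show ?thesis using 2 i j neg[OF j]
        by (simp add: E SO_flag_basis_def gram c_def h_gram_def add2 diff2 sc2)
    next
      case 3
      then have "i \<noteq> j" "j \<noteq> - i" using i unfolding mem by auto
      then have "i \<noteq> j" "- i \<noteq> j" "i + j \<noteq> 0" by auto
      then show ?thesis using 3 i j neg[OF i]
        by (simp add: E SO_flag_basis_def gram c_def h_gram_def add1 diff1 sc1)
    next
      case 4
      have nz: "i \<noteq> 0" "j \<noteq> 0" using i j unfolding mem by auto
      show ?thesis using 4 i j neg[OF i] neg[OF j] nz
        by (auto simp: E SO_flag_basis_def gram c_def h_gram_def add1 diff1 sc1 add2 diff2 sc2 s2
            simp flip: add_divide_distrib)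
    qed
  qed
  have bl: "bilinear_form (scl D) (bil D)" and hf: "hermitian_form (scl D) (herm D)"
    and bg: "\<And>i j. i \<in> Idx D \<Longrightarrow> j \<in> Idx D \<Longrightarrow> bil D (def_basis D i) (def_basis D j) = h_gram i j"
    and hg: "\<And>i j. i \<in> Idx D \<Longrightarrow> j \<in> Idx D \<Longrightarrow> herm D (def_basis D i) (def_basis D j) = h_gram i j"
    using D unfolding flag_setting_def by (simp_all add: SO)
  have L1: "Vector_Spaces.linear (scl D) (*) (bil D x)"
    and L2: "Vector_Spaces.linear (scl D) (*) (\<lambda>x. bil D x y)"
    and L3: "Vector_Spaces.linear (scl D) (*) (\<lambda>x. herm D x y)"
    and cj: "herm D y x = cnj (herm D x y)" for x y
    using bl hf unfolding bilinear_form_def hermitian_form_def by blast+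
  note M1 = L1[THEN Vector_Spaces.linear.axioms(3)] and M2 = L2[THEN Vector_Spaces.linear.axioms(3)]
    and M3 = L3[THEN Vector_Spaces.linear.axioms(3)]
  show "bil D (flag_basis D i) (flag_basis D j) = c"
    by (rule gen[OF M2[THEN module_hom.add] M1[THEN module_hom.add] M2[THEN module_hom.diff]
      M1[THEN module_hom.diff] M2[THEN module_hom.scale] M1[THEN module_hom.scale] bg])
  have A: "herm D (x + y) z = herm D x z + herm D y z" "herm D (x - y) z = herm D x z - herm D y z"
    "herm D (scl D a x) z = a * herm D x z" for x y z a
    by (rule M3[THEN module_hom.add] M3[THEN module_hom.diff] M3[THEN module_hom.scale])+
  have B: "herm D z (x + y) = herm D z x + herm D z y" for x y z
    by (metis A(1) cj complex_cnj_add)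
  have B2: "herm D z (x - y) = herm D z x - herm D z y" for x y z
    by (metis A(2) cj complex_cnj_diff)
  have B3: "herm D z (scl D a x) = cnj a * herm D z x" for x z a
    by (metis A(3) cj complex_cnj_mult)
  show "herm D (flag_basis D i) (flag_basis D j) = c"
    by (rule gen[OF A(1) B A(2) B2 A(3) _ hg]) (simp_all add: B3)
qed

end

theory Submission
  imports Defs "HOL-Computational_Algebra.Polynomial"
begin

text \<open>If \<open>h\<close> degenerates on a member of the flag, there are unipotents \<open>1 + tN\<close> in \<open>G\<close>, with \<open>N\<^sup>2 = 0\<close>,
  that raise the rank of \<open>h\<close> on the intersection of that member with some \<open>V\<^sub>n\<close> for arbitrarily
  small \<open>t\<close>; elements of \<open>G\<^sub>0\<close> preserve this rank for large \<open>n\<close>, so the orbit is not open.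

  Conversely, let the flag be nondegenerate and let \<open>k \<in> G\<close> be near \<open>1\<close>. Write \<open>k\<^sup>* k = r\<^sup>* r\<close> with \<open>r\<close>
  near \<open>1\<close> and stabilizing the flag (block Cholesky, with adjoints taken for \<open>h\<close>). Then \<open>u = k r\<^sup>-\<^sup>1\<close> is
  an \<open>h\<close>-isometry that moves the flag as \<open>k\<close> does. Uniqueness of \<open>r\<close> makes it preserve \<open>b\<close> as well, and
  a Cayley path joins \<open>u\<close> to \<open>1\<close> in the isometry group.\<close>

text \<open>For SU and the symplectic forms N has rank one, x \<mapsto> h(x,v) v or x \<mapsto>
  b(x,v) v. For symmetric b it is x \<mapsto> b(x,u) v - b(x,v) u with an isotropic plane spanned by
  u and v, and it takes a radical vector r to v when b(u,r) = 1 and b(v,r) = 0. Let \<sigma> be the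
  antilinear map with h(x,y) = b(x,\<sigma> y). If r is proportional to \<sigma> r, then b(v,r) = 0
  forces h(v,r) = 0, and the rank can only grow through h(Nr,Nr). For \<open>SO_star\<close> this
  cannot happen, since \<sigma>^2 = -1. For SO(\<infinity>,q) the way out is a second radical vector
  or a vector v outside V_n, and here it matters that V has infinite dimension.

  As h is indefinite, the Cholesky factor does not come from positivity but from a contraction near
  1. Nondegeneracy of the flag supplies the orthogonal projections that define the blocks. As the
  proper members are b-isotropic, they can be completed by their b-orthogonal complements to a
  longer chain. That chain is stable under the duality given by b, which is what allows uniqueness
  to carry invariance under b over to the factor.\<close>

typedef (overloaded) 'v endo = "{f::'v::ab_group_add \<Rightarrow> 'v. \<forall>x y. f (x + y) = f x + f y}"
  morphisms app Endo
  by (rule exI[of _ id]) auto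

setup_lifting type_definition_endo

text \<open>The maps are only additive, so that the antilinear \<sigma> is an element too and
  conjugation by it is a product in the ring. The sort is \<open>{ring,monoid_mult}\<close> and not
  \<open>ring_1\<close>, since \<open>0 = 1\<close> holds when the underlying group is
  trivial.\<close>

instantiation endo :: (ab_group_add) "{ring, monoid_mult}"
begin

lift_definition zero_endo :: "'a endo" is "\<lambda>x. 0" by simp
lift_definition one_endo :: "'a endo" is "\<lambda>x. x" by simp
lift_definition plus_endo :: "'a endo \<Rightarrow> 'a endo \<Rightarrow> 'a endo" is "\<lambda>f g x. f x + g x"
  by (simp add: algebra_simps)
lift_definition minus_endo :: "'a endo \<Rightarrow> 'a endo \<Rightarrow> 'a endo" is "\<lambda>f g x. f x - g x"
  by (simp add: algebra_simps)
lift_definition uminus_endo :: "'a endo \<Rightarrow> 'a endo" is "\<lambda>f x. - f x"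
  by (simp add: algebra_simps)
lift_definition times_endo :: "'a endo \<Rightarrow> 'a endo \<Rightarrow> 'a endo" is "\<lambda>f g x. f (g x)"
  by simp

instance
  by standard (transfer; auto simp: algebra_simps fun_eq_iff)+

end

lemma app_add: "app a (x + y) = app a x + app a y"
  using app[of a] by simp

lemma app_zero_right [simp]: "app a 0 = 0"
  using app_add[of a 0 0] by simp

lemma app_minus_right: "app a (- x) = - app a x"
  using app_add[of a x "- x"] by (simp add: eq_neg_iff_add_eq_0 add.commute)

lemma app_diff: "app a (x - y) = app a x - app a y"
  using app_add[of a x "- y"] by (simp add: app_minus_right)

lemma app_simps [simp]:
  "app 0 x = 0" "app 1 x = x" "app (a + b) x = app a x + app b x"
  "app (a - b) x = app a x - app b x" "app (- a) x = - app a x"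
  "app (a * b) x = app a (app b x)"
  by (transfer; simp)+

lemma endo_eqI: "(\<And>x. app a x = app b x) \<Longrightarrow> a = b"
  by transfer auto

lemma app_Endo: "(\<And>x y. f (x + y) = f x + f y) \<Longrightarrow> app (Endo f) = f"
  by (rule Endo_inverse) simp

section \<open>Normed star algebras: contractions and inverses near the identity\<close>

text \<open>In the application \<open>A\<close> consists of the endomorphisms supported on V_n, to
  which the identity of V does not belong in general; hence group elements are written 1 + a with a
  in \<open>A\<close>. The element \<open>hf\<close> plays the scalar 1/2.\<close>

locale star_algebra =
  fixes A :: "'a::{ring,monoid_mult} set" and N :: "'a \<Rightarrow> real" and st :: "'a \<Rightarrow> 'a" and hf :: 'a
  assumes A_zero: "0 \<in> A"
    and A_add: "a \<in> A \<Longrightarrow> b \<in> A \<Longrightarrow> a + b \<in> A"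
    and A_uminus: "a \<in> A \<Longrightarrow> - a \<in> A"
    and A_mult: "a \<in> A \<Longrightarrow> b \<in> A \<Longrightarrow> a * b \<in> A"
    and A_half: "a \<in> A \<Longrightarrow> hf * a \<in> A"
    and half: "hf + hf = 1"
    and N_add: "N (a + b) \<le> N a + N b"
    and N_uminus: "N (- a) = N a"
    and N_zero: "N 0 = 0"
    and N_mult: "a \<in> A \<Longrightarrow> b \<in> A \<Longrightarrow> N (a * b) \<le> N a * N b"
    and N_eq_0: "a \<in> A \<Longrightarrow> N a = 0 \<Longrightarrow> a = 0"
    and N_half: "a \<in> A \<Longrightarrow> N (hf * a) \<le> N a"
    and N_complete: "(\<And>i::nat. y i \<in> A) \<Longrightarrow>
      (\<And>e. 0 < e \<Longrightarrow> \<exists>M. \<forall>i\<ge>M. \<forall>j\<ge>M. N (y i - y j) < e) \<Longrightarrow>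
      \<exists>a\<in>A. (\<lambda>i. N (y i - a)) \<longlonglongrightarrow> 0"
    and st_A: "a \<in> A \<Longrightarrow> st a \<in> A"
    and st_add: "a \<in> A \<Longrightarrow> b \<in> A \<Longrightarrow> st (a + b) = st a + st b"
    and st_mult: "a \<in> A \<Longrightarrow> b \<in> A \<Longrightarrow> st (a * b) = st b * st a"
    and st_st: "a \<in> A \<Longrightarrow> st (st a) = a"
    and N_st: "a \<in> A \<Longrightarrow> N (st a) = N a"
begin

lemma A_diff: "a \<in> A \<Longrightarrow> b \<in> A \<Longrightarrow> a - b \<in> A"
  using A_add[of a "- b"] A_uminus by simp

lemma A_sum: "(\<And>i. i \<in> B \<Longrightarrow> f i \<in> A) \<Longrightarrow> sum f B \<in> A"
  by (induction B rule: infinite_finite_induct) (auto simp: A_zero A_add)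

lemmas A_intros = A_zero A_add A_uminus A_mult A_half A_diff A_sum st_A

lemma N_nonneg: "0 \<le> N a"
  using N_add[of a "- a"] by (simp add: N_zero N_uminus)

lemma N_diff: "N (a - b) \<le> N a + N b"
  using N_add[of a "- b"] by (simp add: N_uminus)

lemma N_diff_commute: "N (a - b) = N (b - a)"
  using N_uminus[of "a - b"] by simp

lemma N_diff_triangle: "N (a - c) \<le> N (a - b) + N (b - c)"
  using N_add[of "a - b" "b - c"] by simp

lemma N_sum: "N (sum f B) \<le> (\<Sum>i\<in>B. N (f i))"
proof (induction B rule: infinite_finite_induct)
  case (insert x F)
  then show ?case using N_add[of "f x" "sum f F"] by simp
qed (auto simp: N_zero)

lemma st_zero: "st 0 = 0"
  using st_add[of 0 0] A_zero by simp

lemma st_uminus: "a \<in> A \<Longrightarrow> st (- a) = - st a"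
  using st_add[of a "- a"] A_uminus by (simp add: st_zero eq_neg_iff_add_eq_0 add.commute)

lemma st_diff: "a \<in> A \<Longrightarrow> b \<in> A \<Longrightarrow> st (a - b) = st a - st b"
  using st_add[of a "- b"] A_uminus by (simp add: st_uminus)

lemma st_sum: "(\<And>i. i \<in> B \<Longrightarrow> f i \<in> A) \<Longrightarrow> st (sum f B) = (\<Sum>i\<in>B. st (f i))"
  by (induction B rule: infinite_finite_induct) (auto simp: st_zero st_add A_sum)

lemma half_add: "hf * a + hf * a = a"
  by (metis distrib_right half mult_1)

lemma half_double: "hf * (a + a) = a"
  by (simp add: distrib_left half_add)

lemma half_comm: "hf * a = a * hf"
  by (metis distrib_left half half_double mult.right_neutral mult.assoc)

lemma half_eqI: "x + x = a \<Longrightarrow> x = hf * a"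
  using half_double[of x] by simp

lemma st_half: "a \<in> A \<Longrightarrow> st (hf * a) = hf * st a"
  by (metis A_half half_add half_eqI st_add)

text \<open>Banach iteration from 0 with ratio 1/2. As the whole orbit stays in the ball of radius
  r, \<open>geo\<close> bounds an entire tail by induction on its starting point, and no geometric
  series has to be summed.\<close>

lemma contraction_fixpoint:
  assumes r: "0 \<le> r" and f: "\<And>a. a \<in> A \<Longrightarrow> N a \<le> r \<Longrightarrow> f a \<in> A \<and> N (f a) \<le> r"
    and c: "\<And>a b. a \<in> A \<Longrightarrow> b \<in> A \<Longrightarrow> N a \<le> r \<Longrightarrow> N b \<le> r \<Longrightarrow> N (f a - f b) \<le> N (a - b) / 2"
  shows "\<exists>a\<in>A. N a \<le> r \<and> f a = a"
proof -
  define y where "y = (\<lambda>i. (f ^^ i) 0)"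
  have y: "y i \<in> A \<and> N (y i) \<le> r" for i
    by (induction i) (auto simp: y_def A_zero N_zero r f)
  have ySuc: "y (Suc i) = f (y i)" for i by (simp add: y_def)
  have geo: "N (y (i + k) - y i) \<le> r / 2 ^ i" for i k
  proof (induction i)
    case 0
    then show ?case using y[of k] by (simp add: y_def)
  next
    case (Suc i)
    have "N (y (Suc i + k) - y (Suc i)) \<le> N (y (i + k) - y i) / 2"
      using c[of "y (i + k)" "y i"] y by (simp add: ySuc)
    with Suc show ?case by simp
  qed
  have lim0: "(\<lambda>i. r / 2 ^ i) \<longlonglongrightarrow> 0"
    using LIMSEQ_divide_realpow_zero[of 2 r] by simp
  have "\<exists>a\<in>A. (\<lambda>i. N (y i - a)) \<longlonglongrightarrow> 0"
  proof (rule N_complete)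
    fix e :: real assume "0 < e"
    then obtain M where M: "r / 2 ^ M < e"
      using lim0 r by (auto simp: lim_sequentially dist_real_def)
    have one: "N (y i - y j) < e" if "i \<ge> M" "j \<ge> M" "j \<le> i" for i j
    proof -
      have "N (y i - y j) \<le> r / 2 ^ j" using geo[of j "i - j"] that by simp
      also have "\<dots> \<le> r / 2 ^ M" using that r by (simp add: divide_left_mono power_increasing)
      finally show ?thesis using M by simp
    qed
    show "\<exists>M. \<forall>i\<ge>M. \<forall>j\<ge>M. N (y i - y j) < e"
      using one N_diff_commute by (metis nle_le)
  qed (use y in blast)
  then obtain a where a: "a \<in> A" and lim: "(\<lambda>i. N (y i - a)) \<longlonglongrightarrow> 0" by blast
  have Na: "N a \<le> r"
  proof (rule LIMSEQ_le_const[of "\<lambda>i. r + N (y i - a)"])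
    show "(\<lambda>i. r + N (y i - a)) \<longlonglongrightarrow> r" using tendsto_add[OF tendsto_const lim, of r] by simp
    have "N a \<le> r + N (y i - a)" for i
      using N_diff[of "y i" "y i - a"] y[of i] by simp
    then show "\<exists>M. \<forall>n\<ge>M. N a \<le> r + N (y n - a)" by blast
  qed
  have "N (f a - a) \<le> 0"
  proof (rule LIMSEQ_le_const)
    show "(\<lambda>i. N (y i - a) / 2 + N (y (Suc i) - a)) \<longlonglongrightarrow> 0"
      using tendsto_add[OF tendsto_divide[OF lim tendsto_const, of 2] LIMSEQ_Suc[OF lim]] by simp
    have "N (f a - a) \<le> N (y i - a) / 2 + N (y (Suc i) - a)" for i
    proof -
      have "N (f a - a) \<le> N (f a - f (y i)) + N (f (y i) - a)" by (rule N_diff_triangle)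
      also have "N (f a - f (y i)) \<le> N (a - y i) / 2" using c a Na y by blast
      finally show ?thesis by (simp add: ySuc N_diff_commute)
    qed
    then show "\<exists>M. \<forall>n\<ge>M. N (f a - a) \<le> N (y n - a) / 2 + N (y (Suc n) - a)" by blast
  qed
  then have "N (f a - a) = 0" using N_nonneg[of "f a - a"] by simp
  then have "f a = a" using N_eq_0[of "f a - a"] A_diff f[OF a Na] a by simp
  then show ?thesis using a Na by blast
qed

text \<open>A right inverse solves z = - a - a z and a left inverse w = - a - w a. Both right-hand
  sides are contractions of the unit ball since N a is at most 1/2, and a left inverse equals a
  right inverse. The last bound follows from N z \<le> N a + N z / 2.\<close>

lemma one_add_inverse:
  assumes a: "a \<in> A" and Na: "N a \<le> 1 / 2"
  obtains z where "z \<in> A" "(1 + a) * (1 + z) = 1" "(1 + z) * (1 + a) = 1" "N z \<le> 2 * N a"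
proof -
  have ar: "\<exists>z\<in>A. N z \<le> 1 \<and> - a - a * z = z"
  proof (rule contraction_fixpoint)
    fix z assume z: "z \<in> A" "N z \<le> 1"
    have "N (- a - a * z) \<le> N a + N a * N z"
      using N_diff[of "- a" "a * z"] N_mult[OF a z(1)] by (simp add: N_uminus)
    also have "\<dots> \<le> 1" using Na z mult_mono[of "N a" "1/2" "N z" 1] N_nonneg by simp
    finally show "- a - a * z \<in> A \<and> N (- a - a * z) \<le> 1" using a z by (simp add: A_intros)
  next
    fix z w assume z: "z \<in> A" "w \<in> A"
    have "- a - a * z - (- a - a * w) = a * (w - z)" by (simp add: algebra_simps)
    then have "N (- a - a * z - (- a - a * w)) \<le> N a * N (w - z)"
      using N_mult[of a "w - z"] a z by (simp add: A_diff)
    also have "\<dots> \<le> 1 / 2 * N (z - w)"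
      using Na N_nonneg by (metis N_diff_commute mult_right_mono)
    finally show "N (- a - a * z - (- a - a * w)) \<le> N (z - w) / 2" by simp
  qed simp
  have al: "\<exists>z\<in>A. N z \<le> 1 \<and> - a - z * a = z"
  proof (rule contraction_fixpoint)
    fix z assume z: "z \<in> A" "N z \<le> 1"
    have "N (- a - z * a) \<le> N a + N z * N a"
      using N_diff[of "- a" "z * a"] N_mult[OF z(1) a] by (simp add: N_uminus)
    also have "\<dots> \<le> 1" using Na z mult_mono[of "N z" 1 "N a" "1/2"] N_nonneg by simp
    finally show "- a - z * a \<in> A \<and> N (- a - z * a) \<le> 1" using a z by (simp add: A_intros)
  next
    fix z w assume z: "z \<in> A" "w \<in> A"
    have "- a - z * a - (- a - w * a) = (w - z) * a" by (simp add: algebra_simps)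
    then have "N (- a - z * a - (- a - w * a)) \<le> N (w - z) * N a"
      using N_mult[of "w - z" a] a z by (simp add: A_diff)
    also have "\<dots> \<le> N (z - w) * (1 / 2)"
      using Na N_nonneg by (metis N_diff_commute mult_left_mono)
    finally show "N (- a - z * a - (- a - w * a)) \<le> N (z - w) / 2" by simp
  qed simp
  obtain z where z: "z \<in> A" "N z \<le> 1" "- a - a * z = z" using ar by blast
  obtain w where w: "w \<in> A" "- a - w * a = w" using al by blast
  have "(1 + a) * (1 + z) = 1 + (z - (- a - a * z))" by (simp add: algebra_simps)
  then have r: "(1 + a) * (1 + z) = 1" using z(3) by simp
  have "(1 + w) * (1 + a) = 1 + (w - (- a - w * a))" by (simp add: algebra_simps)
  then have l: "(1 + w) * (1 + a) = 1" using w(2) by simp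
  have "1 + w = 1 + z" by (metis l r mult.assoc mult_1 mult.right_neutral)
  then have l': "(1 + z) * (1 + a) = 1" using l by simp
  have "N z \<le> N a + N a * N z"
    using N_diff[of "- a" "a * z"] N_mult[OF a z(1)] z(3) by (simp add: N_uminus)
  also have "\<dots> \<le> N a + 1 / 2 * N z" using mult_right_mono[OF Na N_nonneg[of z]] by simp
  finally show ?thesis using that[OF z(1) r l'] by simp
qed

end

section \<open>Block Cholesky factors along a chain of projections\<close>

locale projection_chain = star_algebra A N st hf
  for A :: "'a::{ring,monoid_mult} set" and N st hf +
  fixes P :: "nat \<Rightarrow> 'a" and m :: nat
  assumes P_A: "j \<le> m \<Longrightarrow> P j \<in> A"
    and P_0: "P 0 = 0"
    and P_unit: "a \<in> A \<Longrightarrow> P m * a = a" "a \<in> A \<Longrightarrow> a * P m = a"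
    and st_P: "j \<le> m \<Longrightarrow> st (P j) = P j"
    and P_mult: "i \<le> j \<Longrightarrow> j \<le> m \<Longrightarrow> P i * P j = P i" "i \<le> j \<Longrightarrow> j \<le> m \<Longrightarrow> P j * P i = P i"
begin

definition E :: "nat \<Rightarrow> 'a" where "E j = P (Suc j) - P j"

text \<open>With \<open>E j\<close> as the block projections, half of
  \<open>(P j + P (Suc j)) * X * E j\<close> is \<open>P j * X * E j\<close> plus half of
  \<open>E j * X * E j\<close>. So \<open>psi\<close> keeps the strictly upper block triangle of X
  and half of its block diagonal, which solves the linearized Cholesky equation
  \<open>y + st y = X\<close>.\<close>

definition psi :: "'a \<Rightarrow> 'a" where
  "psi X = hf * (\<Sum>j<m. (P j + P (Suc j)) * X * E j)"

definition psi_bound :: real where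
  "psi_bound = (\<Sum>j<m. N (P j + P (Suc j)) * N (E j))"

lemma E_A: "j < m \<Longrightarrow> E j \<in> A"
  unfolding E_def by (intro A_diff P_A) auto

lemma psi_A: "X \<in> A \<Longrightarrow> psi X \<in> A"
  unfolding psi_def by (intro A_intros P_A E_A) auto

lemma sum_E: "(\<Sum>j<m. E j) = P m"
  unfolding E_def using sum_lessThan_telescope[of P m] by (simp add: P_0)

lemma st_E: "j < m \<Longrightarrow> st (E j) = E j"
  unfolding E_def by (simp add: st_diff P_A st_P)

lemma psi_diff: "psi (X - Y) = psi X - psi Y"
  unfolding psi_def by (simp add: algebra_simps sum_subtractf)

lemma psi_add: "psi (X + Y) = psi X + psi Y"
  unfolding psi_def by (simp add: algebra_simps sum.distrib)

lemma psi_bound_nonneg: "0 \<le> psi_bound"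
  unfolding psi_bound_def by (intro sum_nonneg mult_nonneg_nonneg N_nonneg)

lemma N_psi: assumes X: "X \<in> A" shows "N (psi X) \<le> psi_bound * N X"
proof -
  let ?f = "\<lambda>j. (P j + P (Suc j)) * X * E j"
  have "N (psi X) \<le> N (\<Sum>j<m. ?f j)"
    unfolding psi_def using X by (intro N_half A_sum A_mult A_add P_A E_A) auto
  also have "\<dots> \<le> (\<Sum>j<m. N (?f j))" by (rule N_sum)
  also have "\<dots> \<le> (\<Sum>j<m. N (P j + P (Suc j)) * N (E j) * N X)"
  proof (rule sum_mono)
    fix j assume "j \<in> {..<m}"
    then have mem: "P j + P (Suc j) \<in> A" "E j \<in> A" by (auto intro!: A_add P_A E_A)
    have "N (?f j) \<le> N ((P j + P (Suc j)) * X) * N (E j)"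
      using mem X by (intro N_mult A_mult)
    also have "\<dots> \<le> (N (P j + P (Suc j)) * N X) * N (E j)"
      using mem X by (intro mult_right_mono N_mult N_nonneg)
    finally show "N (?f j) \<le> N (P j + P (Suc j)) * N (E j) * N X" by (simp add: mult_ac)
  qed
  finally show ?thesis by (simp add: psi_bound_def sum_distrib_right)
qed

lemma psi_add_st:
  assumes X: "X \<in> A" and sX: "st X = X"
  shows "psi X + st (psi X) = X"
proof -
  have mem: "P j + P (Suc j) \<in> A" "E j \<in> A" if "j < m" for j
    using that by (auto intro!: A_add P_A E_A)
  have "st (psi X) = hf * (\<Sum>j<m. st ((P j + P (Suc j)) * X * E j))"
  proof -
    have "(P j + P (Suc j)) * X * E j \<in> A" if "j < m" for j using mem[OF that] X by (intro A_mult)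
    then show ?thesis unfolding psi_def by (subst st_half, (auto intro!: A_sum)[1], subst st_sum) auto
  qed
  also have "(\<Sum>j<m. st ((P j + P (Suc j)) * X * E j)) = (\<Sum>j<m. E j * X * (P j + P (Suc j)))"
    using X mem by (intro sum.cong refl)
      (simp add: st_mult A_mult sX st_E mult.assoc st_add P_A st_P)
  finally have "psi X + st (psi X)
      = hf * (\<Sum>j<m. (P j + P (Suc j)) * X * E j + E j * X * (P j + P (Suc j)))"
    by (simp add: psi_def distrib_left sum.distrib)
  \<comment> \<open>The mixed terms cancel, and the rest telescopes to twice
    \<open>P m * X * P m\<close>.\<close>
  also have "(\<Sum>j<m. (P j + P (Suc j)) * X * E j + E j * X * (P j + P (Suc j)))
      = (\<Sum>j<m. (P (Suc j) * X * P (Suc j) + P (Suc j) * X * P (Suc j)) - (P j * X * P j + P j * X * P j))"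
    by (intro sum.cong refl) (simp add: E_def algebra_simps)
  also have "\<dots> = X + X"
    using X sum_lessThan_telescope[of "\<lambda>j. P j * X * P j + P j * X * P j" m] by (simp add: P_0 P_unit)
  finally show ?thesis by (simp add: half_double)
qed

lemma E_P: "j < m \<Longrightarrow> i \<le> m \<Longrightarrow> E j * P i = (if i \<le> j then 0 else E j)"
  unfolding E_def by (auto simp: left_diff_distrib P_mult)

lemma P_E: "j < m \<Longrightarrow> i \<le> m \<Longrightarrow> P i * E j = (if i \<le> j then 0 else E j)"
  unfolding E_def by (auto simp: right_diff_distrib P_mult)

lemma E_E: "i < m \<Longrightarrow> j < m \<Longrightarrow> E i * E j = (if i = j then E i else 0)"
  by (subst (2) E_def) (auto simp: right_diff_distrib E_P)

text \<open>The first condition says that y maps the range of each \<open>P i\<close> into itself.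
  Self-adjoint diagonal blocks normalize the factor 1 + y, which could otherwise be multiplied on
  the left by a block diagonal unitary.\<close>

definition triangular :: "'a \<Rightarrow> bool" where
  "triangular y \<longleftrightarrow> y \<in> A \<and> (\<forall>i\<le>m. P i * y * P i = y * P i) \<and>
     (\<forall>i<m. st (E i * y * E i) = E i * y * E i)"

lemma half_left: "a * (hf * b) = hf * (a * b)"
  by (metis half_comm mult.assoc)

lemma triangular_psi:
  assumes X: "X \<in> A" and sX: "st X = X"
  shows "triangular (psi X)"
proof -
  have up: "P i * psi X * P i = psi X * P i" if i: "i \<le> m" for i
  proof -
    have "P i * ((P j + P (Suc j)) * X * E j) * P i = (P j + P (Suc j)) * X * E j * P i"
      if j: "j < m" for j
    proof (cases "i \<le> j")
      case True
      then show ?thesis using i j by (simp add: mult.assoc E_P)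
    next
      case False
      then have "P i * (P j + P (Suc j)) = P j + P (Suc j)"
        using i j by (simp add: distrib_left P_mult)
      then show ?thesis by (simp add: mult.assoc[symmetric])
    qed
    then have "(\<Sum>j<m. P i * ((P j + P (Suc j)) * X * E j) * P i)
        = (\<Sum>j<m. (P j + P (Suc j)) * X * E j * P i)" by simp
    then have "P i * (\<Sum>j<m. (P j + P (Suc j)) * X * E j) * P i
        = (\<Sum>j<m. (P j + P (Suc j)) * X * E j) * P i"
      by (simp add: sum_distrib_left sum_distrib_right)
    then show ?thesis unfolding psi_def by (simp add: half_left mult.assoc)
  qed
  have dg: "E i * psi X * E i = hf * (E i * X * E i)" if i: "i < m" for i
  proof -
    have "E i * (\<Sum>j<m. (P j + P (Suc j)) * X * E j) * E i
        = (\<Sum>j<m. E i * (P j + P (Suc j)) * X * (E j * E i))"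
      by (simp add: sum_distrib_left sum_distrib_right mult.assoc)
    also have "\<dots> = (\<Sum>j<m. if j = i then E i * X * E i else 0)"
      using i by (intro sum.cong refl) (auto simp: E_E distrib_left distrib_right E_P mult.assoc)
    also have "\<dots> = E i * X * E i" using i by simp
    finally show ?thesis unfolding psi_def by (simp add: half_left mult.assoc)
  qed
  have "st (E i * psi X * E i) = E i * psi X * E i" if i: "i < m" for i
    using i X unfolding dg[OF i] by (simp add: st_half A_mult E_A st_mult st_E sX mult.assoc)
  then show ?thesis using up psi_A[OF X] by (simp add: triangular_def)
qed

lemma triangularD:
  assumes "triangular y"
  shows "y \<in> A" "i \<le> m \<Longrightarrow> P i * (y * P i) = y * P i" "i \<le> m \<Longrightarrow> P i * st y * P i = P i * st y"
    and "i < m \<Longrightarrow> st (E i * y * E i) = E i * y * E i"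
proof -
  show yA: "y \<in> A" using assms by (simp add: triangular_def)
  show a: "P i * (y * P i) = y * P i" if "i \<le> m" for i using assms that by (simp add: triangular_def mult.assoc)
  show "P i * st y * P i = P i * st y" if "i \<le> m"
  proof -
    have "st (P i * (y * P i)) = st (y * P i)" using a[OF that] by simp
    then show ?thesis using that yA by (simp add: st_mult P_A A_mult st_P)
  qed
  show "i < m \<Longrightarrow> st (E i * y * E i) = E i * y * E i" using assms by (simp add: triangular_def)
qed

text \<open>As \<open>st y\<close> is lower triangular, \<open>y + st y\<close> agrees with y on
  strictly upper blocks, while a self-adjoint diagonal block occurs twice and is halved by
  \<open>psi\<close>. So \<open>psi\<close> inverts y \<mapsto> \<open>y + st y\<close> on
  triangular elements; uniqueness of the factor rests on this.\<close>

lemma psi_triangular: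
  assumes y: "triangular y" shows "psi (y + st y) = y"
proof -
  note yA = triangularD(1)[OF y]
  have "(P j + P (Suc j)) * (y + st y) * E j = y * E j + y * E j" if j: "j < m" for j
  proof -
    have E: "E j = P (Suc j) * E j" using j by (simp add: P_E)
    have "P (Suc j) * (y * E j) = P (Suc j) * (y * (P (Suc j) * E j))" using E by simp
    also have "\<dots> = P (Suc j) * (y * P (Suc j)) * E j" by (simp only: mult.assoc)
    also have "\<dots> = y * P (Suc j) * E j" using triangularD(2)[OF y, of "Suc j"] j by simp
    also have "\<dots> = y * E j" using arg_cong[OF E, of "(*) y"] by (simp add: mult.assoc)
    finally have a: "P (Suc j) * (y * E j) = y * E j" .
    have b: "P j * (y * E j) = y * E j - E j * y * E j"
    proof -
      have "P j = P (Suc j) - E j" by (simp add: E_def)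
      then have "P j * (y * E j) = P (Suc j) * (y * E j) - E j * (y * E j)" by (simp add: left_diff_distrib)
      then show ?thesis using a by (simp add: mult.assoc)
    qed
    have "P j * st y * E j = P j * st y * P j * E j" using triangularD(3)[OF y, of j] j by simp
    also have "\<dots> = 0" using j by (simp add: mult.assoc P_E)
    finally have c: "P j * (st y * E j) = 0" by (simp add: mult.assoc)
    have "P (Suc j) * (st y * E j) = E j * (st y * E j) + P j * (st y * E j)"
      by (simp add: E_def algebra_simps)
    also have "\<dots> = st (E j * y * E j)" using c j yA by (simp add: st_mult A_mult E_A st_E mult.assoc)
    also have "\<dots> = E j * y * E j" using triangularD(4)[OF y j] .
    finally have d: "P (Suc j) * (st y * E j) = E j * y * E j" .
    show ?thesis using a b c d by (simp add: distrib_left distrib_right mult.assoc)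
  qed
  then have "psi (y + st y) = hf * (\<Sum>j<m. y * E j + y * E j)" unfolding psi_def by simp
  also have "(\<Sum>j<m. y * E j + y * E j) = y + y"
    using yA by (simp add: sum.distrib sum_distrib_left[symmetric] sum_E P_unit)
  finally show ?thesis by (simp add: half_double)
qed

lemma quadratic_diff:
  assumes "y \<in> A" "y' \<in> A" "N y \<le> r" "N y' \<le> r"
  shows "N (st y * y - st y' * y') \<le> 2 * r * N (y - y')"
proof -
  have "st y * y - st y' * y' = st (y - y') * y + st y' * (y - y')"
    using assms by (simp add: st_diff algebra_simps)
  then have "N (st y * y - st y' * y') \<le> N (st (y - y')) * N y + N (st y') * N (y - y')"
    using N_add[of "st (y - y') * y" "st y' * (y - y')"] N_mult[of "st (y - y')" y]
      N_mult[of "st y'" "y - y'"] assms by (simp add: A_diff st_A)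
  also have "\<dots> \<le> N (y - y') * r + r * N (y - y')"
    using assms by (intro add_mono mult_mono) (auto simp: N_st A_diff N_nonneg intro: order_trans[OF N_nonneg])
  finally show ?thesis by simp
qed

text \<open>A block Cholesky decomposition \<open>1 + X = (1 + y)\<^sup>* (1 + y)\<close>; the fixed point
  equation \<open>y = psi (X - y\<^sup>* y)\<close> forces \<open>y + y\<^sup>* = X - y\<^sup>* y\<close> since \<open>psi Z + (psi Z)\<^sup>* = Z\<close>.\<close>

lemma cholesky_exists:
  assumes r: "0 < r" "psi_bound * r \<le> 1 / 4" and X: "X \<in> A" "st X = X" "psi_bound * N X \<le> r / 2"
  shows "\<exists>y. triangular y \<and> N y \<le> r \<and> y + st y + st y * y = X"
proof -
  have "\<exists>y\<in>A. N y \<le> r \<and> psi (X - st y * y) = y"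
  proof (rule contraction_fixpoint)
    fix y assume y: "y \<in> A" "N y \<le> r"
    have mem: "X - st y * y \<in> A" using X y by (intro A_intros)
    have "N (st y * y) \<le> N y * N y" using N_mult[of "st y" y] y by (simp add: st_A N_st)
    also have "\<dots> \<le> r * r" using y r N_nonneg by (intro mult_mono) auto
    finally have "N (X - st y * y) \<le> N X + r * r" using N_diff[of X "st y * y"] by simp
    then have "N (psi (X - st y * y)) \<le> psi_bound * (N X + r * r)"
      using N_psi[OF mem] psi_bound_nonneg by (meson mult_left_mono order_trans)
    also have "\<dots> = psi_bound * N X + psi_bound * r * r" by (simp add: distrib_left)
    \<comment> \<open>Half of the radius is spent on X, a quarter on the quadratic term. The
      contraction ratio 1/2 below comes from the same bound
      \<open>psi_bound * r \<le> 1 / 4\<close>.\<close>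
    also have "\<dots> \<le> r / 2 + (1 / 4) * r"
      using r by (intro add_mono X(3) mult_right_mono) auto
    finally show "psi (X - st y * y) \<in> A \<and> N (psi (X - st y * y)) \<le> r"
      using psi_A[OF mem] r(1) by simp
  next
    fix y y' assume y: "y \<in> A" "y' \<in> A" "N y \<le> r" "N y' \<le> r"
    have "psi (X - st y * y) - psi (X - st y' * y') = psi (st y' * y' - st y * y)"
      by (simp add: psi_diff[symmetric])
    then have "N (psi (X - st y * y) - psi (X - st y' * y')) \<le> psi_bound * (2 * r * N (y' - y))"
      using N_psi[of "st y' * y' - st y * y"] quadratic_diff[OF y(2,1,4,3)] psi_bound_nonneg y
      by (smt (verit) A_diff A_mult st_A mult_left_mono)
    also have "\<dots> = 2 * (psi_bound * r) * N (y - y')" by (simp add: N_diff_commute)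
    also have "\<dots> \<le> 2 * (1 / 4) * N (y - y')" using r(2) N_nonneg by (intro mult_right_mono) auto
    finally show "N (psi (X - st y * y) - psi (X - st y' * y')) \<le> N (y - y') / 2" by simp
  qed (use r in simp)
  then obtain y where y: "y \<in> A" "N y \<le> r" "psi (X - st y * y) = y" by blast
  have Z: "X - st y * y \<in> A" "st (X - st y * y) = X - st y * y"
    using X y by (auto simp: A_intros st_diff st_mult st_st)
  have "y + st y = X - st y * y" using psi_add_st[OF Z] y(3) by simp
  moreover have "triangular y" using triangular_psi[OF Z] y(3) by simp
  ultimately show ?thesis using y(2) by (metis diff_add_cancel)
qed

text \<open>Through \<open>psi\<close> the difference of the two equations expresses y - y' by a
  difference of quadratic terms, and on the ball of radius r this costs a factor of at most
  1/2.\<close>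

lemma cholesky_unique:
  assumes r: "psi_bound * r \<le> 1 / 4"
    and y: "triangular y" "N y \<le> r" and y': "triangular y'" "N y' \<le> r"
    and eq: "y + st y + st y * y = y' + st y' + st y' * y'"
  shows "y = y'"
proof -
  have "y - y' = psi (y + st y) - psi (y' + st y')" using y y' by (simp add: psi_triangular)
  also have "y + st y = (y' + st y') + (st y' * y' - st y * y)"
    using eq by (metis add_diff_cancel_right' add_diff_eq)
  finally have e: "y - y' = psi (st y' * y' - st y * y)"
    by (simp add: psi_add)
  note A = triangularD(1)[OF y(1)] triangularD(1)[OF y'(1)]
  have "N (y - y') \<le> psi_bound * (2 * r * N (y' - y))"
    unfolding e using N_psi[of "st y' * y' - st y * y"] quadratic_diff[OF A(2,1) y'(2) y(2)] psi_bound_nonneg A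
    by (smt (verit) A_diff A_mult st_A mult_left_mono)
  also have "\<dots> = 2 * (psi_bound * r) * N (y - y')" by (simp add: N_diff_commute)
  also have "\<dots> \<le> 2 * (1 / 4) * N (y - y')" using r N_nonneg by (intro mult_right_mono) auto
  finally have "N (y - y') = 0" using N_nonneg[of "y - y'"] by simp
  then show ?thesis using N_eq_0[of "y - y'"] A by (simp add: A_diff)
qed

end

context projection_chain begin

text \<open>The lower block q = (1 - \<open>P i\<close>) w \<open>P i\<close> of the inverse
  satisfies q = - (y - \<open>P i * y\<close>) q, where the factor has norm below 1; hence q = 0.
  The smallness condition takes the place of the dimension count that would be used for
  matrices.\<close>

lemma triangular_inverse_upper:
  assumes y: "triangular y" and small: "\<And>i. i \<le> m \<Longrightarrow> (1 + N (P i)) * N y < 1"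
    and w: "w \<in> A" "y + w + y * w = 0" and i: "i \<le> m"
  shows "P i * (w * P i) = w * P i"
proof -
  note yA = triangularD(1)[OF y]
  define q where "q = w * P i - P i * (w * P i)"
  have qA: "q \<in> A" unfolding q_def using w i by (intro A_intros P_A)
  have yP: "P i * (y * P i) = y * P i" using triangularD(2)[OF y i] .
  have "(y + w + y * w) * P i - P i * (y + w + y * w) * P i = 0" using w by simp
  then have "q + (y * w * P i - P i * (y * (w * P i))) = 0"
    unfolding q_def using yP by (simp add: algebra_simps)
  moreover have "(y - P i * y) * q = y * w * P i - P i * (y * (w * P i))"
  proof -
    have z: "(y - P i * y) * P i = 0" using yP by (simp add: left_diff_distrib mult.assoc)
    have "(y - P i * y) * q = (y - P i * y) * (w * P i) - (y - P i * y) * (P i * (w * P i))"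
      unfolding q_def by (rule right_diff_distrib)
    also have "(y - P i * y) * (P i * (w * P i)) = 0"
      using z by (simp only: mult.assoc[symmetric] mult_zero_left)
    finally show ?thesis by (simp add: left_diff_distrib mult.assoc)
  qed
  ultimately have q: "q = - ((y - P i * y) * q)" by (metis add_eq_0_iff2 minus_minus)
  have mem: "y - P i * y \<in> A" using yA i by (intro A_intros P_A)
  have "N q \<le> N (y - P i * y) * N q"
    using N_mult[OF mem qA] by (metis N_uminus q)
  moreover have "N (y - P i * y) < 1"
  proof -
    have "N (y - P i * y) \<le> N y + N (P i) * N y"
      using N_diff[of y "P i * y"] N_mult[OF P_A[OF i] yA] by simp
    then show ?thesis using small[OF i] by (simp add: algebra_simps)
  qed
  ultimately have "N q = 0"
    using N_nonneg[of q] by (metis less_le_not_le mult_1 mult_right_mono mult_strict_right_mono order_less_le)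
  then have "q = 0" using N_eq_0 qA by blast
  then show ?thesis by (simp add: q_def)
qed

text \<open>Compression to a diagonal block is multiplicative on block triangular elements
  (\<open>split\<close>). So 1 + c is the inverse of 1 + a with a self-adjoint, and the adjoint of
  an inverse is the inverse of the adjoint.\<close>

lemma triangular_inverse_diagonal:
  assumes y: "triangular y"
    and w: "w \<in> A" "y + w + y * w = 0" "w + y + w * y = 0"
    and up: "\<And>i. i \<le> m \<Longrightarrow> P i * (w * P i) = w * P i" and i: "i < m"
  shows "st (E i * w * E i) = E i * w * E i"
proof -
  note yA = triangularD(1)[OF y]
  define a c where "a = E i * y * E i" and "c = E i * w * E i"
  have A: "a \<in> A" "c \<in> A" unfolding a_def c_def using yA w i by (auto intro!: A_mult E_A)
  have split: "E i * (u * (v * E i)) = (E i * u * E i) * (E i * v * E i)"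
    if u: "P i * (u * P i) = u * P i" and v: "P (Suc i) * (v * P (Suc i)) = v * P (Suc i)" for u v
  proof -
    have E: "P (Suc i) * E i = E i" and E0: "E i * P i = 0" and EE: "E i * (E i * x) = E i * x" for x
      using i by (simp_all add: P_E E_P E_E mult.assoc[symmetric])
    have "v * E i = v * P (Suc i) * E i" using E by (simp add: mult.assoc)
    also have "\<dots> = P (Suc i) * (v * E i)" using v E by (metis mult.assoc)
    finally have v': "v * E i = P (Suc i) * (v * E i)" .
    have "E i * u * P i = E i * (P i * (u * P i))" using u by (simp only: mult.assoc)
    also have "\<dots> = 0" using E0 by (simp only: mult.assoc[symmetric] mult_zero_left)
    finally have "E i * u * P i = 0" .
    moreover have PS: "P (Suc i) = E i + P i" by (simp add: E_def)
    ultimately have u': "E i * u * P (Suc i) = E i * u * E i" by (simp only: PS distrib_left add_0_right)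
    have "E i * (u * (v * E i)) = E i * u * (P (Suc i) * (v * E i))" using v' by (metis mult.assoc)
    also have "\<dots> = E i * u * P (Suc i) * (v * E i)" by (simp only: mult.assoc)
    also have "\<dots> = E i * u * E i * (v * E i)" using u' by simp
    also have "\<dots> = (E i * u * E i) * (E i * v * E i)" by (simp add: mult.assoc EE)
    finally show ?thesis .
  qed
  have e1: "a + c + a * c = 0"
  proof -
    have "E i * (y * (w * E i)) = a * c"
      unfolding a_def c_def using i by (intro split triangularD(2)[OF y] up) auto
    moreover have "E i * (y + w + y * w) * E i = 0" using w by simp
    ultimately show ?thesis by (simp add: a_def c_def algebra_simps)
  qed
  have e2: "c + a + c * a = 0"
  proof -
    have "E i * (w * (y * E i)) = c * a"
      unfolding a_def c_def using i by (intro split triangularD(2)[OF y] up) auto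
    moreover have "E i * (w + y + w * y) * E i = 0" using w by simp
    ultimately show ?thesis by (simp add: a_def c_def algebra_simps)
  qed
  have sa: "st a = a" unfolding a_def using triangularD(4)[OF y i] .
  have "st (a + c + a * c) = 0" using e1 by (simp add: st_zero)
  then have e3: "a + st c + st c * a = 0" using A sa by (simp add: st_add st_mult A_mult A_add)
  have "(1 + st c) * (1 + a) = 1 + (a + st c + st c * a)" by (simp add: algebra_simps)
  then have f3: "(1 + st c) * (1 + a) = 1" using e3 by simp
  have "(1 + a) * (1 + c) = 1 + (a + c + a * c)" by (simp add: algebra_simps)
  then have f1: "(1 + a) * (1 + c) = 1" using e1 by simp
  have "1 + st c = 1 + c" by (metis f1 f3 mult.assoc mult_1 mult.right_neutral)
  then show ?thesis by (simp add: c_def)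
qed

end

section \<open>Chains stable under a second involution\<close>

text \<open>\<open>tau\<close> stands for conjugation by the antilinear \<sigma>, so that
  \<open>tau (st a)\<close> is the adjoint of a for b. By \<open>tau_P\<close>, \<sigma> takes the
  range of \<open>P i\<close> to the h-orthogonal complement of the range of
  \<open>P (m - i)\<close>. Equivalently, the b-orthogonal complement of the i-th member is the (m -
  i)-th member.\<close>

locale twisted_chain = projection_chain A N st hf P m
  for A :: "'a::{ring,monoid_mult} set" and N st hf P m +
  fixes tau :: "'a \<Rightarrow> 'a"
  assumes tau_A: "a \<in> A \<Longrightarrow> tau a \<in> A"
    and tau_add: "tau (a + b) = tau a + tau b"
    and tau_mult: "tau (a * b) = tau a * tau b"
    and tau_tau: "tau (tau a) = a"
    and N_tau: "a \<in> A \<Longrightarrow> N (tau a) = N a"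
    and st_tau: "a \<in> A \<Longrightarrow> st (tau a) = tau (st a)"
    and tau_P: "i \<le> m \<Longrightarrow> tau (P i) = P m - P (m - i)"
begin

lemma tau_zero: "tau 0 = 0"
  using tau_add[of 0 0] by simp

lemma tau_uminus: "tau (- a) = - tau a"
  using tau_add[of a "- a"] by (simp add: tau_zero eq_neg_iff_add_eq_0 add.commute)

lemma tau_diff: "tau (a - b) = tau a - tau b"
  using tau_add[of a "- b"] by (simp add: tau_uminus)

text \<open>\<open>st\<close> makes an upper triangular element lower triangular, and
  \<open>tau\<close> reverses the order of the blocks, taking block \<open>m - Suc j\<close> to
  block j. Together they preserve the upper triangular shape.\<close>

lemma triangular_tau_st:
  assumes w: "w \<in> A" and up: "\<And>i. i \<le> m \<Longrightarrow> P i * (w * P i) = w * P i"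
    and dg: "\<And>i. i < m \<Longrightarrow> st (E i * w * E i) = E i * w * E i"
  shows "triangular (tau (st w))"
proof -
  let ?y = "tau (st w)"
  have yA: "?y \<in> A" using w by (intro tau_A st_A)
  have "P i * ?y * P i = ?y * P i" if i: "i \<le> m" for i
  proof -
    let ?Q = "P (m - i)"
    have mi: "m - i \<le> m" "m - (m - i) = i" using i by auto
    have "st (?Q * (w * ?Q)) = st (w * ?Q)" using up[OF mi(1)] by simp
    then have "?Q * st w * ?Q = ?Q * st w" using w mi by (simp add: st_mult P_A A_mult st_P)
    then have "tau (?Q * st w * ?Q) = tau (?Q * st w)" by simp
    then have "(P m - P i) * ?y * (P m - P i) = (P m - P i) * ?y"
      using tau_P[OF mi(1)] mi by (simp add: tau_mult)
    then show ?thesis using yA i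
      by (simp add: left_diff_distrib right_diff_distrib P_unit P_A A_mult mult.assoc[symmetric])
  qed
  moreover have "st (E j * ?y * E j) = E j * ?y * E j" if j: "j < m" for j
  proof -
    let ?i = "m - Suc j"
    have i: "?i < m" "Suc ?i = m - j" "m - (m - j) = j" "m - ?i = Suc j" "m - j \<le> m" using j by auto
    have "tau (E ?i) = tau (P (m - j)) - tau (P ?i)" using i by (simp add: E_def tau_diff)
    also have "\<dots> = E j" using tau_P[OF i(5)] tau_P[of ?i] i by (simp add: E_def)
    finally have t: "tau (E ?i) = E j" .
    have "E j * ?y * E j = tau (E ?i * st w * E ?i)" by (simp add: tau_mult t)
    also have "E ?i * st w * E ?i = E ?i * w * E ?i"
      using dg[OF i(1)] w i(1) by (simp add: st_mult A_mult E_A st_E mult.assoc)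
    finally have eq: "E j * ?y * E j = tau (E ?i * w * E ?i)" .
    show ?thesis unfolding eq using dg[OF i(1)] st_tau[of "E ?i * w * E ?i"] w i(1)
      by (simp add: A_mult E_A)
  qed
  ultimately show ?thesis using yA by (simp add: triangular_def)
qed

text \<open>If \<open>1 + X\<close> is fixed by the involution \<open>a \<mapsto> tau (a\<^sup>-\<^sup>1)\<close>, then \<open>a \<mapsto> tau (a\<^sup>*)\<^sup>-\<^sup>1\<close> maps its
  Cholesky factor to another one, hence fixes it by uniqueness.\<close>

lemma cholesky_twisted:
  assumes r: "psi_bound * (2 * r) \<le> 1 / 4" "\<And>i. i \<le> m \<Longrightarrow> (1 + N (P i)) * r < 1"
    and y: "triangular y" "N y \<le> r" and w: "w \<in> A" "(1 + y) * (1 + w) = 1" "(1 + w) * (1 + y) = 1" "N w \<le> 2 * N y"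
    and eq: "y + st y + st y * y = X"
    and z: "(1 + z) * (1 + X) = 1" "tau z = X"
  shows "tau (st y) = w"
proof -
  note yA = triangularD(1)[OF y(1)]
  have w1: "y + w + y * w = 0" and w2: "w + y + w * y = 0"
    using w by (simp_all add: algebra_simps)
  have small: "(1 + N (P i)) * N y < 1" if "i \<le> m" for i
  proof -
    have "(1 + N (P i)) * N y \<le> (1 + N (P i)) * r" using y(2) N_nonneg[of "P i"] by (intro mult_left_mono) auto
    then show ?thesis using r(2)[OF that] by simp
  qed
  have up: "P i * (w * P i) = w * P i" if "i \<le> m" for i
    by (rule triangular_inverse_upper[OF y(1) small w(1) w1 that])
  have tri: "triangular (tau (st w))"
    by (rule triangular_tau_st[OF w(1) up triangular_inverse_diagonal[OF y(1) w(1) w1 w2 up]])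
  have inv: "(1 + w) * (1 + st w) = 1 + z"
  proof -
    have "st (w + y + w * y) = 0" using w2 by (simp add: st_zero)
    then have s: "st y + st w + st y * st w = 0" using w yA by (simp add: st_add st_mult A_mult A_add add_ac)
    have "(1 + X) * ((1 + w) * (1 + st w)) = (1 + st y) * ((1 + y) * (1 + w)) * (1 + st w)"
      by (simp add: eq[symmetric] algebra_simps)
    also have "\<dots> = (1 + st y) * (1 + st w)" using w by simp
    also have "\<dots> = 1 + (st y + st w + st y * st w)" by (simp add: algebra_simps)
    finally have "(1 + X) * ((1 + w) * (1 + st w)) = 1" using s by simp
    then show ?thesis using z(1) by (metis mult.assoc mult_1 mult.right_neutral)
  qed
  have "w + st w + w * st w = z" using inv by (simp add: algebra_simps)
  then have "tau (w + st w + w * st w) = X" using z by simp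
  then have "y + st y + st y * y = tau (st w) + st (tau (st w)) + st (tau (st w)) * tau (st w)"
    using w(1) eq by (simp add: tau_add tau_mult st_tau st_A st_st add_ac)
  moreover have "N (tau (st w)) \<le> 2 * r" using w y by (simp add: N_tau st_A N_st)
  moreover have "N y \<le> 2 * r" using y(2) N_nonneg[of y] by simp
  \<comment> \<open>The norm of w is only bounded by 2 N y, so uniqueness is applied on the ball of
    radius 2 r.\<close>
  ultimately have "y = tau (st w)" by (intro cholesky_unique[OF r(1) y(1) _ tri])
  then have "tau (st y) = tau (st (tau (st w)))" by simp
  also have "\<dots> = w" using w(1) by (simp add: st_tau st_A st_st tau_tau)
  finally show ?thesis .
qed

end

section \<open>Isometries that move a chain in the same way as a given element\<close>

context projection_chain begin

lemma cholesky_factor: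
  assumes "0 < r" "psi_bound * r \<le> 1 / 4" "r \<le> 1 / 2"
  obtains d where "0 < d" "d \<le> r"
    "\<And>k. k \<in> A \<Longrightarrow> N k \<le> d \<Longrightarrow> \<exists>y w. triangular y \<and> N y \<le> r \<and> y + st y + st y * y = k + st k + st k * k
      \<and> w \<in> A \<and> (1 + y) * (1 + w) = 1 \<and> (1 + w) * (1 + y) = 1 \<and> N w \<le> 2 * N y"
proof -
  \<comment> \<open>The norm of \<open>k + st k + st k * k\<close> is at most 3 d, and 3 d
    (\<open>psi_bound\<close> + 1) = r / 2 is the size that \<open>cholesky_exists\<close>
    admits.\<close>
  define d where "d = r / (6 * (psi_bound + 1))"
  have d: "0 < d" "d \<le> r" unfolding d_def using assms psi_bound_nonneg by (auto simp: divide_simps)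
  have "\<exists>y w. triangular y \<and> N y \<le> r \<and> y + st y + st y * y = k + st k + st k * k
      \<and> w \<in> A \<and> (1 + y) * (1 + w) = 1 \<and> (1 + w) * (1 + y) = 1 \<and> N w \<le> 2 * N y"
    if k: "k \<in> A" "N k \<le> d" for k
  proof -
    let ?X = "k + st k + st k * k"
    have X: "?X \<in> A" "st ?X = ?X" using k by (auto simp: A_intros st_add st_mult st_st add_ac)
    have "N ?X \<le> N k + N (st k) + N (st k) * N k"
      using N_add[of "k + st k" "st k * k"] N_add[of k "st k"] N_mult[of "st k" k] k by (simp add: st_A)
    also have "\<dots> \<le> d + d + 1 * d" using k d assms N_nonneg by (intro add_mono mult_mono) (auto simp: N_st)
    finally have "psi_bound * N ?X \<le> (psi_bound + 1) * (3 * d)"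
      using psi_bound_nonneg N_nonneg by (intro mult_mono) auto
    also have "\<dots> = r / 2" unfolding d_def using psi_bound_nonneg by (simp add: field_simps)
    finally obtain y where y: "triangular y" "N y \<le> r" "y + st y + st y * y = ?X"
      using cholesky_exists[OF assms(1,2) X] by blast
    then show ?thesis using one_add_inverse[of y] triangularD(1) assms(3) by (metis order_trans)
  qed
  then show ?thesis using that d by blast
qed

lemma polar_unitary:
  assumes yA: "y \<in> A" and kA: "k \<in> A" and wA: "w \<in> A" and eq: "y + st y + st y * y = k + st k + st k * k"
    and w: "(1 + y) * (1 + w) = 1"
  defines "u \<equiv> k + w + k * w"
  shows "u \<in> A" "1 + u = (1 + k) * (1 + w)" "(1 + st u) * (1 + u) = 1"
proof -
  show uA: "u \<in> A" unfolding u_def using kA wA by (intro A_intros)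
  show u: "1 + u = (1 + k) * (1 + w)" by (simp add: u_def algebra_simps)
  have s: "(1 + st w) * (1 + st y) = 1"
  proof -
    have "st (y + w + y * w) = 0" using w by (simp add: algebra_simps st_zero)
    then have "st y + st w + st w * st y = 0" using wA yA by (simp add: st_add st_mult A_mult A_add)
    moreover have "(1 + st w) * (1 + st y) = 1 + (st y + st w + st w * st y)" by (simp add: algebra_simps)
    ultimately show ?thesis by simp
  qed
  have "1 + st u = (1 + st w) * (1 + st k)"
    using kA wA by (simp add: u_def st_add st_mult A_mult A_add algebra_simps)
  then have "(1 + st u) * (1 + u) = (1 + st w) * ((1 + st k) * (1 + k)) * (1 + w)"
    by (simp add: u mult.assoc)
  also have "(1 + st k) * (1 + k) = (1 + st y) * (1 + y)"
    using eq by (simp add: algebra_simps)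
  also have "(1 + st w) * ((1 + st y) * (1 + y)) * (1 + w) = ((1 + st w) * (1 + st y)) * ((1 + y) * (1 + w))"
    by (simp only: mult.assoc)
  finally show "(1 + st u) * (1 + u) = 1" using w s by simp
qed

text \<open>1 + u and 1 + k map the range of each \<open>P i\<close> onto the same subspace. Without
  vectors in the abstract algebra this is said by mutual divisibility on the right.\<close>

definition same_range :: "'a \<Rightarrow> 'a \<Rightarrow> bool" where
  "same_range u k \<longleftrightarrow> (\<forall>i\<le>m. \<exists>s t. (1 + u) * P i = (1 + k) * P i * s \<and> (1 + k) * P i = (1 + u) * P i * t)"

lemma polar_same_range:
  assumes y: "triangular y" and small: "\<And>i. i \<le> m \<Longrightarrow> (1 + N (P i)) * N y < 1"
    and w: "w \<in> A" "(1 + y) * (1 + w) = 1" "(1 + w) * (1 + y) = 1" and u: "1 + u = (1 + k) * (1 + w)"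
  shows "same_range u k"
  unfolding same_range_def
proof (intro allI impI exI conjI)
  fix i assume i: "i \<le> m"
  have w1: "y + w + y * w = 0" using w by (simp add: algebra_simps)
  have PP: "P i * P i = P i" using i by (simp add: P_mult)
  have "P i * (w * P i) = w * P i" by (rule triangular_inverse_upper[OF y small w(1) w1 i])
  then have "P i * ((1 + w) * P i) = (1 + w) * P i" by (simp add: algebra_simps PP)
  then show "(1 + u) * P i = (1 + k) * P i * ((1 + w) * P i)" by (simp add: u mult.assoc)
  have k: "1 + k = (1 + u) * (1 + y)" using u w by (simp add: mult.assoc)
  have "P i * (y * P i) = y * P i" by (rule triangularD(2)[OF y i])
  then have "P i * ((1 + y) * P i) = (1 + y) * P i" by (simp add: algebra_simps PP)
  then show "(1 + k) * P i = (1 + u) * P i * ((1 + y) * P i)" by (simp add: k mult.assoc)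
qed

text \<open>The bounds serve, in this order, existence of the factor, uniqueness on the doubled
  ball, inversion of 1 + y, the estimate of the isometry by r + 2 r + r, and triangularity of the
  inverse.\<close>

lemma small_radius:
  assumes "0 < e"
  obtains r where "0 < r" "psi_bound * r \<le> 1 / 4" "psi_bound * (2 * r) \<le> 1 / 4" "r \<le> 1 / 2" "4 * r < e"
    "\<And>i. i \<le> m \<Longrightarrow> (1 + N (P i)) * r < 1"
proof -
  define M where "M = (\<Sum>i\<le>m. N (P i))"
  have M: "0 \<le> M" "i \<le> m \<Longrightarrow> N (P i) \<le> M" for i
    unfolding M_def by (auto intro!: sum_nonneg member_le_sum N_nonneg)
  define r where "r = Min {1 / (8 * (psi_bound + 1)), 1 / (2 * (1 + M)), e / 8}"
  have r: "0 < r" "r \<le> 1 / (8 * (psi_bound + 1))" "r \<le> 1 / (2 * (1 + M))" "r \<le> e / 8"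
    unfolding r_def using assms psi_bound_nonneg M by auto
  have "psi_bound * r + r \<le> 1 / 8" using r(2) psi_bound_nonneg by (simp add: field_simps)
  moreover have rM: "(1 + M) * r \<le> 1 / 2" using r(3) M by (simp add: field_simps)
  moreover have NM: "(1 + N (P i)) * r \<le> (1 + M) * r" if "i \<le> m" for i
    using M(2)[OF that] r(1) by (intro mult_right_mono) auto
  moreover have "0 \<le> psi_bound * r" "0 \<le> M * r" using psi_bound_nonneg r(1) M by auto
  moreover have "(1 + N (P i)) * r < 1" if "i \<le> m" for i
    using NM[OF that] rM by linarith
  ultimately show ?thesis using r(1,4) assms
    by (intro that[of r]) (linarith | blast)+
qed

theorem unitary_same_range:
  assumes "0 < e"
  shows "\<exists>d>0. \<forall>k\<in>A. N k \<le> d \<longrightarrow> (\<exists>u\<in>A. N u < e \<and> (1 + st u) * (1 + u) = 1 \<and> same_range u k)"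
proof -
  obtain r where r: "0 < r" "psi_bound * r \<le> 1 / 4" "psi_bound * (2 * r) \<le> 1 / 4" "r \<le> 1 / 2" "4 * r < e"
    "\<And>i. i \<le> m \<Longrightarrow> (1 + N (P i)) * r < 1"
    using small_radius[OF assms] by metis
  obtain d where d: "0 < d" "d \<le> r" and fac:
    "\<And>k. k \<in> A \<Longrightarrow> N k \<le> d \<Longrightarrow> \<exists>y w. triangular y \<and> N y \<le> r \<and> y + st y + st y * y = k + st k + st k * k
      \<and> w \<in> A \<and> (1 + y) * (1 + w) = 1 \<and> (1 + w) * (1 + y) = 1 \<and> N w \<le> 2 * N y"
    using cholesky_factor[OF r(1,2,4)] by metis
  show ?thesis
  proof (intro exI[of _ d] conjI ballI impI d)
    fix k assume k: "k \<in> A" "N k \<le> d"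
    obtain y w where y: "triangular y" "N y \<le> r" "y + st y + st y * y = k + st k + st k * k"
      and w: "w \<in> A" "(1 + y) * (1 + w) = 1" "(1 + w) * (1 + y) = 1" "N w \<le> 2 * N y"
      using fac[OF k] by blast
    have "(1 + N (P i)) * N y \<le> (1 + N (P i)) * r" for i
      using y(2) N_nonneg[of "P i"] by (intro mult_left_mono) auto
    then have small: "(1 + N (P i)) * N y < 1" if "i \<le> m" for i
      using r(6)[OF that] by (meson le_less_trans)
    let ?u = "k + w + k * w"
    note pu = polar_unitary[OF triangularD(1)[OF y(1)] k(1) w(1) y(3) w(2)]
    have "N ?u \<le> N k + N w + N k * N w"
      using N_add[of "k + w" "k * w"] N_add[of k w] N_mult[OF k(1) w(1)] by simp
    also have "\<dots> \<le> r + 2 * r + (1 / 2) * (2 * r)"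
      using k d w y r N_nonneg by (intro add_mono mult_mono) auto
    finally have "N ?u < e" using r by simp
    then show "\<exists>u\<in>A. N u < e \<and> (1 + st u) * (1 + u) = 1 \<and> same_range u k"
      using pu polar_same_range[OF y(1) small w(1-3) pu(2)] by blast
  qed
qed

end

context twisted_chain begin

text \<open>The two equations say that 1 + k is an isometry of b. Then
  \<open>(1 + st k) * (1 + k)\<close> is fixed by inversion followed by \<open>tau\<close>, so by
  \<open>cholesky_twisted\<close> its factor 1 + y is an isometry of b, and so is the quotient 1 +
  u.\<close>

theorem unitary_same_range_twisted:
  assumes "0 < e"
  shows "\<exists>d>0. \<forall>k\<in>A. N k \<le> d \<longrightarrow> (1 + tau (st k)) * (1 + k) = 1 \<longrightarrow> (1 + k) * (1 + tau (st k)) = 1 \<longrightarrow>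
    (\<exists>u\<in>A. N u < e \<and> (1 + st u) * (1 + u) = 1 \<and> (1 + tau (st u)) * (1 + u) = 1 \<and> same_range u k)"
proof -
  obtain r where r: "0 < r" "psi_bound * r \<le> 1 / 4" "psi_bound * (2 * r) \<le> 1 / 4" "r \<le> 1 / 2" "4 * r < e"
    "\<And>i. i \<le> m \<Longrightarrow> (1 + N (P i)) * r < 1"
    using small_radius[OF assms] by metis
  obtain d where d: "0 < d" "d \<le> r" and fac:
    "\<And>k. k \<in> A \<Longrightarrow> N k \<le> d \<Longrightarrow> \<exists>y w. triangular y \<and> N y \<le> r \<and> y + st y + st y * y = k + st k + st k * k
      \<and> w \<in> A \<and> (1 + y) * (1 + w) = 1 \<and> (1 + w) * (1 + y) = 1 \<and> N w \<le> 2 * N y"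
    using cholesky_factor[OF r(1,2,4)] by metis
  show ?thesis
  proof (intro exI[of _ d] conjI ballI impI d)
    fix k assume k: "k \<in> A" "N k \<le> d"
      and tk: "(1 + tau (st k)) * (1 + k) = 1" "(1 + k) * (1 + tau (st k)) = 1"
    obtain y w where y: "triangular y" "N y \<le> r" "y + st y + st y * y = k + st k + st k * k"
      and w: "w \<in> A" "(1 + y) * (1 + w) = 1" "(1 + w) * (1 + y) = 1" "N w \<le> 2 * N y"
      using fac[OF k] by blast
    have "(1 + N (P i)) * N y \<le> (1 + N (P i)) * r" for i
      using y(2) N_nonneg[of "P i"] by (intro mult_left_mono) auto
    then have small: "(1 + N (P i)) * N y < 1" if "i \<le> m" for i
      using r(6)[OF that] by (meson le_less_trans)
    let ?u = "k + w + k * w"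
    note yA = triangularD(1)[OF y(1)]
    note pu = polar_unitary[OF yA k(1) w(1) y(3) w(2)]
    have "N ?u \<le> N k + N w + N k * N w"
      using N_add[of "k + w" "k * w"] N_add[of k w] N_mult[OF k(1) w(1)] by simp
    also have "\<dots> \<le> r + 2 * r + (1 / 2) * (2 * r)"
      using k d w y r N_nonneg by (intro add_mono mult_mono) auto
    finally have Nu: "N ?u < e" using r by simp
    define k' where "k' = tau (st k)"
    have k': "k' \<in> A" "tau (st k') = k" unfolding k'_def
      using k by (auto simp: tau_A st_A st_tau st_st tau_tau)
    have k'st: "tau k' = st k" "tau (st k') = k" using k by (auto simp: k'_def tau_tau st_tau st_A st_st)
    have kk: "k' + k + k' * k = 0" using tk(1) by (simp add: k'_def algebra_simps)
    have "st (k + k' + k * k') = 0" using tk(2) by (simp add: k'_def algebra_simps st_zero)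
    then have skk: "st k' + st k + st k' * st k = 0" using k(1) k'(1) by (simp add: st_add st_mult A_add A_mult add_ac)
    \<comment> \<open>1 + \<open>?z\<close> is \<open>(1 + k') * (1 + st k')\<close>, the inverse of
      \<open>(1 + st k) * (1 + k)\<close> since 1 + k' inverts 1 + k.\<close>
    let ?z = "k' + st k' + k' * st k'"
    have "(1 + ?z) * (1 + (k + st k + st k * k)) = (1 + k') * ((1 + st k') * (1 + st k)) * (1 + k)"
      by (simp add: algebra_simps)
    also have "(1 + st k') * (1 + st k) = 1 + (st k' + st k + st k' * st k)" by (simp add: algebra_simps)
    finally have "(1 + ?z) * (1 + (k + st k + st k * k)) = (1 + k') * (1 + k)" using skk by simp
    then have z: "(1 + ?z) * (1 + (k + st k + st k * k)) = 1" using tk(1) by (simp add: k'_def)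
    have tz: "tau ?z = k + st k + st k * k" by (simp add: tau_add tau_mult k'st add_ac)
    have tw: "tau (st y) = w"
      by (rule cholesky_twisted[OF r(3,6) y(1,2) w y(3) z tz])
    then have wy: "tau (st w) = y" using yA by (metis st_A st_st st_tau tau_A tau_tau)
    have "1 + tau (st ?u) = (1 + y) * (1 + k')"
      using k w(1) by (simp add: st_add st_mult A_add A_mult tau_add tau_mult wy k'_def algebra_simps)
    then have "(1 + tau (st ?u)) * (1 + ?u) = (1 + y) * ((1 + k') * (1 + k)) * (1 + w)"
      by (simp add: pu(2) mult.assoc)
    also have "\<dots> = 1" using tk(1) w(2) by (simp add: k'_def)
    finally show "\<exists>u\<in>A. N u < e \<and> (1 + st u) * (1 + u) = 1 \<and> (1 + tau (st u)) * (1 + u) = 1 \<and> same_range u k"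
      using Nu pu polar_same_range[OF y(1) small w(1-3) pu(2)] by blast
  qed
qed

end

section \<open>Determinants over finite sets of indices\<close>

lemma det_on_cong: "(\<And>i j. i \<in> S \<Longrightarrow> j \<in> S \<Longrightarrow> A i j = B i j) \<Longrightarrow> det_on S A = det_on S B"
  unfolding det_on_def
  by (intro sum.cong refl arg_cong2[where f = "(*)"] prod.cong) (auto simp: permutes_in_image)

text \<open>Composition with the transposition of a and b reverses the sign of a permutation and
  leaves the product unchanged, so the sum equals its own negative.\<close>

lemma det_on_repeated_row:
  assumes S: "finite S" and ab: "a \<in> S" "b \<in> S" "a \<noteq> b" and f: "f a = f b"
  shows "(\<Sum>p | p permutes S. of_int (sign p) * (\<Prod>i\<in>S. B (f i) (p i))) = (0::complex)"
    (is "sum ?g _ = 0")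
proof -
  let ?t = "Transposition.transpose a b"
  have t: "?t permutes S" using ab by (intro permutes_swap_id)
  have "?g (p \<circ> ?t) = - ?g p" if p: "p permutes S" for p
  proof -
    have "sign (p \<circ> ?t) = - sign p"
      using sign_compose[of p ?t] permutation_permutes S p t ab by (auto simp: sign_swap_id)
    moreover have "(\<Prod>i\<in>S. B (f i) ((p \<circ> ?t) i)) = (\<Prod>i\<in>S. B (f (?t i)) ((p \<circ> ?t) (?t i)))"
      using prod.permute[OF t, of "\<lambda>i. B (f i) ((p \<circ> ?t) i)"] by (simp add: o_def)
    moreover have "f (?t i) = f i" for i using f by (simp add: Transposition.transpose_def)
    ultimately show ?thesis by simp
  qed
  then have "sum ?g {p. p permutes S} = (\<Sum>p | p permutes S. - ?g p)"
    by (subst sum_permutations_compose_right[OF t]) (intro sum.cong, auto)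
  then show ?thesis by (simp add: sum_negf)
qed

lemma det_on_permuted_rows:
  assumes S: "finite S" and q: "q permutes S"
  shows "(\<Sum>p | p permutes S. of_int (sign p) * (\<Prod>i\<in>S. B (q i) (p i))) = of_int (sign q) * det_on S B"
proof -
  have "(\<Sum>p | p permutes S. of_int (sign p) * (\<Prod>i\<in>S. B (q i) (p i)))
      = (\<Sum>p | p permutes S. of_int (sign (p \<circ> q)) * (\<Prod>i\<in>S. B (q i) ((p \<circ> q) i)))"
    by (rule sum_permutations_compose_right[OF q])
  also have "\<dots> = (\<Sum>p | p permutes S. of_int (sign q) * (of_int (sign p) * (\<Prod>i\<in>S. B i (p i))))"
  proof (intro sum.cong refl)
    fix p assume "p \<in> {p. p permutes S}"
    then have "sign (p \<circ> q) = sign p * sign q"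
      using sign_compose permutation_permutes S q by blast
    moreover have "(\<Prod>i\<in>S. B (q i) ((p \<circ> q) i)) = (\<Prod>i\<in>S. B i (p i))"
      using prod.permute[OF q, of "\<lambda>i. B i (p i)"] by (simp add: o_def)
    ultimately show "of_int (sign (p \<circ> q)) * (\<Prod>i\<in>S. B (q i) ((p \<circ> q) i))
        = of_int (sign q) * (of_int (sign p) * (\<Prod>i\<in>S. B i (p i)))" by simp
  qed
  finally show ?thesis by (simp add: det_on_def sum_distrib_left)
qed

text \<open>The product of sums is expanded over all functions from S to S. Those that are not
  injective repeat a row and contribute 0; the others are restrictions of permutations q and
  contribute \<open>sign q\<close> times the determinant of B.\<close>

lemma det_on_mult:
  assumes S: "finite S"
  shows "det_on S (\<lambda>i j. \<Sum>k\<in>S. A i k * B k j) = det_on S A * det_on S B"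
proof -
  let ?P = "{p. p permutes S}"
  let ?D = "\<lambda>f. \<Sum>p\<in>?P. of_int (sign p) * (\<Prod>i\<in>S. B (f i) (p i))"
  have fin: "finite ?P" using S by (rule finite_permutations)
  have "det_on S (\<lambda>i j. \<Sum>k\<in>S. A i k * B k j)
      = (\<Sum>p\<in>?P. of_int (sign p) * (\<Sum>f\<in>S \<rightarrow>\<^sub>E S. (\<Prod>i\<in>S. A i (f i) * B (f i) (p i))))"
    unfolding det_on_def using S by (simp add: prod_sum_PiE)
  also have "\<dots> = (\<Sum>f\<in>S \<rightarrow>\<^sub>E S. \<Sum>p\<in>?P. (\<Prod>i\<in>S. A i (f i)) * (of_int (sign p) * (\<Prod>i\<in>S. B (f i) (p i))))"
    by (subst sum.swap) (simp add: sum_distrib_left prod.distrib mult_ac)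
  also have "\<dots> = (\<Sum>f\<in>S \<rightarrow>\<^sub>E S. (\<Prod>i\<in>S. A i (f i)) * ?D f)"
    by (simp add: sum_distrib_left)
  also have "\<dots> = (\<Sum>f\<in>(\<lambda>q. restrict q S) ` ?P. (\<Prod>i\<in>S. A i (f i)) * ?D f)"
  proof (rule sum.mono_neutral_right)
    show "finite (S \<rightarrow>\<^sub>E S)" using S by (intro finite_PiE) auto
    show "(\<lambda>q. restrict q S) ` ?P \<subseteq> S \<rightarrow>\<^sub>E S" by (auto simp: permutes_in_image)
    show "\<forall>f\<in>(S \<rightarrow>\<^sub>E S) - (\<lambda>q. restrict q S) ` ?P. (\<Prod>i\<in>S. A i (f i)) * ?D f = 0"
    proof
      fix f assume f: "f \<in> (S \<rightarrow>\<^sub>E S) - (\<lambda>q. restrict q S) ` ?P"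
      have "\<not> inj_on f S"
      proof
        assume inj: "inj_on f S"
        have "f ` S = S" using f inj S by (intro endo_inj_surj) auto
        then have "(\<lambda>x. if x \<in> S then f x else x) permutes S"
          using inj by (intro bij_imp_permutes) (auto simp: bij_betw_def inj_on_def)
        moreover have "f = restrict (\<lambda>x. if x \<in> S then f x else x) S"
          using f by (auto simp: fun_eq_iff PiE_def extensional_def)
        ultimately show False using f by blast
      qed
      then obtain a b where "a \<in> S" "b \<in> S" "a \<noteq> b" "f a = f b" by (auto simp: inj_on_def)
      then show "(\<Prod>i\<in>S. A i (f i)) * ?D f = 0" using det_on_repeated_row[OF S, of a b f B] by simp
    qed
  qed
  also have "\<dots> = (\<Sum>q\<in>?P. (\<Prod>i\<in>S. A i (restrict q S i)) * ?D (restrict q S))"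
  proof (rule sum.reindex[unfolded o_def])
    show "inj_on (\<lambda>q. restrict q S) ?P"
    proof (rule inj_onI, rule ext)
      fix p q x assume "p \<in> ?P" "q \<in> ?P" and eq: "restrict p S = restrict q S"
      then show "p x = q x"
        by (cases "x \<in> S") (auto simp: permutes_def dest: fun_cong[of _ _ x])
    qed
  qed
  also have "\<dots> = (\<Sum>q\<in>?P. (\<Prod>i\<in>S. A i (q i)) * (of_int (sign q) * det_on S B))"
    using det_on_permuted_rows[OF S, of _ B] by (intro sum.cong refl) simp
  also have "\<dots> = det_on S A * det_on S B"
    by (simp add: det_on_def[of S A] sum_distrib_left mult_ac)
  finally show ?thesis .
qed

lemma det_on_transpose:
  assumes "finite S" shows "det_on S (\<lambda>i j. A j i) = det_on S A"
proof -
  have "det_on S (\<lambda>i j. A j i) = (\<Sum>p | p permutes S. of_int (sign (inv p)) * (\<Prod>i\<in>S. A (inv p i) i))"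
    unfolding det_on_def by (rule sum_permutations_inverse)
  also have "\<dots> = det_on S A"
    unfolding det_on_def
  proof (intro sum.cong refl)
    fix p assume "p \<in> {p. p permutes S}"
    then have p: "p permutes S" by simp
    have "(\<Prod>i\<in>S. A (inv p i) i) = (\<Prod>i\<in>S. A i (p i))"
      using prod.permute[OF p, of "\<lambda>i. A (inv p i) i"] p by (simp add: o_def permutes_inverses)
    moreover have "sign (inv p) = sign p"
      using p assms by (meson sign_inverse permutation_permutes)
    ultimately show "of_int (sign (inv p)) * (\<Prod>i\<in>S. A (inv p i) i) = of_int (sign p) * (\<Prod>i\<in>S. A i (p i))" by simp
  qed
  finally show ?thesis .
qed

lemma det_on_extend:
  assumes T: "finite T" and ST: "S \<subseteq> T"
    and A: "\<And>i j. i \<in> T \<Longrightarrow> j \<in> T - S \<Longrightarrow> A i j = (if i = j then 1 else 0)"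
  shows "det_on T A = det_on S A"
proof -
  have "det_on T A = (\<Sum>p | p permutes S. of_int (sign p) * (\<Prod>i\<in>T. A i (p i)))"
    unfolding det_on_def
  proof (rule sum.mono_neutral_right)
    show "finite {p. p permutes T}" using T by (rule finite_permutations)
    show "{p. p permutes S} \<subseteq> {p. p permutes T}" using ST permutes_subset by blast
    show "\<forall>p\<in>{p. p permutes T} - {p. p permutes S}. of_int (sign p) * (\<Prod>i\<in>T. A i (p i)) = 0"
    proof
      fix p assume p: "p \<in> {p. p permutes T} - {p. p permutes S}"
      have "\<exists>x\<in>T - S. p x \<noteq> x"
      proof (rule ccontr)
        assume "\<not> ?thesis"
        then have "p permutes S" using p by (intro permutes_superset[of p T S]) auto
        then show False using p by simp
      qed
      then obtain x where x: "x \<in> T" "x \<notin> S" "p x \<noteq> x" by blast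
      \<comment> \<open>Column x is a unit vector and row \<open>inv p x\<close> meets it off the
        diagonal, so the product belonging to p has a zero factor.\<close>
      have "inv p x \<in> T" "p (inv p x) = x" "inv p x \<noteq> x"
        using p x permutes_inv[of p T] permutes_in_image[of "inv p" T x] by (auto simp: permutes_inverses) 
          (metis permutes_inverses(1))
      then have "A (inv p x) (p (inv p x)) = 0" using A x by simp
      then have "(\<Prod>i\<in>T. A i (p i)) = 0" using T \<open>inv p x \<in> T\<close> by (meson prod_zero)
      then show "of_int (sign p) * (\<Prod>i\<in>T. A i (p i)) = 0" by simp
    qed
  qed
  also have "\<dots> = det_on S A"
    unfolding det_on_def
  proof (intro sum.cong refl arg_cong2[where f = "(*)"])
    fix p assume "p \<in> {p. p permutes S}"
    then have "A i (p i) = 1" if "i \<in> T - S" for i using that A by (simp add: permutes_def)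
    then show "(\<Prod>i\<in>T. A i (p i)) = (\<Prod>i\<in>S. A i (p i))"
      using T ST by (intro prod.mono_neutral_right) auto
  qed
  finally show ?thesis .
qed

lemma det_on_id:
  assumes "finite S" and "\<And>i j. i \<in> S \<Longrightarrow> j \<in> S \<Longrightarrow> A i j = (if i = j then 1 else 0)"
  shows "det_on S A = 1"
  using det_on_extend[of S "{}" A] assms by (simp add: det_on_def)

lemma det_on_scale: "det_on S (\<lambda>i j. c * A i j) = c ^ card S * det_on S A"
  by (simp add: det_on_def prod.distrib sum_distrib_left mult_ac)

lemma det_on_cnj: "det_on S (\<lambda>i j. cnj (A i j)) = cnj (det_on S A)"
  by (simp add: det_on_def)

lemma continuous_on_det_on:
  assumes "\<And>i j. i \<in> S \<Longrightarrow> j \<in> S \<Longrightarrow> continuous_on T (\<lambda>t. A t i j)"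
  shows "continuous_on T (\<lambda>t. det_on S (A t))"
  unfolding det_on_def
  by (intro continuous_intros) (auto intro!: assms simp: permutes_in_image)

text \<open>The determinant of \<open>1 + tB\<close> is a polynomial \<open>p(t)\<close>, and \<open>p(t)p(-t) = 1\<close> forces it to be constant.\<close>

lemma det_on_unipotent:
  assumes S: "finite S" and B: "\<And>i j. i \<in> S \<Longrightarrow> j \<in> S \<Longrightarrow> (\<Sum>k\<in>S. B i k * B k j) = 0"
  shows "det_on S (\<lambda>i j. (if i = j then 1 else 0) + B i j) = 1"
proof -
  let ?A = "\<lambda>t i j. (if i = j then 1 else 0) + t * B i j"
  define p where "p = (\<Sum>q | q permutes S. [:of_int (sign q):] * (\<Prod>i\<in>S. [:if i = q i then 1 else 0, B i (q i):]))"
  have p: "poly p t = det_on S (?A t)" for t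
    by (simp add: p_def det_on_def poly_sum poly_prod)
  have "poly p t * poly p (- t) = 1" for t
  proof -
    have "poly p t * poly p (- t) = det_on S (\<lambda>i j. \<Sum>k\<in>S. ?A t i k * ?A (- t) k j)"
      by (simp add: p det_on_mult[OF S])
    also have "\<dots> = 1"
    proof (rule det_on_id[OF S])
      fix i j assume ij: "i \<in> S" "j \<in> S"
      have "(\<Sum>k\<in>S. ?A t i k * ?A (- t) k j)
          = (\<Sum>k\<in>S. (if i = k then ?A (- t) k j else 0) + (if k = j then t * B i k else 0) - t * t * (B i k * B k j))"
        by (intro sum.cong refl) (auto simp: algebra_simps)
      also have "\<dots> = ?A (- t) i j + t * B i j"
        using ij S B[OF ij] by (simp add: sum.distrib sum_subtractf sum_distrib_left[symmetric])
      finally show "(\<Sum>k\<in>S. ?A t i k * ?A (- t) k j) = (if i = j then 1 else 0)" by simp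
    qed
    finally show ?thesis .
  qed
  then have "p * pcompose p [:0, -1:] = 1"
    by (intro poly_ext) (simp add: poly_pcompose)
  then have "is_unit p" by (metis dvd_triv_left)
  then obtain c where "p = [:c:]" by (auto simp: is_unit_poly_iff)
  then have "det_on S (?A 1) = det_on S (?A 0)" using p[of 1] p[of 0] by simp
  also have "\<dots> = 1" using S by (intro det_on_id) auto
  finally show ?thesis by simp
qed

section \<open>The flag basis, its coordinates and the exhaustion\<close>

locale flag_space =
  fixes D :: "'v::ab_group_add flag_data"
  assumes setting: "flag_setting D"
begin

abbreviation "sc \<equiv> scl D"
abbreviation "h \<equiv> herm D"
abbreviation "b \<equiv> bil D"
abbreviation "e \<equiv> flag_basis D"
abbreviation "I \<equiv> Idx D"
abbreviation "S \<equiv> exh D"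
abbreviation "V \<equiv> V_level D"

sublocale vector_space "scl D"
  using setting by (simp add: flag_setting_def)

lemma hermitian: "hermitian_form sc h"
  using setting by (simp add: flag_setting_def)

lemma h_linear: "Vector_Spaces.linear sc (*) (\<lambda>x. h x y)" and h_cnj: "h y x = cnj (h x y)"
  using hermitian unfolding hermitian_form_def by blast+

lemma h_add_left: "h (x + y) z = h x z + h y z"
  and h_scale_left: "h (sc c x) z = c * h x z"
  and h_diff_left: "h (x - y) z = h x z - h y z"
  and h_zero_left [simp]: "h 0 z = 0"
  and h_sum_left: "h (sum f A) z = (\<Sum>i\<in>A. h (f i) z)"
proof -
  note M = h_linear[of z, THEN Vector_Spaces.linear.axioms(3)]
  show "h (x + y) z = h x z + h y z" "h (sc c x) z = c * h x z" "h (x - y) z = h x z - h y z"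
    "h 0 z = 0" "h (sum f A) z = (\<Sum>i\<in>A. h (f i) z)"
    using M[THEN module_hom.add] M[THEN module_hom.scale] M[THEN module_hom.diff]
      M[THEN module_hom.zero] M[THEN module_hom.sum] by simp_all
qed

lemma h_add_right: "h z (x + y) = h z x + h z y"
  by (metis h_add_left h_cnj complex_cnj_add)

lemma h_scale_right: "h z (sc c x) = cnj c * h z x"
  by (metis h_scale_left h_cnj complex_cnj_mult)

lemma h_diff_right: "h z (x - y) = h z x - h z y"
  by (metis h_diff_left h_cnj complex_cnj_diff)

lemma h_zero_right [simp]: "h z 0 = 0"
  by (metis h_zero_left h_cnj complex_cnj_zero)

lemma h_sum_right: "h z (sum f A) = (\<Sum>i\<in>A. h z (f i))"
  by (induction A rule: infinite_finite_induct) (auto simp: h_add_right)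

lemmas h_simps = h_add_left h_scale_left h_diff_left h_add_right h_scale_right h_diff_right

lemma h_sym_0: "h x y = 0 \<longleftrightarrow> h y x = 0"
  by (metis h_cnj complex_cnj_zero)

lemma h_self_real: "cnj (h x x) = h x x"
  by (metis h_cnj)

text \<open>The Gram matrix of h on E is a signed permutation matrix: e_i pairs only with the basis
  vector of index \<open>kap i\<close>, with value \<open>eta i\<close>. Apart from
  SO(\<infinity>,q), where E is not h-orthogonal, \<open>kap\<close> is the identity.\<close>

definition kap :: "int \<Rightarrow> int" where
  "kap i = (case form D of SO q \<Rightarrow> if i < 0 \<and> q < enat (nat (- i)) then i else - i | _ \<Rightarrow> i)"

definition eta :: "int \<Rightarrow> complex" where
  "eta i = (case form D of SO q \<Rightarrow> 1 | _ \<Rightarrow> if i < 0 then 1 else - 1)"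

lemma mem_I_SO: "form D = SO q \<Longrightarrow> i \<in> I \<longleftrightarrow> i < 0 \<or> (0 < i \<and> enat (nat i) \<le> q)"
  by (simp add: q_indices_def)

lemma zero_notin_I: "0 \<notin> I"
  by (cases "form D") (simp_all add: q_indices_def)

lemma kap_I: "i \<in> I \<Longrightarrow> kap i \<in> I"
  by (cases "form D") (auto simp: kap_def q_indices_def not_less)

lemma kap_kap: "i \<in> I \<Longrightarrow> kap (kap i) = i"
  by (cases "form D") (auto simp: kap_def q_indices_def not_less)

lemma eta_kap: "i \<in> I \<Longrightarrow> eta (kap i) = eta i"
  by (cases "form D") (auto simp: kap_def eta_def)

lemma eta_eta [simp]: "eta i * eta i = 1" "eta i * (eta i * z) = z"
  by (cases "form D"; simp add: eta_def)+

lemma cnj_eta [simp]: "cnj (eta i) = eta i"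
  by (cases "form D") (auto simp: eta_def)

lemma norm_eta [simp]: "cmod (eta i) = 1"
  by (cases "form D") (auto simp: eta_def)

lemma flag_basis_not_SO: "\<not> is_SO (form D) \<Longrightarrow> e = def_basis D"
  by (cases "form D") (auto simp: flag_basis_def)

lemma h_basis:
  assumes i: "i \<in> I" and j: "j \<in> I"
  shows "h (e i) (e j) = (if j = kap i then eta i else 0)"
proof (cases "is_SO (form D)")
  case True
  then obtain q where q: "form D = SO q" by (cases "form D") auto
  show ?thesis
    using flag_basis_SO_gram(2)[OF setting q i j] by (auto simp: kap_def eta_def q)
next
  case False
  have "h (e i) (e j) = h_gram i j"
    using setting i j unfolding flag_setting_def flag_basis_not_SO[OF False] by blast
  moreover have "kap i = i" "eta i = (if i < 0 then 1 else - 1)"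
    using False by (cases "form D"; simp add: kap_def eta_def)+
  ultimately show ?thesis by (auto simp: h_gram_def)
qed

lemma span_e: "span (e ` I) = UNIV"
proof (cases "is_SO (form D)")
  case False
  then show ?thesis using setting by (simp add: flag_setting_def flag_basis_not_SO)
next
  case True
  then obtain q where q: "form D = SO q" by (cases "form D") auto
  let ?r = "1 / complex_of_real (sqrt 2)"
  have "complex_of_real (sqrt 2) * complex_of_real (sqrt 2) = 2"
    by (metis of_real_mult of_real_numeral real_sqrt_mult_self abs_numeral)
  then have r2: "?r * ?r + ?r * ?r = 1" by simp
  \<comment> \<open>Sums and differences of e_i and e_-i, scaled by \<open>?r\<close> once more,
    give back the vectors of E'.\<close>
  have dbl: "sc ?r (sc ?r x + sc ?r x) = x" for x
  proof -
    have "sc ?r (sc ?r x + sc ?r x) = sc (?r * ?r + ?r * ?r) x"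
      by (simp only: scale_right_distrib scale_scale scale_left_distrib)
    then show ?thesis using r2 by simp
  qed
  have e: "e = SO_flag_basis q sc (def_basis D)" by (simp add: flag_basis_def q)
  have "def_basis D i \<in> span (e ` I)" if i: "i \<in> I" for i
  proof (cases "i < 0 \<and> q < enat (nat (- i))")
    case True
    then show ?thesis using i by (intro span_base) (auto simp: e SO_flag_basis_def image_iff)
  next
    case False
    then have ni: "- i \<in> I" using i unfolding mem_I_SO[OF q] by (cases "i < 0") auto
    have i0: "i \<noteq> 0" using i zero_notin_I by auto
    have mem: "e i \<in> span (e ` I)" "e (- i) \<in> span (e ` I)" using i ni by (auto intro: span_base)
    show ?thesis
    proof (cases "i < 0")
      case True
      have "e i = sc ?r (def_basis D i + def_basis D (- i))" "e (- i) = sc ?r (def_basis D i - def_basis D (- i))"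
        using True False by (auto simp: e SO_flag_basis_def)
      then have "sc ?r (e i + e (- i)) = def_basis D i"
        using dbl[of "def_basis D i"] by (simp add: scale_right_distrib scale_right_diff_distrib)
      then show ?thesis using mem by (metis span_add span_scale)
    next
      case pos: False
      then have "e (- i) = sc ?r (def_basis D (- i) + def_basis D i)" "e i = sc ?r (def_basis D (- i) - def_basis D i)"
        using False i i0 by (auto simp: e SO_flag_basis_def q_indices_def q)
      then have "sc ?r (e (- i) - e i) = def_basis D i"
        using dbl[of "def_basis D i"] by (simp add: scale_right_distrib scale_right_diff_distrib)
      then show ?thesis using mem by (metis span_diff span_scale)
    qed
  qed
  then have "span (def_basis D ` I) \<subseteq> span (e ` I)" by (intro span_minimal) auto
  moreover have "span (def_basis D ` I) = UNIV" using setting by (simp add: flag_setting_def)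
  ultimately show ?thesis by auto
qed

text \<open>The coordinate functional of e_i. Writing it through h makes it linear and available
  before E is known to be independent; \<open>independent_e\<close> is deduced from it.\<close>

definition co :: "int \<Rightarrow> 'v \<Rightarrow> complex" where
  "co i x = eta i * h x (e (kap i))"

lemma co_simps [simp]: "co i (x + y) = co i x + co i y" "co i (x - y) = co i x - co i y"
  "co i (sc c x) = c * co i x" "co i 0 = 0"
  by (simp_all add: co_def h_simps algebra_simps)

lemma co_sum: "co i (sum f A) = (\<Sum>j\<in>A. co i (f j))"
  by (simp add: co_def h_sum_left sum_distrib_left)

lemma co_e: "i \<in> I \<Longrightarrow> j \<in> I \<Longrightarrow> co i (e j) = (if i = j then 1 else 0)"
  using h_basis[of j "kap i"] kap_I[of i] kap_kap[of i] kap_kap[of j] eta_kap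
  by (auto simp: co_def)

lemma h_e: "i \<in> I \<Longrightarrow> h x (e i) = eta i * co (kap i) x"
  using kap_kap[of i] eta_kap[of i] by (simp add: co_def)

lemma inj_e: "inj_on e I"
  by (rule inj_onI) (metis co_e zero_neq_one)

lemma independent_e: "independent (e ` I)"
proof
  assume "dependent (e ` I)"
  then obtain t u v where t: "finite t" "t \<subseteq> e ` I" "(\<Sum>v\<in>t. sc (u v) v) = 0" "v \<in> t" "u v \<noteq> 0"
    unfolding dependent_explicit by blast
  then obtain i where i: "i \<in> I" "v = e i" by blast
  have "0 = co i (\<Sum>v\<in>t. sc (u v) v)" using t by simp
  also have "\<dots> = (\<Sum>w\<in>t. if w = v then u w else 0)"
    unfolding co_sum
  proof (intro sum.cong refl)
    fix w assume "w \<in> t"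
    then obtain j where "j \<in> I" "w = e j" using t(2) by blast
    then show "co i (sc (u w) w) = (if w = v then u w else 0)"
      using i inj_e by (auto simp: co_e inj_on_def)
  qed
  also have "\<dots> = u v" using t by simp
  finally show False using t by simp
qed

lemma S_finite: "finite (S n)" and S_mono: "m \<le> n \<Longrightarrow> S m \<subseteq> S n" and S_I: "(\<Union>n. S n) = I"
  and nondeg_h: "nondegenerate_on h (V n)" and nondeg_b: "\<not> is_SU (form D) \<Longrightarrow> nondegenerate_on b (V n)"
  using setting by (auto simp: flag_setting_def incseq_def)

lemma S_sub: "S n \<subseteq> I"
  using S_I by blast

lemma V_subspace: "subspace (V n)"
  unfolding V_level_def by (rule subspace_span)

lemma V_mono: "m \<le> n \<Longrightarrow> V m \<subseteq> V n"
  unfolding V_level_def using S_mono by (intro span_mono image_mono)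

lemma V_UN: "\<exists>n. x \<in> V n"
proof -
  have "subspace (\<Union>n. V n)"
  proof (rule subspaceI)
    show "0 \<in> (\<Union>n. V n)" using subspace_0[OF V_subspace] by blast
  next
    fix x y assume "x \<in> (\<Union>n. V n)" "y \<in> (\<Union>n. V n)"
    then obtain m n where mn: "x \<in> V m" "y \<in> V n" by blast
    then have "x \<in> V (max m n)" "y \<in> V (max m n)"
      using V_mono[of m "max m n"] V_mono[of n "max m n"] by auto
    then show "x + y \<in> (\<Union>n. V n)" using subspace_add[OF V_subspace] by blast
  next
    fix c x assume "x \<in> (\<Union>n. V n)"
    then show "sc c x \<in> (\<Union>n. V n)" using subspace_scale[OF V_subspace] by blast
  qed
  moreover have "e ` I \<subseteq> (\<Union>n. V n)"
  proof
    fix y assume "y \<in> e ` I"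
    then obtain i n where "y = e i" "i \<in> S n" using S_I by blast
    then have "y \<in> V n" unfolding V_level_def by (auto intro: span_base)
    then show "y \<in> (\<Union>n. V n)" by blast
  qed
  ultimately have "span (e ` I) \<subseteq> (\<Union>n. V n)" by (rule span_minimal[rotated])
  then show ?thesis using span_e by auto
qed

lemma V_expand:
  assumes x: "x \<in> V n" shows "x = (\<Sum>i\<in>S n. sc (co i x) (e i))"
proof -
  define f where "f x = (\<Sum>i\<in>S n. sc (co i x) (e i))" for x
  have f: "f 0 = 0" "f (x + y) = f x + f y" "f (sc c x) = sc c (f x)" for c x y
    by (simp_all add: f_def scale_left_distrib sum.distrib scale_sum_right)
  have "f (e j) = e j" if j: "j \<in> S n" for j
  proof -
    have "f (e j) = (\<Sum>i\<in>S n. if i = j then e i else 0)"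
      unfolding f_def using j S_sub by (intro sum.cong refl) (auto simp: co_e subset_iff)
    then show ?thesis using j S_finite by simp
  qed
  moreover have "subspace {x. f x = x}" using f by (intro subspaceI) auto
  ultimately have "span (e ` S n) \<subseteq> {x. f x = x}" by (intro span_minimal) auto
  then have "f x = x" using x by (auto simp: V_level_def)
  then show ?thesis by (simp add: f_def)
qed

lemma co_span_0:
  assumes "A \<subseteq> I" "x \<in> span (e ` A)" "i \<in> I - A" shows "co i x = 0"
  using assms(2)
proof (induction rule: span_induct)
  case base
  then show ?case by (intro subspaceI) auto
next
  case (step x)
  then show ?case using assms by (auto simp: co_e subset_iff)
qed

lemma span_iff:
  assumes "A \<subseteq> I" shows "x \<in> span (e ` A) \<longleftrightarrow> (\<forall>i\<in>I - A. co i x = 0)"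
proof
  show "x \<in> span (e ` A) \<Longrightarrow> \<forall>i\<in>I - A. co i x = 0" using co_span_0 assms by blast
next
  assume a: "\<forall>i\<in>I - A. co i x = 0"
  obtain n where "x \<in> V n" using V_UN by blast
  then have x: "x = (\<Sum>i\<in>S n. sc (co i x) (e i))" by (rule V_expand)
  have "sc (co i x) (e i) \<in> span (e ` A)" if "i \<in> S n" for i
    using a that S_sub by (cases "i \<in> A") (auto intro: span_scale span_base span_zero simp: subset_iff)
  then have "(\<Sum>i\<in>S n. sc (co i x) (e i)) \<in> span (e ` A)" by (rule span_sum)
  then show "x \<in> span (e ` A)" using x by metis
qed

lemma V_iff: "x \<in> V n \<longleftrightarrow> (\<forall>i\<in>I - S n. co i x = 0)"
  unfolding V_level_def using span_iff[OF S_sub] .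

lemma e_V: "i \<in> S n \<Longrightarrow> e i \<in> V n"
  unfolding V_level_def by (auto intro: span_base)

lemma span_Int: "A \<subseteq> I \<Longrightarrow> B \<subseteq> I \<Longrightarrow> span (e ` A) \<inter> span (e ` B) = span (e ` (A \<inter> B))"
  using span_iff[of A] span_iff[of B] span_iff[of "A \<inter> B"] by blast

lemma co_eqI: "(\<And>i. i \<in> I \<Longrightarrow> co i x = co i y) \<Longrightarrow> x = y"
proof -
  assume a: "\<And>i. i \<in> I \<Longrightarrow> co i x = co i y"
  obtain n where "x - y \<in> V n" using V_UN by blast
  then have "x - y = (\<Sum>i\<in>S n. sc (co i (x - y)) (e i))" by (rule V_expand)
  also have "\<dots> = 0" using a S_sub by (intro sum.neutral) (auto simp: subset_iff)
  finally show ?thesis by simp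
qed

lemma h_nondeg: "(\<And>y. h x y = 0) \<Longrightarrow> x = 0"
  using co_eqI[of x 0] by (simp add: co_def)

text \<open>If \<open>kap i\<close> were missing, e_i would be orthogonal to all of V_n and h would
  degenerate there. It follows that V_n is orthogonal to the remaining basis vectors, so that a
  level can be split off.\<close>

lemma kap_S: assumes "i \<in> S n" shows "kap i \<in> S n"
proof (rule ccontr)
  assume k: "kap i \<notin> S n"
  have i: "i \<in> I" using assms S_sub by blast
  have "h (e i) y = 0" if "y \<in> V n" for y
  proof -
    have "kap i \<in> I - S n" using k kap_I[OF i] by blast
    then have "co (kap i) y = 0" using that V_iff by blast
    then have "h y (e i) = 0" using h_e[OF i] by simp
    then show ?thesis using h_sym_0 by blast
  qed
  then have "e i = 0" using nondeg_h e_V[OF assms] by (auto simp: nondegenerate_on_def)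
  then show False using co_e[OF i i] by simp
qed

lemma h_V_outside:
  assumes "x \<in> V n" "i \<in> I - S n" shows "h x (e i) = 0" "h (e i) x = 0"
proof -
  have "kap i \<in> I - S n" using assms kap_I[of i] kap_S[of "kap i" n] kap_kap[of i] by auto
  then show "h x (e i) = 0" using h_e[of i x] assms V_iff by auto
  then show "h (e i) x = 0" using h_sym_0 by blast
qed

lemma h_V_span_outside:
  assumes "x \<in> V n" "A \<subseteq> I - S n" "y \<in> span (e ` A)" shows "h x y = 0"
  using assms(3)
proof (induction rule: span_induct)
  case base
  then show ?case by (intro subspaceI) (auto simp: h_simps)
next
  case (step y)
  then show ?case using assms h_V_outside by blast
qed

lemma representation_e: "i \<in> I \<Longrightarrow> representation (e ` I) x (e i) = co i x"
proof -
  assume i: "i \<in> I"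
  have "x \<in> span (e ` I)" using span_e by simp
  then show ?thesis
  proof (induction rule: span_induct)
    case base
    show ?case
      by (intro subspaceI)
        (auto simp: representation_zero representation_add[OF independent_e] representation_scale[OF independent_e] span_e)
  next
    case (step x)
    then show ?case using i inj_e by (auto simp: representation_basis[OF independent_e] co_e inj_on_def)
  qed
qed

lemma mat_entries_eq: "mat_entries D g i j = (if i \<in> I \<and> j \<in> I then co i (g (e j)) else 0)"
  by (simp add: mat_entries_def representation_e)

lemma linear_iff: "Vector_Spaces.linear sc sc g \<longleftrightarrow> (\<forall>x y. g (x + y) = g x + g y) \<and> (\<forall>c x. g (sc c x) = sc c (g x))"
  by (subst Vector_Spaces.linear_iff) (use vector_space_axioms in blast)

lemma linear_eqI:
  assumes "Vector_Spaces.linear sc sc f" "Vector_Spaces.linear sc sc g" "\<And>i. i \<in> I \<Longrightarrow> f (e i) = g (e i)"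
  shows "f = g"
proof
  fix x
  have "x \<in> span (e ` I)" using span_e by simp
  then show "f x = g x"
  proof (induction rule: span_induct)
    case base
    have "f 0 = 0" "g 0 = 0" using assms(1,2) unfolding linear_iff by (metis add_cancel_right_right add_0)+
    then show ?case using assms(1,2) by (intro subspaceI) (auto simp: linear_iff)
  qed (use assms(3) in blast)
qed

end

section \<open>Groups, levels and their topologies\<close>

lemma act_comp: "act (f \<circ> g) F = act f (act g F)"
  by (simp add: act_def image_image o_def)

lemma act_id: "act id F = F"
  by (simp add: act_def)

text \<open>The group topology, the topology of a finite-dimensional flag manifold and that of the
  whole flag manifold are all given by conditions on preimages in the levels. This lemma is what
  allows \<open>openin\<close> to be unfolded in each of the three cases.\<close>

lemma istopology_preimages:
  assumes "\<And>x n. x \<in> C n \<Longrightarrow> f x \<in> M"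
  shows "istopology (\<lambda>U. U \<subseteq> M \<and> (\<forall>n. openin (T n) {x \<in> C n. f x \<in> U}))"
  unfolding istopology_def
proof (intro conjI allI impI)
  fix U W assume U: "U \<subseteq> M \<and> (\<forall>n. openin (T n) {x \<in> C n. f x \<in> U})"
    and W: "W \<subseteq> M \<and> (\<forall>n. openin (T n) {x \<in> C n. f x \<in> W})"
  show "U \<inter> W \<subseteq> M" using U by blast
  fix n
  have "{x \<in> C n. f x \<in> U \<inter> W} = {x \<in> C n. f x \<in> U} \<inter> {x \<in> C n. f x \<in> W}" by blast
  then show "openin (T n) {x \<in> C n. f x \<in> U \<inter> W}" using U W by (simp add: openin_Int)
next
  fix K assume K: "\<forall>U\<in>K. U \<subseteq> M \<and> (\<forall>n. openin (T n) {x \<in> C n. f x \<in> U})"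
  show "\<Union> K \<subseteq> M" using K by blast
  fix n
  have eq: "{x \<in> C n. f x \<in> \<Union> K} = (\<Union>U\<in>K. {x \<in> C n. f x \<in> U})" by blast
  show "openin (T n) {x \<in> C n. f x \<in> \<Union> K}" unfolding eq using K by (intro openin_Union) blast
qed

context flag_space begin

lemma linearD:
  assumes "Vector_Spaces.linear sc sc g"
  shows "g (x + y) = g x + g y" "g (sc c x) = sc c (g x)" "g 0 = 0" "g (x - y) = g x - g y"
    "g (sum f A) = (\<Sum>i\<in>A. g (f i))"
proof -
  show a: "g (x + y) = g x + g y" for x y using assms linear_iff by blast
  show "g (sc c x) = sc c (g x)" using assms linear_iff by blast
  show z: "g 0 = 0" using a[of 0 0] by simp
  show "g (x - y) = g x - g y" using a[of "x - y" y] by (simp add: algebra_simps)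
  show "g (sum f A) = (\<Sum>i\<in>A. g (f i))"
    by (induction A rule: infinite_finite_induct) (auto simp: a z)
qed

lemma linear_comp:
  "Vector_Spaces.linear sc sc f \<Longrightarrow> Vector_Spaces.linear sc sc g \<Longrightarrow> Vector_Spaces.linear sc sc (f \<circ> g)"
  by (simp add: linear_iff)

lemma linear_id: "Vector_Spaces.linear sc sc id"
  by (simp add: linear_iff)

lemma linear_inv:
  assumes "Vector_Spaces.linear sc sc g" "bij g" shows "Vector_Spaces.linear sc sc (inv g)"
proof -
  have i: "g (inv g x) = x" "inv g (g x) = x" for x
    using assms(2) by (auto simp: bij_def surj_f_inv_f inv_f_f)
  show ?thesis unfolding linear_iff
  proof (intro conjI allI)
    show "inv g (x + y) = inv g x + inv g y" for x y
      by (metis assms(1) i linearD(1))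
    show "inv g (sc c x) = sc c (inv g x)" for c x
      by (metis assms(1) i linearD(2))
  qed
qed

definition GL_level :: "nat \<Rightarrow> ('v \<Rightarrow> 'v) set" where
  "GL_level n = {g. Vector_Spaces.linear sc sc g \<and> bij g \<and> (\<forall>i\<in>I - S n. g (e i) = e i) \<and> g ` V n = V n}"

lemma G_level_iff:
  "g \<in> G_level D n \<longleftrightarrow> g \<in> GL_level n \<and> (\<not> symplectic (form D) \<longrightarrow> det_on (S n) (mat_entries D g) = 1) \<and>
    (\<not> is_SU (form D) \<longrightarrow> (\<forall>x y. b (g x) (g y) = b x y))"
  by (auto simp: G_level_def GL_level_def)

lemma GL_linear: "g \<in> GL_level n \<Longrightarrow> Vector_Spaces.linear sc sc g"
  and GL_bij: "g \<in> GL_level n \<Longrightarrow> bij g"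
  and GL_outside: "g \<in> GL_level n \<Longrightarrow> i \<in> I - S n \<Longrightarrow> g (e i) = e i"
  and GL_V: "g \<in> GL_level n \<Longrightarrow> g ` V n = V n"
  by (auto simp: GL_level_def)

lemma GL_V_mem: "g \<in> GL_level n \<Longrightarrow> x \<in> V n \<Longrightarrow> g x \<in> V n"
  using GL_V by blast

lemma linear_fixes_span:
  assumes "Vector_Spaces.linear sc sc g" "\<And>i. i \<in> A \<Longrightarrow> g (e i) = e i" "x \<in> span (e ` A)"
  shows "g x = x"
  using assms(3)
proof (induction rule: span_induct)
  case base
  show ?case using linearD[OF assms(1)] by (intro subspaceI) auto
qed (use assms in auto)

lemma GL_fixes_span: "g \<in> GL_level n \<Longrightarrow> A \<subseteq> I - S n \<Longrightarrow> x \<in> span (e ` A) \<Longrightarrow> g x = x"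
  using linear_fixes_span GL_linear GL_outside by (metis subsetD)

lemma split_level:
  assumes A: "A \<subseteq> I" and x: "x \<in> span (e ` A)"
  obtains y z where "x = y + z" "y \<in> span (e ` A) \<inter> V n" "z \<in> span (e ` (A - S n))"
proof -
  let ?y = "\<Sum>i\<in>S n. sc (co i x) (e i)"
  have coy: "co j ?y = (if j \<in> S n then co j x else 0)" if j: "j \<in> I" for j
  proof -
    have "co j ?y = (\<Sum>i\<in>S n. if i = j then co j x else 0)"
      unfolding co_sum using j S_sub by (intro sum.cong refl) (auto simp: co_e subset_iff)
    then show ?thesis using S_finite by simp
  qed
  have ASn: "A - S n \<subseteq> I" using A by blast
  have yA: "?y \<in> span (e ` A)"
    unfolding span_iff[OF A] using coy x span_iff[OF A] by auto
  have yV: "?y \<in> V n" unfolding V_iff using coy by auto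
  have z: "x - ?y \<in> span (e ` (A - S n))"
    unfolding span_iff[OF ASn] using coy x span_iff[OF A] by auto
  show ?thesis using that[of ?y "x - ?y"] yA yV z by simp
qed

lemma level_add:
  "A \<subseteq> I \<Longrightarrow> y \<in> span (e ` A) \<inter> V n \<Longrightarrow> z \<in> span (e ` (A - S n)) \<Longrightarrow> y + z \<in> span (e ` A)"
  using span_mono[of "e ` (A - S n)" "e ` A"] by (auto intro!: span_add)

lemma GL_id: "id \<in> GL_level n"
  by (simp add: GL_level_def linear_id)

lemma GL_comp: "f \<in> GL_level n \<Longrightarrow> g \<in> GL_level n \<Longrightarrow> f \<circ> g \<in> GL_level n"
  using image_comp[of f g "V n"] by (simp add: GL_level_def linear_comp bij_comp)

lemma GL_inv: assumes g: "g \<in> GL_level n" shows "inv g \<in> GL_level n"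
proof -
  have "bij g" using g GL_bij by blast
  then have i: "inv g (g x) = x" for x by (simp add: bij_def inv_f_f)
  have "inv g (e j) = e j" if "j \<in> I - S n" for j using GL_outside[OF g that] i by metis
  moreover have "inv g ` V n = V n"
    using GL_V[OF g] i by (metis (no_types, lifting) image_inv_f_f bij_def \<open>bij g\<close>)
  ultimately show ?thesis
    using linear_inv[OF GL_linear[OF g] \<open>bij g\<close>] \<open>bij g\<close> by (simp add: GL_level_def bij_imp_bij_inv)
qed

lemma GL_mono: assumes mn: "m \<le> n" and g: "g \<in> GL_level m" shows "g \<in> GL_level n"
proof -
  have sub: "f ` V n \<subseteq> V n" if f: "f \<in> GL_level m" for f
  proof
    fix y assume "y \<in> f ` V n"
    then obtain x where x: "x \<in> span (e ` S n)" "y = f x" by (auto simp: V_level_def)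
    then obtain u v where uv: "x = u + v" "u \<in> span (e ` S n) \<inter> V m" "v \<in> span (e ` (S n - S m))"
      using split_level[OF S_sub, of x n m] by metis
    have "f v = v" using GL_fixes_span[OF f _ uv(3)] S_sub by blast
    then have y: "y = f u + v" using linearD(1)[OF GL_linear[OF f]] x uv by simp
    have "f u \<in> V n" using GL_V_mem[OF f] uv(2) V_mono[OF mn] by blast
    moreover have "v \<in> V n" unfolding V_level_def using uv(3) span_mono[of "e ` (S n - S m)" "e ` S n"] by auto
    ultimately show "y \<in> V n" unfolding y by (intro subspace_add V_subspace)
  qed
  have "V n \<subseteq> g ` V n"
  proof
    fix x assume "x \<in> V n"
    then have "inv g x \<in> V n" using sub[OF GL_inv[OF g]] by blast
    moreover have "g (inv g x) = x" using GL_bij[OF g] by (simp add: bij_def surj_f_inv_f)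
    ultimately show "x \<in> g ` V n" by (metis imageI)
  qed
  then show ?thesis using g sub[OF g] S_mono[OF mn] by (auto simp: GL_level_def)
qed

lemma co_linear_expand:
  assumes f: "Vector_Spaces.linear sc sc f" and x: "x \<in> V n"
  shows "co i (f x) = (\<Sum>k\<in>S n. co i (f (e k)) * co k x)"
proof -
  have "f x = (\<Sum>k\<in>S n. sc (co k x) (f (e k)))"
    by (subst V_expand[OF x]) (simp add: linearD[OF f])
  then show ?thesis by (simp add: co_sum mult.commute)
qed

lemma det_comp:
  assumes f: "Vector_Spaces.linear sc sc f" and g: "\<And>x. x \<in> V n \<Longrightarrow> g x \<in> V n"
  shows "det_on (S n) (mat_entries D (f \<circ> g)) = det_on (S n) (mat_entries D f) * det_on (S n) (mat_entries D g)"
proof -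
  have "det_on (S n) (mat_entries D (f \<circ> g))
      = det_on (S n) (\<lambda>i j. \<Sum>k\<in>S n. mat_entries D f i k * mat_entries D g k j)"
  proof (rule det_on_cong)
    fix i j assume ij: "i \<in> S n" "j \<in> S n"
    have "k \<in> I" if "k \<in> S n" for k using that S_sub by blast
    then show "mat_entries D (f \<circ> g) i j = (\<Sum>k\<in>S n. mat_entries D f i k * mat_entries D g k j)"
      using co_linear_expand[OF f g[OF e_V[OF ij(2)]], of i] ij by (simp add: mat_entries_eq)
  qed
  then show ?thesis by (simp add: det_on_mult[OF S_finite])
qed

lemma det_id: "det_on (S n) (mat_entries D id) = 1"
  using S_sub by (intro det_on_id S_finite) (auto simp: mat_entries_eq co_e subset_iff)

lemma det_mono:
  assumes mn: "m \<le> n" and g: "g \<in> GL_level m"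
  shows "det_on (S n) (mat_entries D g) = det_on (S m) (mat_entries D g)"
proof (rule det_on_extend[OF S_finite S_mono[OF mn]])
  fix i j assume "i \<in> S n" "j \<in> S n - S m"
  then have "i \<in> I" "j \<in> I - S m" using S_sub by auto
  then show "mat_entries D g i j = (if i = j then 1 else 0)"
    using GL_outside[OF g] by (simp add: mat_entries_eq co_e)
qed

lemma G_level_GL: "g \<in> G_level D n \<Longrightarrow> g \<in> GL_level n"
  by (simp add: G_level_iff)

lemma G_level_id: "id \<in> G_level D n"
  by (simp add: G_level_iff GL_id det_id)

lemma G_level_comp: "f \<in> G_level D n \<Longrightarrow> g \<in> G_level D n \<Longrightarrow> f \<circ> g \<in> G_level D n"
  using det_comp[of f n g, OF GL_linear[of f n] GL_V_mem[of g n]] by (simp add: G_level_iff GL_comp)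

lemma G_level_inv: assumes g: "g \<in> G_level D n" shows "inv g \<in> G_level D n"
proof -
  have GL: "g \<in> GL_level n" using g by (rule G_level_GL)
  have i: "g \<circ> inv g = id" "g (inv g x) = x" for x
    using GL_bij[OF GL] by (auto simp: bij_def surj_iff surj_f_inv_f)
  have "det_on (S n) (mat_entries D g) * det_on (S n) (mat_entries D (inv g)) = 1"
    using det_comp[of g n "inv g", OF GL_linear[OF GL] GL_V_mem[OF GL_inv[OF GL]]] by (simp add: i det_id)
  moreover have "b (inv g x) (inv g y) = b x y" if "\<not> is_SU (form D)" for x y
    using g that i(2) by (metis G_level_iff)
  ultimately show ?thesis using g GL_inv[OF GL] by (auto simp: G_level_iff)
qed

lemma G_level_mono: "m \<le> n \<Longrightarrow> g \<in> G_level D m \<Longrightarrow> g \<in> G_level D n"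
  using GL_mono det_mono by (simp add: G_level_iff)

lemma H_iff: "g \<in> h_preserving_level D n \<longleftrightarrow> g \<in> G_level D n \<and> (\<forall>x y. h (g x) (g y) = h x y)"
  by (simp add: h_preserving_level_def)

lemma H_id: "id \<in> h_preserving_level D n"
  by (simp add: H_iff G_level_id)

lemma H_comp: "f \<in> h_preserving_level D n \<Longrightarrow> g \<in> h_preserving_level D n \<Longrightarrow> f \<circ> g \<in> h_preserving_level D n"
  by (simp add: H_iff G_level_comp)

lemma H_mono: "m \<le> n \<Longrightarrow> g \<in> h_preserving_level D m \<Longrightarrow> g \<in> h_preserving_level D n"
  by (simp add: H_iff G_level_mono)

lemma openin_level_topology:
  "openin (level_topology D H) U \<longleftrightarrow> (\<exists>W. open W \<and> U = {g \<in> H. mat_entries D g \<in> W})"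
  unfolding level_topology_def openin_pullback_topology by (auto simp: vimage_def Int_def conj_commute)

lemma openin_level_topologyI:
  assumes "U \<subseteq> H" "\<And>g. g \<in> U \<Longrightarrow> \<exists>W. open W \<and> mat_entries D g \<in> W \<and> (\<forall>g'\<in>H. mat_entries D g' \<in> W \<longrightarrow> g' \<in> U)"
  shows "openin (level_topology D H) U"
proof -
  obtain W where W: "\<And>g. g \<in> U \<Longrightarrow> open (W g) \<and> mat_entries D g \<in> W g \<and> (\<forall>g'\<in>H. mat_entries D g' \<in> W g \<longrightarrow> g' \<in> U)"
    using assms(2) by metis
  have "open (\<Union>g\<in>U. W g)" using W by blast
  moreover have "U = {g \<in> H. mat_entries D g \<in> (\<Union>g\<in>U. W g)}" using W assms(1) by blast
  ultimately show ?thesis unfolding openin_level_topology by blast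
qed

lemma openin_group_topology:
  "openin (group_topology D H) U \<longleftrightarrow> U \<subseteq> (\<Union>n. H n) \<and> (\<forall>n. openin (level_topology D (H n)) (U \<inter> H n))"
proof -
  have "istopology (\<lambda>U. U \<subseteq> (\<Union>n. H n) \<and> (\<forall>n. openin (level_topology D (H n)) {x \<in> H n. x \<in> U}))"
    by (rule istopology_preimages) blast
  moreover have "{x \<in> H n. x \<in> U} = U \<inter> H n" for n U by blast
  ultimately show ?thesis unfolding group_topology_def by (simp add: topology_inverse')
qed

lemma topspace_group_topology: "topspace (group_topology D H) = (\<Union>n. H n)"
proof (rule antisym)
  show "topspace (group_topology D H) \<subseteq> (\<Union>n. H n)"
    using openin_topspace openin_group_topology by blast
  have "openin (level_topology D (H n)) ((\<Union>n. H n) \<inter> H n)" for n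
    unfolding openin_level_topology by (intro exI[of _ UNIV]) auto
  then have "openin (group_topology D H) (\<Union>n. H n)" unfolding openin_group_topology by blast
  then show "(\<Union>n. H n) \<subseteq> topspace (group_topology D H)" by (rule openin_subset)
qed

abbreviation HT :: "('v \<Rightarrow> 'v) topology" where
  "HT \<equiv> group_topology D (h_preserving_level D)"

text \<open>Needed for closure of the identity component under composition. On one level the matrix
  of \<open>a \<circ> x\<close> is a function \<open>Psi\<close> of the matrix of x with entries
  given by finite sums, hence continuous for the product topology.\<close>

lemma continuous_map_left_mult:
  assumes a: "a \<in> h_preserving_level D n0"
  shows "continuous_map HT HT (\<lambda>x. a \<circ> x)"
proof -
  have alin: "Vector_Spaces.linear sc sc a" using a GL_linear G_level_GL by (auto simp: H_iff)
  have "\<exists>m. a \<circ> x \<in> h_preserving_level D m" if "x \<in> h_preserving_level D n" for x n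
    using H_comp[OF H_mono[OF _ a] H_mono[OF _ that], of "max n0 n"] by auto
  then have dom: "a \<circ> x \<in> topspace HT" if "x \<in> topspace HT" for x
    using that unfolding topspace_group_topology by blast
  have "openin HT {x \<in> topspace HT. a \<circ> x \<in> U}" if U: "openin HT U" for U
    unfolding openin_group_topology
  proof (intro conjI allI)
    show "{x \<in> topspace HT. a \<circ> x \<in> U} \<subseteq> (\<Union>n. h_preserving_level D n)"
      by (auto simp: topspace_group_topology)
    fix m
    define M where "M = max m n0"
    \<comment> \<open>For j outside \<open>S M\<close> the map x fixes e_j, and the entry is that of
      \<open>a\<close>.\<close>
    define Psi where "Psi A i j = (if i \<in> I \<and> j \<in> I then
        if j \<in> S M then \<Sum>k\<in>S M. co i (a (e k)) * A k j else co i (a (e j)) else 0)"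
      for A :: "int \<Rightarrow> int \<Rightarrow> complex" and i j
    have aM: "a \<in> h_preserving_level D M" using a H_mono[of n0 M] by (simp add: M_def)
    have Psi: "mat_entries D (a \<circ> x) = Psi (mat_entries D x)" if x: "x \<in> GL_level M" for x
    proof (intro ext)
      fix i j
      have "k \<in> I" if "k \<in> S M" for k using that S_sub by blast
      then show "mat_entries D (a \<circ> x) i j = Psi (mat_entries D x) i j"
        using co_linear_expand[OF alin GL_V_mem[OF x e_V], of j i] GL_outside[OF x, of j]
        by (auto simp: Psi_def mat_entries_eq)
    qed
    have Psi_cont: "continuous_on UNIV Psi"
    proof (intro continuous_on_coordinatewise_then_product)
      fix i j
      have coord: "continuous_on UNIV (\<lambda>A::int \<Rightarrow> int \<Rightarrow> complex. A k l)" for k l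
        by (rule continuous_on_product_then_coordinatewise[OF continuous_on_product_then_coordinatewise[OF continuous_on_id]])
      have eq: "(\<lambda>A. Psi A i j) = (if i \<in> I \<and> j \<in> I then if j \<in> S M
          then (\<lambda>A. \<Sum>k\<in>S M. co i (a (e k)) * A k j) else (\<lambda>A. co i (a (e j))) else (\<lambda>A. 0))"
        by (auto simp: Psi_def fun_eq_iff)
      show "continuous_on UNIV (\<lambda>A. Psi A i j)"
        unfolding eq by (auto intro!: continuous_on_sum continuous_on_mult continuous_on_const coord)
    qed
    have "openin (level_topology D (h_preserving_level D M)) (U \<inter> h_preserving_level D M)"
      using U unfolding openin_group_topology by blast
    then obtain W where W: "open W" "U \<inter> h_preserving_level D M = {g \<in> h_preserving_level D M. mat_entries D g \<in> W}"
      unfolding openin_level_topology by blast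
    have "open (Psi -` W)" using Psi_cont W(1) by (simp add: continuous_on_open_vimage)
    moreover have "{x \<in> topspace HT. a \<circ> x \<in> U} \<inter> h_preserving_level D m
        = {x \<in> h_preserving_level D m. mat_entries D x \<in> Psi -` W}"
    proof -
      have "x \<in> topspace HT \<and> (a \<circ> x \<in> U \<longleftrightarrow> mat_entries D x \<in> Psi -` W)"
        if x: "x \<in> h_preserving_level D m" for x
      proof -
        have xM: "x \<in> h_preserving_level D M" using H_mono[OF _ x, of M] by (simp add: M_def)
        then have "a \<circ> x \<in> U \<longleftrightarrow> mat_entries D (a \<circ> x) \<in> W" using W(2) H_comp[OF aM xM] by blast
        moreover have "x \<in> GL_level M" using xM G_level_GL by (simp add: H_iff)
        ultimately show ?thesis using Psi x by (auto simp: topspace_group_topology)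
      qed
      then show ?thesis by blast
    qed
    ultimately show "openin (level_topology D (h_preserving_level D m)) ({x \<in> topspace HT. a \<circ> x \<in> U} \<inter> h_preserving_level D m)"
      unfolding openin_level_topology by blast
  qed
  then show ?thesis using dom by (auto simp: continuous_map_def)
qed

lemma G0_level: "g \<in> G0 D \<Longrightarrow> \<exists>n. g \<in> h_preserving_level D n"
  using connected_component_of_subset_topspace[of HT id] topspace_group_topology[of "h_preserving_level D"]
  by (auto simp: G0_def split: if_splits)

lemma G0_id: "id \<in> G0 D"
proof (cases "is_SO (form D)")
  case True
  have "id \<in> topspace HT" unfolding topspace_group_topology using H_id by blast
  then show ?thesis using True by (simp add: G0_def connected_component_of_refl)
qed (use H_id in \<open>auto simp: G0_def\<close>)

text \<open>For the identity component: if T is connected and contains \<open>id\<close> and g, then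
  its left translate by f is connected and contains f and \<open>f \<circ> g\<close>.\<close>

lemma G0_comp:
  assumes f: "f \<in> G0 D" and g: "g \<in> G0 D" shows "f \<circ> g \<in> G0 D"
proof (cases "is_SO (form D)")
  case True
  obtain n where n: "f \<in> h_preserving_level D n" using G0_level[OF f] by blast
  have "connected_component_of HT id f" "connected_component_of HT id g" using True f g by (auto simp: G0_def)
  moreover from this(2) obtain T where T: "connectedin HT T" "id \<in> T" "g \<in> T"
    by (auto simp: connected_component_of_def)
  then have "connectedin HT ((\<lambda>x. f \<circ> x) ` T)"
    using connectedin_continuous_map_image[OF continuous_map_left_mult[OF n]] by blast
  then have "connected_component_of HT f (f \<circ> g)"
    unfolding connected_component_of_def using T(2,3)
    by (intro exI[of _ "(\<lambda>x. f \<circ> x) ` T"]) (metis comp_id imageI)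
  ultimately have "connected_component_of HT id (f \<circ> g)" using connected_component_of_trans by metis
  then show ?thesis using True by (simp add: G0_def)
next
  case False
  obtain m n where "f \<in> h_preserving_level D m" "g \<in> h_preserving_level D n" using G0_level f g by blast
  then have "f \<circ> g \<in> h_preserving_level D (max m n)"
    using H_comp[OF H_mono[of m "max m n"] H_mono[of n "max m n"]] by simp
  then show ?thesis using False by (auto simp: G0_def)
qed

lemma subspace_eq_of_linear_image:
  assumes A: "subspace A" and AB: "A \<subseteq> B" and fin: "finite T" "B \<subseteq> span T"
    and f: "Vector_Spaces.linear sc sc f" "f ` A = B"
  shows "A = B"
proof (rule ccontr)
  assume "A \<noteq> B"
  then obtain v where v: "v \<in> B" "v \<notin> A" using AB by blast
  obtain C where C: "C \<subseteq> A" "independent C" "A \<subseteq> span C"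
    using maximal_independent_subset[of A] by metis
  have "C \<subseteq> span T" using C AB fin by blast
  then have finC: "finite C" using independent_span_bound[OF fin(1) C(2)] by blast
  have "v \<notin> span C" using v span_minimal[OF C(1) A] by blast
  then have "independent (insert v C)" using C(2) by (simp add: independent_insert span_base)
  moreover have "insert v C \<subseteq> span (f ` C)"
  proof -
    have "f x \<in> span (f ` C)" if "x \<in> span C" for x
      using that
    proof (induction rule: span_induct)
      case base
      show ?case using linearD[OF f(1)] by (intro subspaceI) (auto intro: span_add span_scale span_zero)
    qed (auto intro: span_base)
    then have "B \<subseteq> span (f ` C)" using f(2) C(3) by blast
    then show ?thesis using v(1) C(1) AB by blast
  qed
  ultimately have "card (insert v C) \<le> card (f ` C)"
    using independent_span_bound[of "f ` C" "insert v C"] finC by blast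
  moreover have "v \<notin> C" using \<open>v \<notin> span C\<close> span_base by blast
  ultimately show False using card_image_le[OF finC, of f] finC by simp
qed

text \<open>Elements of a level preserve dimensions in V_n, and comparable subspaces of equal finite
  dimension coincide. In this way the image of a member of a flag tells which member it comes
  from.\<close>

lemma GL_same_level_part:
  assumes X: "subspace X" "subspace X'" "X \<subseteq> X' \<or> X' \<subseteq> X" and g: "g \<in> GL_level n" "g' \<in> GL_level n"
    and eq: "g ` (X \<inter> V n) = g' ` (X' \<inter> V n)"
  shows "X \<inter> V n = X' \<inter> V n"
proof -
  have key: "Y \<inter> V n = Y' \<inter> V n" if Y: "subspace Y" "Y \<subseteq> Y'" and f: "f \<in> GL_level n" "f' \<in> GL_level n"
    and eq: "f ` (Y \<inter> V n) = f' ` (Y' \<inter> V n)" for Y Y' f f'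
  proof (rule subspace_eq_of_linear_image[where T = "e ` S n" and f = "inv f' \<circ> f"])
    show "subspace (Y \<inter> V n)" using Y(1) V_subspace by (simp add: subspace_inter)
    show "Vector_Spaces.linear sc sc (inv f' \<circ> f)" using f by (intro GL_linear[of _ n] GL_comp GL_inv)
    show "(inv f' \<circ> f) ` (Y \<inter> V n) = Y' \<inter> V n"
      using GL_bij[OF f(2)] unfolding image_comp[symmetric] eq by (simp add: bij_def image_inv_f_f)
  qed (use Y S_finite in \<open>auto simp: V_level_def\<close>)
  show ?thesis using X(3) key[OF X(1) _ g eq] key[OF X(2) _ g(2,1) eq[symmetric]] by blast
qed

lemma GL_image_Int_V: "g \<in> GL_level n \<Longrightarrow> g ` X \<inter> V n = g ` (X \<inter> V n)"
  using GL_V GL_bij by (metis bij_def image_Int)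

text \<open>Both maps fix the basis vectors outside V_n, so their effect on a span of basis vectors
  is determined by the part in V_n.\<close>

lemma GL_image_eqI:
  assumes A: "A \<subseteq> I" and g: "g \<in> GL_level n" "g' \<in> GL_level n"
    and eq: "g ` (span (e ` A) \<inter> V n) = g' ` (span (e ` A) \<inter> V n)"
  shows "g ` span (e ` A) = g' ` span (e ` A)"
proof -
  have sub: "f ` span (e ` A) \<subseteq> f' ` span (e ` A)"
    if f: "f \<in> GL_level n" "f' \<in> GL_level n" and eq: "f ` (span (e ` A) \<inter> V n) = f' ` (span (e ` A) \<inter> V n)" for f f'
  proof
    fix y assume "y \<in> f ` span (e ` A)"
    then obtain x where x: "x \<in> span (e ` A)" "y = f x" by blast
    obtain u v where "x = u + v" and uv: "u \<in> span (e ` A) \<inter> V n" "v \<in> span (e ` (A - S n))"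
      using split_level[OF A x(1)] by metis
    then have y: "y = f (u + v)" using x by simp
    have "A - S n \<subseteq> I - S n" using A by blast
    then have v: "f v = v" "f' v = v" using GL_fixes_span f uv(2) by blast+
    obtain u' where u': "u' \<in> span (e ` A) \<inter> V n" "f u = f' u'" using eq uv(1) by blast
    have "y = f' (u' + v)" using y u'(2) v linearD(1)[OF GL_linear] f by metis
    then show "y \<in> f' ` span (e ` A)" using level_add[OF A u'(1) uv(2)] by blast
  qed
  show ?thesis using sub[OF g eq] sub[OF g(2,1) eq[symmetric]] by blast
qed

end

section \<open>Compatible flags and the topology of the flag manifold\<close>

locale flag_setting_chain = flag_space D for D :: "'v::ab_group_add flag_data" +
  fixes F :: "'v set set"
  assumes flag: "flag D F" and compat: "compatible D F"
begin

lemma F_chain: "X \<in> F \<Longrightarrow> Y \<in> F \<Longrightarrow> X \<subseteq> Y \<or> Y \<subseteq> X"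
  using flag by (auto simp: flag_def generalized_flag_def chain_subset_def)

text \<open>Every member has a neighbour in the flag and thus occurs in a successor pair, to which
  compatibility applies.\<close>

lemma F_span: assumes "X \<in> F" obtains A where "A \<subseteq> I" "X = span (e ` A)"
proof -
  have "\<forall>X\<in>F. \<exists>Y. successor_pair F X Y \<or> successor_pair F Y X"
    using flag by (simp add: flag_def generalized_flag_def)
  then obtain Y where "successor_pair F X Y \<or> successor_pair F Y X" using assms by blast
  then obtain prec :: "int \<Rightarrow> int \<Rightarrow> bool" and \<alpha> where
    "X = span (e ` {\<beta> \<in> I. prec \<beta> \<alpha>}) \<or> X = {0} \<or> X = span (e ` {\<beta> \<in> I. \<not> prec \<alpha> \<beta>})"
    using compat unfolding compatible_def by metis
  moreover have "{0} = span (e ` {})" by simp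
  ultimately show ?thesis using that by (metis (no_types, lifting) Collect_subset empty_subsetI mem_Collect_eq subsetI)
qed

lemma restrict_act: "g \<in> GL_level n \<Longrightarrow> restrict_flag D n (act g F) = act g (restrict_flag D n F)"
  by (simp add: restrict_flag_def act_def image_image GL_image_Int_V)

text \<open>This justifies identifying the flag manifold of the intersections with V_n with an orbit
  of F: the part in V_n determines both the member, since members are comparable, and its
  image.\<close>

lemma act_restrict_inj:
  assumes g: "g \<in> GL_level n" "g' \<in> GL_level n"
    and eq: "act g (restrict_flag D n F) = act g' (restrict_flag D n F)"
  shows "act g F = act g' F"
proof -
  have sub: "act f F \<subseteq> act f' F"
    if f: "f \<in> GL_level n" "f' \<in> GL_level n" and eq: "act f (restrict_flag D n F) = act f' (restrict_flag D n F)" for f f'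
  proof
    fix Y assume "Y \<in> act f F"
    then obtain X where X: "X \<in> F" "Y = f ` X" by (auto simp: act_def)
    then have "f ` (X \<inter> V n) \<in> act f (restrict_flag D n F)" by (auto simp: act_def restrict_flag_def)
    then have "f ` (X \<inter> V n) \<in> act f' (restrict_flag D n F)" using eq by simp
    then obtain X' where X': "X' \<in> F" "f ` (X \<inter> V n) = f' ` (X' \<inter> V n)" by (auto simp: act_def restrict_flag_def)
    obtain A where A: "A \<subseteq> I" "X = span (e ` A)" using F_span[OF X(1)] by metis
    obtain A' where A': "A' \<subseteq> I" "X' = span (e ` A')" using F_span[OF X'(1)] by metis
    have "X \<inter> V n = X' \<inter> V n"
      using GL_same_level_part[OF _ _ F_chain[OF X(1) X'(1)] f X'(2)] A A' by simp
    then have "f ` X = f' ` X" using GL_image_eqI[OF A(1) f] X'(2) A(2) by simp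
    then show "Y \<in> act f' F" using X by (auto simp: act_def)
  qed
  show ?thesis using sub[OF g eq] sub[OF g(2,1) eq[symmetric]] by blast
qed

lemma openin_fin_flag_topology:
  "openin (fin_flag_topology D F n) W \<longleftrightarrow> W \<subseteq> orbit (G_level D n) (restrict_flag D n F) \<and>
     openin (level_topology D (G_level D n)) {g \<in> G_level D n. act g (restrict_flag D n F) \<in> W}"
proof -
  have "istopology (\<lambda>W. W \<subseteq> orbit (G_level D n) (restrict_flag D n F) \<and>
     (\<forall>k::unit. openin (level_topology D (G_level D n)) {g \<in> G_level D n. act g (restrict_flag D n F) \<in> W}))"
    by (rule istopology_preimages) (simp add: orbit_def)
  then show ?thesis unfolding fin_flag_topology_def by (simp add: topology_inverse')
qed

text \<open>All later arguments use the topology in this form, which speaks only of group levels and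
  the map g \<mapsto> gF. The restricted flags drop out because, by \<open>act_restrict_inj\<close>,
  two elements of a level agree on the restricted flag only if they agree on F.\<close>

theorem openin_flag_topology:
  "openin (flag_topology D F) U \<longleftrightarrow> U \<subseteq> flag_manifold D F \<and>
     (\<forall>n. openin (level_topology D (G_level D n)) {g \<in> G_level D n. act g F \<in> U})"
proof -
  have sub: "restrict_flag D n ` (U \<inter> orbit (G_level D n) F) \<subseteq> orbit (G_level D n) (restrict_flag D n F)" for n U
    using restrict_act[OF G_level_GL] by (auto simp: orbit_def)
  have pre: "{g \<in> G_level D n. act g (restrict_flag D n F) \<in> restrict_flag D n ` (U \<inter> orbit (G_level D n) F)}
      = {g \<in> G_level D n. act g F \<in> U}" for n U
  proof -
    have "act g (restrict_flag D n F) \<in> restrict_flag D n ` (U \<inter> orbit (G_level D n) F) \<longleftrightarrow> act g F \<in> U"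
      if g: "g \<in> G_level D n" for g
    proof
      assume "act g (restrict_flag D n F) \<in> restrict_flag D n ` (U \<inter> orbit (G_level D n) F)"
      then obtain g' where g': "g' \<in> G_level D n" "act g' F \<in> U"
        "act g (restrict_flag D n F) = restrict_flag D n (act g' F)" by (auto simp: orbit_def)
      then show "act g F \<in> U"
        using act_restrict_inj[OF G_level_GL[OF g] G_level_GL[OF g'(1)]] restrict_act[OF G_level_GL[OF g'(1)]] by simp
    next
      assume "act g F \<in> U"
      then show "act g (restrict_flag D n F) \<in> restrict_flag D n ` (U \<inter> orbit (G_level D n) F)"
        using g restrict_act[OF G_level_GL[OF g]] by (auto simp: orbit_def image_iff intro!: bexI[of _ "act g F"])
    qed
    then show ?thesis by blast
  qed
  have "istopology (\<lambda>U. U \<subseteq> flag_manifold D F \<and>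
     (\<forall>n. openin (level_topology D (G_level D n)) {g \<in> G_level D n. act g F \<in> U}))"
    by (rule istopology_preimages) (auto simp: flag_manifold_def orbit_def G_def)
  then show ?thesis unfolding flag_topology_def openin_fin_flag_topology pre
    using sub by (simp add: topology_inverse')
qed

end

section \<open>The bilinear form and its antilinear companion\<close>

lemma Sp_half_gram_iff:
  "Sp_half_gram i j = (if odd i \<and> 0 < i \<and> j = i + 1 then -1 else if odd i \<and> i < 0 \<and> j = i - 1 then 1 else 0)"
proof -
  have 1: "(\<exists>k>0. i = 2 * k - 1 \<and> j = 2 * k) \<longleftrightarrow> odd i \<and> 0 < i \<and> j = i + 1" by presburger
  have 2: "(\<exists>k<0. i = 2 * k + 1 \<and> j = 2 * k) \<longleftrightarrow> odd i \<and> i < 0 \<and> j = i - 1" by presburger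
  show ?thesis unfolding Sp_half_gram_def 1 2 by (rule refl)
qed

locale bilinear_space = flag_space D for D :: "'v::ab_group_add flag_data" +
  assumes not_SU: "\<not> is_SU (form D)"
begin

lemma bilinear: "bilinear_form sc b"
  using setting not_SU by (simp add: flag_setting_def)

lemma b_linear: "Vector_Spaces.linear sc (*) (b x)" "Vector_Spaces.linear sc (*) (\<lambda>x. b x y)"
  using bilinear unfolding bilinear_form_def by blast+

lemma b_add_left: "b (x + y) z = b x z + b y z" and b_add_right: "b z (x + y) = b z x + b z y"
  and b_scale_left: "b (sc c x) z = c * b x z" and b_scale_right: "b z (sc c x) = c * b z x"
  and b_diff_left: "b (x - y) z = b x z - b y z" and b_diff_right: "b z (x - y) = b z x - b z y"
  and b_zero_left [simp]: "b 0 z = 0" and b_zero_right [simp]: "b z 0 = 0"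
  using b_linear[THEN Vector_Spaces.linear.axioms(3), THEN module_hom.add]
    b_linear[THEN Vector_Spaces.linear.axioms(3), THEN module_hom.scale]
    b_linear[THEN Vector_Spaces.linear.axioms(3), THEN module_hom.diff]
    b_linear[THEN Vector_Spaces.linear.axioms(3), THEN module_hom.zero] by auto

lemmas b_simps = b_add_left b_add_right b_scale_left b_scale_right b_diff_left b_diff_right

text \<open>\<open>eps\<close> is the sign of the symmetry of b. The next three constants describe,
  on the basis E, the antilinear \<sigma> with h(x,y) = b(x,\<sigma> y): it sends e_i to
  \<open>mu i\<close> times the basis vector of index \<open>tw i\<close>, and \<sigma>^2 =
  \<open>sig\<close>.\<close>

definition eps :: complex where "eps = (if symplectic (form D) then - 1 else 1)"

definition sig :: complex where "sig = (case form D of Sp q \<Rightarrow> - 1 | SO_star \<Rightarrow> - 1 | _ \<Rightarrow> 1)"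

definition tw :: "int \<Rightarrow> int" where
  "tw i = (case form D of SO q \<Rightarrow> i | Sp q \<Rightarrow> if odd i then i + sgn i else i - sgn i | _ \<Rightarrow> - i)"

definition mu :: "int \<Rightarrow> complex" where
  "mu i = (case form D of Sp q \<Rightarrow> if odd i then 1 else - 1 | SO_star \<Rightarrow> if i < 0 then 1 else - 1 | _ \<Rightarrow> 1)"

lemma eps_eps [simp]: "eps * eps = 1" "eps * (eps * z) = z"
  by (simp_all add: eps_def)

lemma sig_sig [simp]: "sig * sig = 1" "sig * (sig * z) = z"
  by (cases "form D"; simp add: sig_def)+

lemma cnj_sig [simp]: "cnj sig = sig" "cnj eps = eps"
  by (cases "form D"; simp add: sig_def eps_def)+

lemma sig_nonzero [simp]: "sig \<noteq> 0" "eps \<noteq> 0"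
  by (cases "form D"; simp add: sig_def eps_def)+

lemma cnj_mu [simp]: "cnj (mu i) = mu i"
  by (cases "form D") (auto simp: mu_def)

lemma norm_mu [simp]: "cmod (mu i) = 1"
  by (cases "form D") (auto simp: mu_def)

lemma tw_I: assumes "i \<in> I" shows "tw i \<in> I"
proof (cases "form D")
  case (Sp q)
  \<comment> \<open>The partner of an odd positive index is the next one, which stays in range
    because the bound 2 q is even.\<close>
  have even: "enat (nat (i + 1)) \<le> 2 * q" if "odd i" "0 < i" "enat (nat i) \<le> 2 * q"
  proof (cases q)
    case (enat k)
    then have "nat i \<le> 2 * k" using that by (simp add: numeral_eq_enat)
    then have "i \<le> 2 * int k" by linarith
    then have "i + 1 \<le> 2 * int k" using that(1) by presburger
    then have "nat (i + 1) \<le> 2 * k" by linarith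
    then show ?thesis using enat by (simp add: numeral_eq_enat)
  qed (simp add: numeral_eq_enat)
  have less: "enat (nat (i - 1)) \<le> 2 * q" if "enat (nat i) \<le> 2 * q"
    using that by (meson enat_ord_simps(1) nat_mono order_trans diff_le_eq le_add_same_cancel1 zero_le_one)
  show ?thesis using assms even less Sp
    by (auto simp: tw_def q_indices_def sgn_if)
qed (use assms not_SU in \<open>auto simp: tw_def q_indices_def\<close>)

lemma tw_tw: assumes "i \<in> I" shows "tw (tw i) = i"
proof (cases "form D")
  case (Sp q)
  have "i \<noteq> 0" using assms zero_notin_I by blast
  then show ?thesis using Sp by (auto simp: tw_def sgn_if)
qed (auto simp: tw_def)

lemma mu_tw: assumes "i \<in> I" shows "mu i * mu (tw i) = sig"
proof -
  have "i \<noteq> 0" using assms zero_notin_I by blast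
  then show ?thesis by (cases "form D") (auto simp: tw_def mu_def sig_def sgn_if)
qed

lemma b_basis:
  assumes i: "i \<in> I" and j: "j \<in> I"
  shows "b (e i) (e j) = (if is_SO (form D) then h (e i) (e j) else b_gram (form D) i j)"
proof (cases "is_SO (form D)")
  case True
  then obtain q where q: "form D = SO q" by (cases "form D") auto
  show ?thesis using flag_basis_SO_gram[OF setting q i j] True by simp
next
  case False
  have "\<forall>i\<in>I. \<forall>j\<in>I. b (def_basis D i) (def_basis D j) = b_gram (form D) i j"
    using setting not_SU by (simp add: flag_setting_def)
  then show ?thesis using False i j by (simp add: flag_basis_not_SO)
qed

lemma b_basis_tw:
  assumes i: "i \<in> I" and j: "j \<in> I"
  shows "mu j * b (e i) (e (tw j)) = h (e i) (e j)"
proof -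
  note bh = b_basis[OF i tw_I[OF j]] h_basis[OF i j]
  have nz: "i \<noteq> 0" "j \<noteq> 0" using assms zero_notin_I by auto
  show ?thesis
  proof (cases "form D")
    case (SO q)
    then show ?thesis using b_basis[OF i j] by (simp add: mu_def tw_def)
  next
    case (Sp q)
    have "mu j * (Sp_half_gram i (tw j) - Sp_half_gram (tw j) i) = (if j = i then if i < 0 then 1 else - 1 else 0)"
    proof (cases "odd j")
      case True
      then have "mu j = 1" "tw j = j + sgn j" using Sp by (simp_all add: mu_def tw_def)
      then show ?thesis using True nz by (cases "0 < j"; cases "i = j") (auto simp: Sp_half_gram_iff)
    next
      case False
      then have "mu j = - 1" "tw j = j - sgn j" using Sp by (simp_all add: mu_def tw_def)
      then show ?thesis using False nz by (cases "0 < j"; cases "i = j") (auto simp: Sp_half_gram_iff)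
    qed
    then show ?thesis using bh Sp by (simp add: kap_def eta_def)
  next
    case SO_star
    then show ?thesis using bh nz by (auto simp: mu_def tw_def kap_def eta_def)
  next
    case Sp_R
    then show ?thesis using bh nz by (auto simp: mu_def tw_def kap_def eta_def)
  qed (use not_SU in auto)
qed

lemma b_basis_sym:
  assumes i: "i \<in> I" and j: "j \<in> I"
  shows "b (e j) (e i) = eps * b (e i) (e j)"
proof -
  have nz: "i \<noteq> 0" "j \<noteq> 0" using assms zero_notin_I by auto
  note bb = b_basis[OF i j] b_basis[OF j i]
  show ?thesis
  proof (cases "form D")
    case (SO q)
    have "i = kap j \<longleftrightarrow> j = kap i" using kap_kap i j by metis
    then show ?thesis using bb h_basis[OF i j] h_basis[OF j i] SO by (simp add: eps_def eta_def)
  next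
    case (Sp q)
    then show ?thesis using bb by (simp add: eps_def)
  next
    case SO_star
    then show ?thesis using bb by (simp add: eps_def add.commute)
  next
    case Sp_R
    then show ?thesis using bb nz by (auto simp: eps_def add.commute)
  qed (use not_SU in auto)
qed

text \<open>\<open>c'\<close> is the way in which scalars leave the second argument, the identity
  for b and \<open>cnj\<close> for h, so that one proof covers both kinds of forms.\<close>

lemma sesquilinear_eqI:
  assumes f: "\<And>x y z. f (x + y) z = f x z + f y z" "\<And>c x z. f (sc c x) z = c * f x z"
      "\<And>x y z. f z (x + y) = f z x + f z y" "\<And>c x z. f z (sc c x) = c' c * f z x"
    and g: "\<And>x y z. g (x + y) z = g x z + g y z" "\<And>c x z. g (sc c x) z = c * g x z"
      "\<And>x y z. g z (x + y) = g z x + g z y" "\<And>c x z. g z (sc c x) = c' c * g z x"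
    and eq: "\<And>i j. i \<in> I \<Longrightarrow> j \<in> I \<Longrightarrow> f (e i) (e j) = (g (e i) (e j) :: complex)"
  shows "f x y = g x y"
proof -
  have z: "f 0 z = 0" "g 0 z = 0" "f z 0 = 0" "g z 0 = 0" for z
    using f(1)[of 0 0 z] g(1)[of 0 0 z] f(3)[of z 0 0] g(3)[of z 0 0] by simp_all
  have "f (e i) y = g (e i) y" if i: "i \<in> I" for i
  proof -
    have "y \<in> span (e ` I)" using span_e by simp
    then show ?thesis
    proof (induction rule: span_induct)
      case base
      show ?case using f g z by (intro subspaceI) auto
    qed (use i eq in auto)
  qed
  moreover have "x \<in> span (e ` I)" using span_e by simp
  then show ?thesis
  proof (induction rule: span_induct)
    case base
    show ?case using f g z by (intro subspaceI) auto
  qed (use calculation in auto)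
qed

lemma b_sym: "b y x = eps * b x y"
  by (rule sesquilinear_eqI[where f = "\<lambda>x y. b y x" and c' = "\<lambda>c. c" and g = "\<lambda>x y. eps * b x y"])
    (rule b_basis_sym, assumption, assumption | simp add: b_simps algebra_simps)+

text \<open>The antilinear map \<open>\<sigma>\<close> with \<open>h(x,y) = b(x,\<sigma> y)\<close>, as an additive endomorphism.\<close>

lemma ex_sg: "\<exists>s. (\<forall>c x. app s (sc c x) = sc (cnj c) (app s x)) \<and> (\<forall>i\<in>I. app s (e i) = sc (mu i) (e (tw i)))"
proof -
  \<comment> \<open>An antilinear map is a linear map into the conjugate space, so the extension of
    a map from a basis is available for it.\<close>
  interpret c: vector_space "\<lambda>c. sc (cnj c)"
    by standard (simp_all add: scale_right_distrib scale_left_distrib)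
  interpret pair: vector_space_pair sc "\<lambda>c. sc (cnj c)" ..
  obtain g where g: "Vector_Spaces.linear sc (\<lambda>c. sc (cnj c)) g"
    "\<forall>x\<in>e ` I. g x = sc (mu (inv_into I e x)) (e (tw (inv_into I e x)))"
    using pair.linear_independent_extend[OF independent_e,
      of "\<lambda>x. sc (mu (inv_into I e x)) (e (tw (inv_into I e x)))"] by blast
  have add: "g (x + y) = g x + g y" and scale: "g (sc c x) = sc (cnj c) (g x)" for x y c
    using g(1) unfolding Vector_Spaces.linear_iff by blast+
  have "app (Endo g) = g" using add by (rule app_Endo)
  moreover have "\<forall>i\<in>I. g (e i) = sc (mu i) (e (tw i))" using g(2) inj_e by simp
  ultimately show ?thesis using scale by metis
qed

definition sg :: "'v endo" where
  "sg = (SOME s. (\<forall>c x. app s (sc c x) = sc (cnj c) (app s x)) \<and> (\<forall>i\<in>I. app s (e i) = sc (mu i) (e (tw i))))"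

lemma sg_scale: "app sg (sc c x) = sc (cnj c) (app sg x)" and sg_e: "i \<in> I \<Longrightarrow> app sg (e i) = sc (mu i) (e (tw i))"
  using someI_ex[OF ex_sg] unfolding sg_def[symmetric] by blast+

lemma b_sg: "b x (app sg y) = h x y"
  by (rule sesquilinear_eqI[where f = "\<lambda>x y. b x (app sg y)" and c' = cnj and g = "\<lambda>x y. h x y"])
    (simp_all add: b_simps h_simps app_add sg_scale sg_e b_basis_tw)

lemma sg_sg: "app sg (app sg x) = sc sig x"
proof -
  have "Vector_Spaces.linear sc sc (\<lambda>x. app sg (app sg x))" "Vector_Spaces.linear sc sc (\<lambda>x. sc sig x)"
    by (simp_all add: linear_iff app_add sg_scale scale_right_distrib mult.commute)
  then have "(\<lambda>x. app sg (app sg x)) = (\<lambda>x. sc sig x)"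
  proof (rule linear_eqI)
    fix i assume i: "i \<in> I"
    show "app sg (app sg (e i)) = sc sig (e i)"
      using mu_tw[OF i] by (simp add: sg_e i sg_scale tw_I tw_tw)
  qed
  then show ?thesis by metis
qed

lemma b_eq: "b x y = sig * h x (app sg y)"
proof -
  have "sig * b x y = h x (app sg y)" using b_sg[of x "app sg y"] by (simp add: sg_sg b_scale_right)
  then show ?thesis by (metis sig_sig(2))
qed

text \<open>The sign \<open>sig * eps\<close> is 1 for SO(\<infinity>,q) and Sp(\<infinity>,q) and
  -1 for the other two forms, where \<sigma> exchanges positive and negative vectors.\<close>

lemma h_sg: "h (app sg x) (app sg y) = sig * eps * h y x"
proof -
  have "h (app sg x) (app sg y) = b (app sg x) (app sg (app sg y))" by (simp add: b_sg)
  also have "\<dots> = sig * eps * b y (app sg x)"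
    using b_sym[of y "app sg x"] by (simp add: sg_sg b_scale_right b_sym[of "app sg x" y])
  finally show ?thesis by (simp add: b_sg)
qed

lemma h_sg_left: "h (app sg x) y = eps * h (app sg y) x"
proof -
  have "h (app sg x) (app sg (app sg y)) = sig * eps * h (app sg y) x" by (rule h_sg)
  then show ?thesis by (simp add: sg_sg h_scale_right)
qed

lemma b_nondeg: "(\<And>y. b x y = 0) \<Longrightarrow> x = 0"
  using h_nondeg b_sg by metis

lemma b_nondeg_right: "(\<And>x. b x y = 0) \<Longrightarrow> y = 0"
  using b_nondeg b_sym by (metis mult_zero_right)

lemma tw_S: assumes i: "i \<in> S n" shows "tw i \<in> S n"
proof (rule ccontr)
  assume t: "tw i \<notin> S n"
  have iI: "i \<in> I" using i S_sub by blast
  have "b (e i) y = 0" if "y \<in> V n" for y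
  proof -
    have "h y (e (tw i)) = 0" using that t tw_I[OF iI] by (intro h_V_outside) auto
    then have "b y (e i) = 0" by (simp add: b_eq sg_e iI h_scale_right)
    then show ?thesis using b_sym[of "e i" y] by simp
  qed
  then have "e i = 0" using nondeg_b[OF not_SU, of n] e_V[OF i] by (auto simp: nondegenerate_on_def)
  then show False using co_e[OF iI iI] by simp
qed

lemma sg_V: assumes x: "x \<in> V n" shows "app sg x \<in> V n"
proof -
  have "x \<in> span (e ` S n)" using x by (simp add: V_level_def)
  then show ?thesis
  proof (induction rule: span_induct)
    case base
    show ?case
      by (intro subspaceI)
        (simp_all add: app_add sg_scale subspace_add[OF V_subspace] subspace_scale[OF V_subspace] subspace_0[OF V_subspace])
  next
    case (step x)
    then obtain i where i: "i \<in> S n" "x = e i" by blast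
    then have "app sg x = sc (mu i) (e (tw i))" using sg_e S_sub by blast
    then show ?case using e_V[OF tw_S[OF i(1)]] V_subspace by (simp add: subspace_scale)
  qed
qed

end

section \<open>Orthogonal systems as a measure of the rank of h\<close>

context flag_space begin

text \<open>The equivalence also says that h(w,w) is nonzero for every member, which is not
  automatic as h is indefinite.\<close>

definition orthogonal_system :: "'v set \<Rightarrow> bool" where
  "orthogonal_system W \<longleftrightarrow> finite W \<and> (\<forall>w\<in>W. \<forall>w'\<in>W. h w w' = 0 \<longleftrightarrow> w \<noteq> w')"

definition proj :: "'v set \<Rightarrow> 'v \<Rightarrow> 'v" where
  "proj W x = (\<Sum>w\<in>W. sc (h x w / h w w) w)"

lemma orthogonal_systemD:
  assumes "orthogonal_system W"
  shows "finite W" "w \<in> W \<Longrightarrow> h w w \<noteq> 0" "w \<in> W \<Longrightarrow> w' \<in> W \<Longrightarrow> w \<noteq> w' \<Longrightarrow> h w w' = 0"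
  using assms unfolding orthogonal_system_def by blast+

lemma proj_span: "proj W x \<in> span W"
  unfolding proj_def by (intro span_sum span_scale span_base)

lemma proj_mem: "subspace A \<Longrightarrow> W \<subseteq> A \<Longrightarrow> proj W x \<in> A"
  using proj_span span_minimal by blast

lemma h_proj:
  assumes W: "orthogonal_system W" and w: "w \<in> W" shows "h (proj W x) w = h x w"
proof -
  have "h (proj W x) w = (\<Sum>v\<in>W. if v = w then h x w else 0)"
    unfolding proj_def h_sum_left
    using orthogonal_systemD[OF W] w by (intro sum.cong refl) (auto simp: h_scale_left)
  then show ?thesis using orthogonal_systemD(1)[OF W] w by simp
qed

lemma h_diff_proj: "orthogonal_system W \<Longrightarrow> w \<in> W \<Longrightarrow> h (x - proj W x) w = 0"
  by (simp add: h_diff_left h_proj)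

lemma h_proj_right_0: "(\<And>w. w \<in> W \<Longrightarrow> h x w = 0) \<Longrightarrow> h x (proj W y) = 0"
  unfolding proj_def by (simp add: h_sum_right h_scale_right)

lemma orthogonal_system_independent:
  assumes W: "orthogonal_system W" shows "independent W"
proof
  assume "dependent W"
  then obtain t u v where t: "finite t" "t \<subseteq> W" "(\<Sum>v\<in>t. sc (u v) v) = 0" "v \<in> t" "u v \<noteq> 0"
    unfolding dependent_explicit by blast
  have "0 = h (\<Sum>v\<in>t. sc (u v) v) v" using t by simp
  also have "\<dots> = (\<Sum>w\<in>t. if w = v then u v * h v v else 0)"
    unfolding h_sum_left
  proof (intro sum.cong refl)
    fix w assume "w \<in> t"
    then show "h (sc (u w) w) v = (if w = v then u v * h v v else 0)"
      using orthogonal_systemD[OF W] t(2,4) by (auto simp: h_scale_left subset_iff)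
  qed
  also have "\<dots> = u v * h v v" using t by simp
  finally show False using t orthogonal_systemD(2)[OF W] by auto
qed

lemma orthogonal_system_Un:
  assumes "orthogonal_system W" "orthogonal_system W'" "\<And>w w'. w \<in> W \<Longrightarrow> w' \<in> W' \<Longrightarrow> h w w' = 0"
  shows "orthogonal_system (W \<union> W')" "W \<inter> W' = {}"
proof -
  have sym: "h w' w = 0" if "w \<in> W" "w' \<in> W'" for w w' using assms(3)[OF that] h_sym_0 by simp
  show disj: "W \<inter> W' = {}" using assms by (metis disjoint_iff orthogonal_systemD(2))
  show "orthogonal_system (W \<union> W')"
    unfolding orthogonal_system_def
  proof (intro conjI ballI)
    show "finite (W \<union> W')" using assms orthogonal_systemD(1) by blast
    fix v w assume "v \<in> W \<union> W'" "w \<in> W \<union> W'"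
    then show "h v w = 0 \<longleftrightarrow> v \<noteq> w"
      using assms sym disj unfolding orthogonal_system_def by blast
  qed
qed

text \<open>The complement of W in A is exactly the radical of h on A, so that \<open>card W\<close>
  is the rank of h on A.\<close>

definition complete_system :: "'v set \<Rightarrow> 'v set \<Rightarrow> bool" where
  "complete_system W A \<longleftrightarrow> orthogonal_system W \<and> W \<subseteq> A \<and>
     (\<forall>x\<in>A. (\<forall>w\<in>W. h x w = 0) \<longrightarrow> (\<forall>y\<in>A. h x y = 0))"

lemma polarization:
  assumes "h x x = 0" "h y y = 0" "h (x + y) (x + y) = 0" "h (x + sc \<i> y) (x + sc \<i> y) = 0"
  shows "h x y = 0"
proof -
  have 1: "h x y + h y x = 0" using assms by (simp add: h_simps)
  have "\<i> * (h y x - h x y) = 0" using assms by (simp add: h_simps algebra_simps)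
  then have "h y x = h x y" by simp
  then show ?thesis using 1 by simp
qed

text \<open>A system W of maximal size in A works. A vector of A orthogonal to W is null, since
  otherwise it could be added to W. By polarization the complement of W in A is then totally
  isotropic, and hence it is the radical.\<close>

lemma exists_complete_system:
  assumes A: "subspace A" "A \<subseteq> V n"
  obtains W where "complete_system W A"
proof -
  let ?P = "\<lambda>W. orthogonal_system W \<and> W \<subseteq> A"
  have "card W < Suc (card (e ` S n))" if "?P W" for W
  proof -
    have "W \<subseteq> span (e ` S n)" using that A by (auto simp: V_level_def)
    then have "card W \<le> card (e ` S n)"
      using independent_span_bound[of "e ` S n" W] orthogonal_system_independent that S_finite by blast
    then show ?thesis by simp
  qed
  moreover have "?P {}" by (simp add: orthogonal_system_def)
  ultimately obtain W where W: "?P W" and max: "\<And>W'. ?P W' \<Longrightarrow> card W' \<le> card W"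
    using ex_has_greatest_nat[of ?P "{}" card "Suc (card (e ` S n))"] by blast
  have null: "h x x = 0" if x: "x \<in> A" "\<forall>w\<in>W. h x w = 0" for x
  proof (rule ccontr)
    assume nz: "h x x \<noteq> 0"
    then have "x \<notin> W" using x by auto
    moreover have "?P (insert x W)"
      using W x nz h_sym_0 unfolding orthogonal_system_def by auto
    ultimately show False using max[of "insert x W"] W by (simp add: orthogonal_system_def)
  qed
  have rad: "h x y = 0" if x: "x \<in> A" "\<forall>w\<in>W. h x w = 0" and y: "y \<in> A" for x y
  proof -
    let ?y = "y - proj W y"
    have y': "?y \<in> A" "\<forall>w\<in>W. h ?y w = 0"
      using A(1) y W proj_mem h_diff_proj by (auto intro: subspace_diff)
    have "h (x + sc c ?y) (x + sc c ?y) = 0" for c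
      using A(1) x y' by (intro null) (auto simp: h_simps intro: subspace_add subspace_scale)
    then have "h x ?y = 0"
      using polarization[of x ?y] null[OF x] null[OF y'] by (metis scale_one)
    moreover have "h x (proj W y) = 0" using x h_proj_right_0 by blast
    ultimately show ?thesis by (simp add: h_diff_right)
  qed
  have "complete_system W A" unfolding complete_system_def using W rad by blast
  then show ?thesis by (rule that)
qed

text \<open>Projection to the span of W changes a vector of A only by an element of the radical and
  so preserves h on A. It therefore takes W' injectively to an orthogonal, hence independent, system
  in the span of W.\<close>

lemma card_le_complete_system:
  assumes A: "subspace A" and W: "complete_system W A" and W': "orthogonal_system W'" "W' \<subseteq> A"
  shows "card W' \<le> card W"
proof -
  have oW: "orthogonal_system W" "W \<subseteq> A" using W by (auto simp: complete_system_def)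
  have rad: "h (x - proj W x) y = 0" if "x \<in> A" "y \<in> A" for x y
  proof -
    have "x - proj W x \<in> A" using that A proj_mem[OF A oW(2)] by (auto intro: subspace_diff)
    then show ?thesis using W that h_diff_proj[OF oW(1)] unfolding complete_system_def by blast
  qed
  have eq: "h (proj W x) (proj W y) = h x y" if xy: "x \<in> A" "y \<in> A" for x y
  proof -
    have "h (y - proj W y) (proj W x) = 0" using rad xy proj_mem[OF A oW(2)] by blast
    then have "h (proj W x) y = h (proj W x) (proj W y)"
      by (metis h_sym_0 h_diff_right eq_iff_diff_eq_0)
    moreover have "h x y = h (proj W x) y" using rad[OF xy] by (simp add: h_diff_left)
    ultimately show ?thesis by simp
  qed
  have inj: "inj_on (proj W) W'"
  proof (rule inj_onI, rule ccontr)
    fix w w' assume w: "w \<in> W'" "w' \<in> W'" "proj W w = proj W w'" "w \<noteq> w'"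
    then have "h w w = h w w'" using eq W'(2) by (metis subsetD)
    then show False using w orthogonal_systemD[OF W'(1)] by metis
  qed
  have "orthogonal_system (proj W ` W')"
    using W' eq inj unfolding orthogonal_system_def inj_on_def by (auto simp: subset_iff)
  moreover have "proj W ` W' \<subseteq> span W" using proj_span by blast
  ultimately have "card (proj W ` W') \<le> card W"
    using independent_span_bound[of W] orthogonal_system_independent orthogonal_systemD(1)[OF oW(1)] by blast
  then show ?thesis by (simp add: card_image[OF inj])
qed

lemma image_span_split:
  assumes A: "A \<subseteq> I" and g: "g \<in> GL_level n" and x: "x \<in> g ` span (e ` A)"
  obtains y z where "x = y + z" "y \<in> g ` span (e ` A) \<inter> V n" "z \<in> span (e ` (A - S n))"
proof -
  obtain u where u: "u \<in> span (e ` A)" "x = g u" using x by blast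
  obtain y z where yz: "u = y + z" "y \<in> span (e ` A) \<inter> V n" "z \<in> span (e ` (A - S n))"
    using split_level[OF A u(1)] by metis
  have "g z = z" using GL_fixes_span[OF g _ yz(3)] A by blast
  then have "x = g y + z" using u yz linearD(1)[OF GL_linear[OF g]] by simp
  moreover have "g y \<in> g ` span (e ` A) \<inter> V n" using yz GL_V_mem[OF g] by blast
  ultimately show ?thesis using that yz by blast
qed

lemma outside_subset_image:
  assumes A: "A \<subseteq> I" and g: "g \<in> GL_level n"
  shows "span (e ` (A - S n)) \<subseteq> g ` span (e ` A)"
proof
  fix z assume z: "z \<in> span (e ` (A - S n))"
  then have "g z = z" using GL_fixes_span[OF g _ z] A by blast
  moreover have "z \<in> span (e ` A)" using z span_mono[of "e ` (A - S n)" "e ` A"] by blast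
  ultimately show "z \<in> g ` span (e ` A)" by (metis imageI)
qed

text \<open>The maximal size of an orthogonal system measures the rank of \<open>h\<close> on a finite-dimensional
  subspace; it is invariant under isometries and additive along \<open>V = V\<^sub>n \<oplus> span (E - E\<^sub>n)\<close>.\<close>

lemma orthogonal_system_card_le:
  assumes A: "A \<subseteq> I" and g: "g \<in> GL_level n" and k: "k \<in> GL_level n"
    and u: "u \<in> h_preserving_level D l" and eq: "u ` Y = k ` Y" and Y: "Y = g ` span (e ` A)"
    and W: "complete_system W (Y \<inter> V n)" and W2: "orthogonal_system W2" "W2 \<subseteq> k ` (Y \<inter> V n)"
  shows "card W2 \<le> card W"
proof -
  define L where "L = max l n"
  have uL: "u \<in> GL_level L" "\<And>x y. h (u x) (u y) = h x y"
    using u H_mono[of l L] G_level_GL by (auto simp: H_iff L_def)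
  have nL: "V n \<subseteq> V L" using V_mono by (simp add: L_def)
  \<comment> \<open>The isometry u need not preserve V_n, so ranks are compared in the larger V_L.
    There \<open>Y \<inter> V L\<close> is the orthogonal sum of \<open>Y \<inter> V n\<close> and
    \<open>?Z\<close>; as k fixes \<open>?Z\<close>, its contribution occurs on both sides and
    cancels.\<close>
  let ?Z = "span (e ` ((A - S n) \<inter> S L))"
  have ASn: "A - S n \<subseteq> I - S n" using A by blast
  have Zeq: "?Z = span (e ` (A - S n)) \<inter> V L" unfolding V_level_def using A S_sub by (subst span_Int) auto
  have Zn: "?Z \<subseteq> span (e ` (A - S n))" using Zeq by blast
  have ZY: "?Z \<subseteq> Y \<inter> V L" using Zeq outside_subset_image[OF A g] Y by blast
  have ZV: "h y z = 0" "h z y = 0" if "y \<in> V n" "z \<in> ?Z" for y z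
    using h_V_span_outside[OF that(1) ASn] Zn that(2) h_sym_0 by blast+
  obtain Wz where Wz: "complete_system Wz ?Z"
    using exists_complete_system[OF subspace_span, of _ L] Zeq by blast
  have oW: "orthogonal_system W" "W \<subseteq> Y \<inter> V n" and oZ: "orthogonal_system Wz" "Wz \<subseteq> ?Z"
    using W Wz by (auto simp: complete_system_def)
  have subY: "subspace (Y \<inter> V L)"
  proof -
    have "subspace Y" unfolding Y
      by (rule GL_linear[OF g, THEN Vector_Spaces.linear.axioms(3), THEN module_hom.subspace_image, OF subspace_span])
    then show ?thesis using V_subspace by (simp add: subspace_inter)
  qed
  have split: "\<exists>y z. x = y + z \<and> y \<in> Y \<inter> V n \<and> z \<in> ?Z" if x: "x \<in> Y \<inter> V L" for x
  proof -
    obtain y z where yz: "x = y + z" "y \<in> Y \<inter> V n" "z \<in> span (e ` (A - S n))"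
      using image_span_split[OF A g, of x] x Y by blast
    have "z = x - y" using yz by simp
    moreover have "x - y \<in> V L" using x yz(2) nL by (intro subspace_diff[OF V_subspace]) auto
    ultimately have "z \<in> V L" by simp
    then show ?thesis using yz Zeq by blast
  qed
  have WWz: "orthogonal_system (W \<union> Wz)" "W \<inter> Wz = {}"
    using orthogonal_system_Un[OF oW(1) oZ(1)] ZV oW oZ by blast+
  have comp: "complete_system (W \<union> Wz) (Y \<inter> V L)"
    unfolding complete_system_def
  proof (intro conjI WWz ballI impI)
    show "W \<union> Wz \<subseteq> Y \<inter> V L" using oW oZ ZY nL by blast
    fix x x' assume x: "x \<in> Y \<inter> V L" "\<forall>w\<in>W \<union> Wz. h x w = 0" and x': "x' \<in> Y \<inter> V L"
    obtain y z where yz: "x = y + z" "y \<in> Y \<inter> V n" "z \<in> ?Z" using split[OF x(1)] by blast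
    obtain y' z' where yz': "x' = y' + z'" "y' \<in> Y \<inter> V n" "z' \<in> ?Z" using split[OF x'] by blast
    have "h y w = 0" if w: "w \<in> W" for w
    proof -
      have "h z w = 0" using ZV(2) w oW yz by blast
      moreover have "h x w = 0" using x(2) w by blast
      ultimately show ?thesis using yz(1) by (simp add: h_add_left)
    qed
    then have 1: "h y y' = 0" using W yz yz' unfolding complete_system_def by blast
    have "h z w = 0" if w: "w \<in> Wz" for w
    proof -
      have "h y w = 0" using ZV(1) w oZ yz by blast
      moreover have "h x w = 0" using x(2) w by blast
      ultimately show ?thesis using yz(1) by (simp add: h_add_left)
    qed
    then have 2: "h z z' = 0" using Wz yz yz' unfolding complete_system_def by blast
    have "h y z' = 0" "h z y' = 0" using ZV yz yz' by blast+
    then show "h x x' = 0" using 1 2 by (simp add: yz yz' h_simps)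
  qed
  have W2V: "W2 \<subseteq> V n" using W2(2) GL_V_mem[OF k] by blast
  have W2z: "orthogonal_system (W2 \<union> Wz)" "W2 \<inter> Wz = {}"
    using orthogonal_system_Un[OF W2(1) oZ(1)] ZV W2V oZ by blast+
  have "Wz \<subseteq> k ` Y"
  proof
    fix z assume "z \<in> Wz"
    then have "z \<in> ?Z" using oZ by blast
    then have "k z = z" "z \<in> Y" using GL_fixes_span[OF k ASn] Zn ZY by blast+
    then show "z \<in> k ` Y" by (metis imageI)
  qed
  then have "W2 \<union> Wz \<subseteq> u ` Y \<inter> V L" using W2(2) W2V eq nL oZ ZY by blast
  then have sub: "W2 \<union> Wz \<subseteq> u ` (Y \<inter> V L)" using GL_image_Int_V[OF uL(1)] by simp
  have bu: "bij u" using GL_bij uL by blast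
  then have inv: "u (inv u x) = x" for x by (simp add: bij_def surj_f_inv_f)
  have inji: "inj (inv u)" using bu by (simp add: bij_imp_bij_inv bij_is_inj)
  have hi: "h (inv u x) (inv u y) = h x y" for x y using uL(2) inv by metis
  have "orthogonal_system (inv u ` (W2 \<union> Wz))"
    using W2z(1) hi inji unfolding orthogonal_system_def by (auto simp: inj_def)
  moreover have "inv u ` (W2 \<union> Wz) \<subseteq> Y \<inter> V L"
    using sub bu by (auto simp: bij_def inv_f_f)
  ultimately have "card (inv u ` (W2 \<union> Wz)) \<le> card (W \<union> Wz)"
    by (rule card_le_complete_system[OF subY comp])
  moreover have "card (inv u ` (W2 \<union> Wz)) = card W2 + card Wz"
    using W2z orthogonal_systemD(1)[OF W2(1)] orthogonal_systemD(1)[OF oZ(1)]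
    by (subst card_image) (use inji in \<open>auto intro: inj_on_subset simp: card_Un_disjoint\<close>)
  moreover have "card (W \<union> Wz) = card W + card Wz"
    using WWz orthogonal_systemD(1)[OF oW(1)] orthogonal_systemD(1)[OF oZ(1)] by (simp add: card_Un_disjoint)
  ultimately show ?thesis by simp
qed

end

section \<open>Degenerate flags have orbits that are not open\<close>

context flag_space begin

lemma subspace_GL_image: "g \<in> GL_level n \<Longrightarrow> subspace X \<Longrightarrow> subspace (g ` X)"
  by (rule GL_linear[THEN Vector_Spaces.linear.axioms(3), THEN module_hom.subspace_image])

lemma h_proj_0: "(\<And>w. w \<in> W \<Longrightarrow> h w x = 0) \<Longrightarrow> h (proj W y) x = 0"
  unfolding proj_def by (simp add: h_sum_left h_scale_left)

lemma unipotent_GL: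
  assumes N: "Vector_Spaces.linear sc sc N" "\<And>x. N (N x) = 0" "\<And>x. N x \<in> V n" "\<And>j. j \<in> I - S n \<Longrightarrow> N (e j) = 0"
  shows "(\<lambda>x. x + sc t (N x)) \<in> GL_level n" "det_on (S n) (mat_entries D (\<lambda>x. x + sc t (N x))) = 1"
proof -
  note lin = linearD[OF N(1)]
  let ?k = "\<lambda>t x. x + sc t (N x)"
  have kk: "?k t (?k (- t) x) = x" for t x
    by (simp add: lin N(2))
  have kV: "?k t x \<in> V n" if "x \<in> V n" for t x
    using that N(3) by (intro subspace_add[OF V_subspace] subspace_scale[OF V_subspace])
  have "bij (?k t)"
  proof (rule o_bij)
    show "?k (- t) \<circ> ?k t = id" "?k t \<circ> ?k (- t) = id"
      using kk[where t = "- t"] kk[where t = t] by (auto simp: fun_eq_iff)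
  qed
  moreover have "?k t ` V n = V n"
  proof
    show "V n \<subseteq> ?k t ` V n"
    proof
      fix x assume "x \<in> V n"
      then show "x \<in> ?k t ` V n"
        using kk[where t = t and x = x] kV[where t = "- t" and x = x] by (intro image_eqI[of _ _ "?k (- t) x"]) auto
    qed
  qed (use kV in blast)
  moreover have "Vector_Spaces.linear sc sc (?k t)"
    unfolding linear_iff by (simp add: lin scale_right_distrib mult.commute)
  ultimately show "?k t \<in> GL_level n" by (simp add: GL_level_def N(4))
  let ?B = "\<lambda>i j. t * co i (N (e j))"
  have "det_on (S n) (mat_entries D (?k t)) = det_on (S n) (\<lambda>i j. (if i = j then 1 else 0) + ?B i j)"
    using S_sub by (intro det_on_cong) (auto simp: mat_entries_eq co_e subset_iff)
  also have "\<dots> = 1"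
  proof (rule det_on_unipotent[OF S_finite])
    fix i j
    have "(\<Sum>k\<in>S n. ?B i k * ?B k j) = t * t * (\<Sum>k\<in>S n. co i (N (e k)) * co k (N (e j)))"
      by (simp add: sum_distrib_left mult_ac)
    also have "\<dots> = 0" using co_linear_expand[OF N(1) N(3), of i "e j"] by (simp add: N(2))
    finally show "(\<Sum>k\<in>S n. ?B i k * ?B k j) = 0" .
  qed
  finally show "det_on (S n) (mat_entries D (?k t)) = 1" .
qed

end

context flag_setting_chain begin

text \<open>Along \<open>1 + tN\<close>, which fixes \<open>W\<close>, a vector of the radical of \<open>h\<close> on \<open>g1 X \<inter> V\<^sub>n\<close> becomes
  non-null, so that the rank of \<open>h\<close> increases for arbitrarily small \<open>t\<close>.\<close>

lemma not_open_if_nilpotent: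
  assumes g1: "g1 \<in> G_level D n" and X: "X \<in> F" and Y: "Y = g1 ` X"
    and W: "complete_system W (Y \<inter> V n)"
    and N: "Vector_Spaces.linear sc sc N" "\<And>x. N (N x) = 0" "\<And>x. N x \<in> V n" "\<And>j. j \<in> I - S n \<Longrightarrow> N (e j) = 0"
    and Nb: "\<And>x y. \<not> is_SU (form D) \<Longrightarrow> b (N x) y + b x (N y) = 0" "\<And>x y. \<not> is_SU (form D) \<Longrightarrow> b (N x) (N y) = 0"
    and NW: "\<And>w. w \<in> W \<Longrightarrow> N w = 0"
    and r: "r \<in> Y \<inter> V n" "r' \<in> Y \<inter> V n" "\<And>y. y \<in> Y \<inter> V n \<Longrightarrow> h r y = 0" "\<And>y. y \<in> Y \<inter> V n \<Longrightarrow> h r' y = 0"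
    and Nr: "\<And>w. w \<in> W \<Longrightarrow> h (N r) w = 0" "\<And>w. w \<in> W \<Longrightarrow> h (N r') w = 0"
    and nz: "h (N r) r' \<noteq> 0 \<or> h (N r) (N r') \<noteq> 0"
  shows "\<not> openin (flag_topology D F) (orbit (G0 D) (act g1 F))"
proof
  assume op: "openin (flag_topology D F) (orbit (G0 D) (act g1 F))"
  note lin = linearD[OF N(1)]
  define k where "k t x = x + sc t (N x)" for t x
  have kGL: "k t \<in> GL_level n" "det_on (S n) (mat_entries D (k t)) = 1" for t
    using unipotent_GL[OF N] by (simp_all add: k_def[abs_def])
  have kG: "k t \<in> G_level D n" for t
  proof -
    have "b (k t x) (k t y) = b x y" if SU: "\<not> is_SU (form D)" for x y
    proof -
      interpret bilinear_space D by standard (rule SU)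
      have eq: "b (k t x) (k t y) = b x y + t * (b (N x) y + b x (N y)) + t * t * b (N x) (N y)"
        by (simp add: k_def b_simps algebra_simps)
      show ?thesis unfolding eq Nb[OF SU] by simp
    qed
    then show ?thesis using kGL by (simp add: G_level_iff)
  qed
  have oW: "orthogonal_system W" "W \<subseteq> Y \<inter> V n" using W by (auto simp: complete_system_def)
  obtain W0 where W0: "open W0" "{g \<in> G_level D n. act g F \<in> orbit (G0 D) (act g1 F)} = {g \<in> G_level D n. mat_entries D g \<in> W0}"
    using op unfolding openin_flag_topology openin_level_topology by blast
  define M where "M t i j = mat_entries D g1 i j + t * (if i \<in> I \<and> j \<in> I then co i (N (g1 (e j))) else 0)" for t i j
  have M: "mat_entries D (k t \<circ> g1) = M t" for t
    by (intro ext) (auto simp: M_def mat_entries_eq k_def)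
  have "continuous_on UNIV M"
    by (intro continuous_on_coordinatewise_then_product) (auto simp: M_def intro!: continuous_intros)
  then have "open (M -` W0)" using W0(1) by (simp add: continuous_on_open_vimage)
  moreover have "0 \<in> M -` W0"
  proof -
    have "act g1 F \<in> orbit (G0 D) (act g1 F)" using G0_id by (force simp: orbit_def act_id intro: image_eqI[of _ _ id])
    then have "mat_entries D g1 \<in> W0" using W0(2) g1 by blast
    moreover have "M 0 = mat_entries D g1" by (intro ext) (simp add: M_def)
    ultimately show ?thesis by simp
  qed
  ultimately obtain d where d: "0 < d" "ball 0 d \<subseteq> M -` W0" using open_contains_ball by blast
  have hit: "act (k t \<circ> g1) F \<in> orbit (G0 D) (act g1 F)" if "cmod t < d" for t
  proof -
    have "M t \<in> W0" using d(2) that by (auto simp: subset_iff)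
    then have "k t \<circ> g1 \<in> {g \<in> G_level D n. mat_entries D g \<in> W0}"
      using M[of t] G_level_comp[OF kG g1, of t] by simp
    then show ?thesis unfolding W0(2)[symmetric] by simp
  qed
  have kh: "h (k t r) (k t r') = t * h (N r) r' + cnj t * h r (N r') + t * cnj t * h (N r) (N r')" for t
    using r by (simp add: k_def h_simps algebra_simps)
  \<comment> \<open>The value is a combination of t, \<open>cnj t\<close> and their product. If it
    vanished at \<delta>, - \<delta> and \<i>\<delta>, all three coefficients would be 0, against
    \<open>nz\<close>.\<close>
  have "\<exists>t. cmod t < d \<and> h (k t r) (k t r') \<noteq> 0"
  proof (rule ccontr)
    assume "\<not> ?thesis"
    then have z: "h (k t r) (k t r') = 0" if "cmod t < d" for t using that by blast
    define \<delta> where "\<delta> = complex_of_real (d / 2)"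
    have \<delta>: "\<delta> \<noteq> 0" "cmod \<delta> < d" "cnj \<delta> = \<delta>" using d by (simp_all add: \<delta>_def norm_divide)
    let ?a = "h (N r) r'" and ?b = "h r (N r')" and ?c = "h (N r) (N r')"
    have 1: "\<delta> * ?a + \<delta> * ?b + \<delta> * \<delta> * ?c = 0" using z[OF \<delta>(2)] \<delta>(3) by (simp add: kh)
    have 2: "- \<delta> * ?a - \<delta> * ?b + \<delta> * \<delta> * ?c = 0" using z[of "- \<delta>"] \<delta> by (simp add: kh)
    have 3: "\<i> * \<delta> * ?a - \<i> * \<delta> * ?b + \<delta> * \<delta> * ?c = 0" using z[of "\<i> * \<delta>"] \<delta> by (simp add: kh norm_mult algebra_simps)
    have "2 * (\<delta> * \<delta> * ?c) = 0" using 1 2 by (simp add: algebra_simps)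
    then have c: "?c = 0" using \<delta> by simp
    have "\<delta> * (?a + ?b) = 0" using 1 c by (simp add: algebra_simps)
    moreover have "\<i> * \<delta> * (?a - ?b) = 0" using 3 c by (simp add: algebra_simps)
    ultimately have "?a + ?b = 0" "?a - ?b = 0" using \<delta>(1) by auto
    then have "?a = 0" by simp
    then show False using c nz by simp
  qed
  then obtain t where t: "cmod t < d" "h (k t r) (k t r') \<noteq> 0" by blast
  let ?k = "k t"
  have subY: "subspace (Y \<inter> V n)"
  proof -
    obtain A where "X = span (e ` A)" using F_span[OF X] by metis
    then have "subspace Y" unfolding Y using subspace_GL_image[OF G_level_GL[OF g1]] by simp
    then show ?thesis using V_subspace by (simp add: subspace_inter)
  qed
  \<comment> \<open>Polarization turns the nonzero value of h on the images of r and r' into one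
    combination of r and r' whose image is not null. It is orthogonal to W, so that it enlarges the
    orthogonal system.\<close>
  have "\<exists>x\<in>Y \<inter> V n. (\<forall>w\<in>W. h (?k x) w = 0) \<and> h (?k x) (?k x) \<noteq> 0"
  proof -
    have klin: "?k (x + y) = ?k x + ?k y" "?k (sc c x) = sc c (?k x)" for x y c
      using linearD[OF GL_linear[OF kGL(1)]] by blast+
    have perp: "h (?k r) w = 0" "h (?k r') w = 0" if "w \<in> W" for w
      using r(3)[of w] r(4)[of w] Nr[OF that] that oW(2) by (auto simp: k_def h_simps subset_iff)
    have mem: "r + r' \<in> Y \<inter> V n" "r + sc \<i> r' \<in> Y \<inter> V n"
      using subspace_add[OF subY r(1) r(2)] subspace_add[OF subY r(1) subspace_scale[OF subY r(2)]] by blast+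
    have "\<exists>x\<in>{r, r', r + r', r + sc \<i> r'}. h (?k x) (?k x) \<noteq> 0"
      using polarization[of "?k r" "?k r'"] t(2) by (auto simp: klin)
    then obtain x where x: "x \<in> {r, r', r + r', r + sc \<i> r'}" "h (?k x) (?k x) \<noteq> 0" by blast
    have "x \<in> Y \<inter> V n" using x(1) mem r(1,2) by blast
    moreover have "\<forall>w\<in>W. h (?k x) w = 0" using x(1) perp by (auto simp: klin h_simps)
    ultimately show ?thesis using x(2) by blast
  qed
  then obtain x where x: "x \<in> Y \<inter> V n" "\<And>w. w \<in> W \<Longrightarrow> h (?k x) w = 0" "h (?k x) (?k x) \<noteq> 0" by blast
  have kW: "?k w = w" if "w \<in> W" for w using NW[OF that] by (simp add: k_def)
  have W2: "orthogonal_system (insert (?k x) W)" "?k x \<notin> W" "insert (?k x) W \<subseteq> ?k ` (Y \<inter> V n)"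
  proof -
    have "orthogonal_system {?k x}" using x(3) by (simp add: orthogonal_system_def)
    then show "orthogonal_system (insert (?k x) W)" "?k x \<notin> W"
      using orthogonal_system_Un[of "{?k x}" W] oW(1) x(2) by auto
    have "W \<subseteq> ?k ` (Y \<inter> V n)"
    proof
      fix w assume "w \<in> W"
      then show "w \<in> ?k ` (Y \<inter> V n)" using kW[of w] oW(2) by (metis imageI subsetD)
    qed
    then show "insert (?k x) W \<subseteq> ?k ` (Y \<inter> V n)" using x(1) by blast
  qed
  obtain u where u: "u \<in> G0 D" "act (?k \<circ> g1) F = act u (act g1 F)"
    using hit[OF t(1)] by (auto simp: orbit_def)
  obtain l where l: "u \<in> h_preserving_level D l" using G0_level[OF u(1)] by blast
  have "?k ` Y \<in> act (?k \<circ> g1) F" using X Y by (auto simp: act_def image_comp[symmetric])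
  then have "?k ` Y \<in> act (u \<circ> g1) F" using u(2) by (simp add: act_comp)
  then obtain X' where X': "X' \<in> F" "(?k \<circ> g1) ` X = (u \<circ> g1) ` X'" using Y by (auto simp: act_def image_comp)
  \<comment> \<open>A priori u could take another member of the flag to the moved one. On every
    large level the two members are comparable and have images of the same dimension, so they
    coincide.\<close>
  have "X = X'"
  proof -
    obtain A A' where AA: "X = span (e ` A)" "X' = span (e ` A')" using F_span X X'(1) by metis
    have "X \<inter> V L = X' \<inter> V L" if L: "L \<ge> max l n" for L
    proof -
      have kg: "?k \<circ> g1 \<in> GL_level L" "u \<circ> g1 \<in> GL_level L"
        using L GL_mono[of n L] GL_mono[of l L] kGL(1) G_level_GL g1 l by (auto intro!: GL_comp simp: H_iff)
      have "(?k \<circ> g1) ` (X \<inter> V L) = (u \<circ> g1) ` (X' \<inter> V L)"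
        using GL_image_Int_V[OF kg(1)] GL_image_Int_V[OF kg(2)] X'(2) by metis
      then show ?thesis
        using GL_same_level_part[OF _ _ F_chain[OF X X'(1)] kg] AA by simp
    qed
    moreover have "\<exists>L\<ge>max l n. x \<in> V L" for x
    proof -
      obtain m where "x \<in> V m" using V_UN by blast
      then have "x \<in> V (max m (max l n))" using V_mono[of m "max m (max l n)"] by auto
      then show ?thesis by (intro exI[of _ "max m (max l n)"]) simp
    qed
    ultimately show ?thesis by blast
  qed
  then have eq: "u ` Y = ?k ` Y" using X'(2) Y by (simp add: image_comp)
  obtain A where A: "A \<subseteq> I" "X = span (e ` A)" using F_span[OF X] by metis
  have "card (insert (?k x) W) \<le> card W"
    using orthogonal_system_card_le[OF A(1) G_level_GL[OF g1] kGL(1) l eq _ W W2(1,3)] Y A(2) by simp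
  then show False using W2(2) orthogonal_systemD(1)[OF oW(1)] by simp
qed

text \<open>N = h(-,v) v with v null and orthogonal to W, and with h(v,r) = 1: then N^2 = 0, N kills
  W and h(Nr,r) = 1. Such a v exists in V_n since h is nondegenerate there.\<close>

lemma degenerate_not_open_SU:
  assumes SU: "is_SU (form D)" and g1: "g1 \<in> G_level D n" and X: "X \<in> F" and Y: "Y = g1 ` X"
    and r: "r \<in> Y \<inter> V n" "r \<noteq> 0" "\<And>y. y \<in> Y \<Longrightarrow> h r y = 0"
  shows "\<not> openin (flag_topology D F) (orbit (G0 D) (act g1 F))"
proof -
  obtain A where "X = span (e ` A)" using F_span[OF X] by metis
  then have "subspace Y" unfolding Y using subspace_GL_image[OF G_level_GL[OF g1]] by simp
  then have "subspace (Y \<inter> V n)" using V_subspace by (simp add: subspace_inter)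
  then obtain W where W: "complete_system W (Y \<inter> V n)" using exists_complete_system[of _ n] by blast
  have oW: "orthogonal_system W" "W \<subseteq> Y \<inter> V n" using W by (auto simp: complete_system_def)
  have rw: "h r w = 0" "h w r = 0" if "w \<in> W" for w using r(3) that oW(2) h_sym_0 by blast+
  obtain v0 where v0: "v0 \<in> V n" "h r v0 \<noteq> 0"
    using nondeg_h[of n] r unfolding nondegenerate_on_def by blast
  define v1 where "v1 = sc (1 / h v0 r) v0"
  have v1: "v1 \<in> V n" "h v1 r = 1"
    using v0 h_sym_0 subspace_scale[OF V_subspace] by (auto simp: v1_def h_scale_left)
  define v2 where "v2 = v1 - proj W v1"
  have v2: "v2 \<in> V n" "h v2 r = 1" "h r v2 = 1" "\<And>w. w \<in> W \<Longrightarrow> h v2 w = 0"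
  proof -
    show "v2 \<in> V n" unfolding v2_def using v1 oW proj_mem[OF V_subspace, of W n]
      by (intro subspace_diff[OF V_subspace]) auto
    show "h v2 r = 1" using h_proj_0[of W r v1] rw v1 by (simp add: v2_def h_diff_left)
    then show "h r v2 = 1" using h_cnj[of r v2] by simp
    show "h v2 w = 0" if "w \<in> W" for w unfolding v2_def using h_diff_proj[OF oW(1) that] .
  qed
  \<comment> \<open>h(v2,v2) is real and h(v2,r) = 1, so subtracting this multiple of the null
    vector r makes v null.\<close>
  define v where "v = v2 - sc (h v2 v2 / 2) r"
  have rr: "h r r = 0" using r by blast
  have v: "v \<in> V n" "h v r = 1" "h r v = 1" "h v v = 0" "\<And>w. w \<in> W \<Longrightarrow> h v w = 0" "\<And>w. w \<in> W \<Longrightarrow> h w v = 0"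
  proof -
    show "v \<in> V n" unfolding v_def using v2 r by (auto intro!: subspace_diff[OF V_subspace] subspace_scale[OF V_subspace])
    show "h v r = 1" "h r v = 1" using v2 rr by (simp_all add: v_def h_simps)
    show "h v v = 0" using v2 rr h_self_real[of v2] by (simp add: v_def h_simps)
    show vw: "h v w = 0" if "w \<in> W" for w using v2 rw that by (simp add: v_def h_simps)
    show "h w v = 0" if "w \<in> W" for w using vw[OF that] h_sym_0 by blast
  qed
  let ?N = "\<lambda>x. sc (h x v) v"
  show ?thesis
  proof (rule not_open_if_nilpotent[OF g1 X Y W, of ?N r r])
    show "Vector_Spaces.linear sc sc ?N"
      by (simp add: linear_iff h_simps scale_left_distrib)
    show "?N (?N x) = 0" for x by (simp add: h_scale_left v)
    show "?N x \<in> V n" for x using v(1) by (rule subspace_scale[OF V_subspace])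
    show "?N (e j) = 0" if "j \<in> I - S n" for j using h_V_outside[OF v(1) that] by simp
    show "h (?N r) r \<noteq> 0 \<or> h (?N r) (?N r) \<noteq> 0" by (simp add: h_simps v)
  qed (use SU r v in \<open>auto simp: h_simps\<close>)
qed

end

context bilinear_space begin

abbreviation "s \<equiv> app sg"

lemma s_simps: "s (x + y) = s x + s y" "s (x - y) = s x - s y" "s (sc c x) = sc (cnj c) (s x)" "s (s x) = sc sig x"
  by (simp_all add: app_add app_diff sg_scale sg_sg)

text \<open>\<sigma> W is an orthogonal system since \<sigma> preserves h up to sign and order of
  the arguments, and h(w,\<sigma> w') is b(w,w') up to sign, which vanishes on W.\<close>

lemma orthogonal_system_twist:
  assumes W: "orthogonal_system W" and iso: "\<And>w w'. w \<in> W \<Longrightarrow> w' \<in> W \<Longrightarrow> b w w' = 0"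
  shows "orthogonal_system (W \<union> s ` W)"
proof (rule orthogonal_system_Un(1)[OF W])
  have "s x = s y \<Longrightarrow> x = y" for x y
    by (metis s_simps(4) sig_sig(1) scale_one scale_scale)
  then show "orthogonal_system (s ` W)"
    using W h_sg h_sym_0 unfolding orthogonal_system_def by auto
  fix w w' assume "w \<in> W" "w' \<in> s ` W"
  then obtain v where "v \<in> W" "w' = s v" by blast
  then show "h w w' = 0" using iso[OF \<open>w \<in> W\<close>, of v] b_eq[of w v] by simp
qed

lemma b_V_outside: "x \<in> V n \<Longrightarrow> j \<in> I - S n \<Longrightarrow> b (e j) x = 0"
  using h_V_outside(2)[OF sg_V] by (simp add: b_eq)

lemma b_self_0: "eps = - 1 \<Longrightarrow> b x x = 0"
  using b_sym[of x x] by simp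

end

locale bilinear_flag = flag_setting_chain D F + bilinear_space D
  for D :: "'v::ab_group_add flag_data" and F +
  assumes isotropic: "b_isotropic D F"

locale degenerate_member = bilinear_flag D F
  for D :: "'v::ab_group_add flag_data" and F +
  fixes g1 n X Y r W
  assumes g1: "g1 \<in> G_level D n" and X: "X \<in> F" and Y: "Y = g1 ` X"
    and r: "r \<in> Y \<inter> V n" "r \<noteq> 0" "\<And>y. y \<in> Y \<Longrightarrow> h r y = 0"
    and W: "complete_system W (Y \<inter> V n)"
begin

lemma b_Y: assumes "x \<in> Y" "y \<in> Y" shows "b x y = 0"
proof -
  have "X \<noteq> UNIV"
  proof
    assume "X = UNIV"
    then have "Y = UNIV" using GL_bij[OF G_level_GL[OF g1]] Y by (simp add: bij_def)
    then show False using r h_nondeg by blast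
  qed
  then have "b x y = 0" if "x \<in> X" "y \<in> X" for x y using isotropic X that by (auto simp: b_isotropic_def)
  then show ?thesis using assms Y g1 not_SU by (auto simp: G_level_iff)
qed

text \<open>The h-orthogonal complement of \<open>T\<close> consists of the vectors that are
  orthogonal to W for both h and b; \<open>perp\<close> projects to it. Vectors defining N are taken
  from there, so that N kills W.\<close>

definition T :: "'v set" where "T = W \<union> s ` W"

definition perp :: "'v \<Rightarrow> 'v" where "perp x = x - proj T x"

lemma W_Y: "orthogonal_system W" "W \<subseteq> Y \<inter> V n"
  using W by (auto simp: complete_system_def)

lemma orthogonal_T: "orthogonal_system T"
  unfolding T_def using W_Y b_Y by (intro orthogonal_system_twist) auto

lemma T_V: "T \<subseteq> V n"
  unfolding T_def using W_Y(2) sg_V by auto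

lemma perp_V: "x \<in> V n \<Longrightarrow> perp x \<in> V n"
  unfolding perp_def using proj_mem[OF V_subspace T_V] by (auto intro: subspace_diff[OF V_subspace])

lemma h_perp_T: "w \<in> T \<Longrightarrow> h (perp x) w = 0"
  unfolding perp_def by (rule h_diff_proj[OF orthogonal_T])

lemma T_perpD:
  assumes "\<And>w. w \<in> T \<Longrightarrow> h x w = 0" "w \<in> W"
  shows "h x w = 0" "b x w = 0" "b w x = 0"
proof -
  show "h x w = 0" using assms by (simp add: T_def)
  have "h x (s w) = 0" using assms by (simp add: T_def)
  then show "b x w = 0" by (simp add: b_eq)
  then show "b w x = 0" by (simp add: b_sym[of w x])
qed

text \<open>A radical vector q is orthogonal to W for h and, as the member is isotropic, also for b.
  By the behaviour of h under \<sigma> the same is true of \<sigma> q. Hence multiples of both can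
  be added to a vector without spoiling its orthogonality to \<open>T\<close>.\<close>

lemma radical_T:
  assumes q: "q \<in> Y \<inter> V n" "\<And>y. y \<in> Y \<Longrightarrow> h q y = 0" and w: "w \<in> T"
  shows "h q w = 0" "h (s q) w = 0"
proof -
  have 1: "h q v = 0" "h v q = 0" "h q (s v) = 0" "h (s v) q = 0" if "v \<in> W" for v
  proof -
    have v: "v \<in> Y" using that W_Y(2) by blast
    then show "h q v = 0" "h v q = 0" using q(2) h_sym_0 by blast+
    have "b q v = 0" using b_Y q v by blast
    then show "h q (s v) = 0" "h (s v) q = 0" using h_sym_0 by (auto simp: b_eq)
  qed
  show "h q w = 0" using w 1 by (auto simp: T_def)
  have "h (s q) v = 0" if "v \<in> W" for v using 1(4)[OF that] h_sg_left[of q v] by simp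
  then show "h (s q) w = 0" using w 1 by (auto simp: T_def h_sg)
qed

lemma h_perp:
  assumes "\<And>w. w \<in> T \<Longrightarrow> h q w = 0" shows "h (perp x) q = h x q"
proof -
  have "h (proj T x) q = 0" using assms h_sym_0 by (intro h_proj_0) blast
  then show ?thesis by (simp add: perp_def h_diff_left)
qed

text \<open>N = b(-,v) v is infinitesimally symplectic and squares to 0 for every v, as b is
  alternating. It remains to choose v orthogonal to W for both forms with b(r,v) and h(v,r)
  nonzero.\<close>

lemma not_open_if_symplectic:
  assumes "eps = - 1"
  shows "\<not> openin (flag_topology D F) (orbit (G0 D) (act g1 F))"
proof -
  have rad: "h r w = 0" "h (s r) w = 0" if "w \<in> T" for w using radical_T[OF r(1,3) that] by blast+
  have "s r \<noteq> 0" using r(2) s_simps(4)[of r] by (auto simp: scale_eq_0_iff)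
  then obtain x1 x2 where x12: "x1 \<in> V n" "h x1 r \<noteq> 0" "x2 \<in> V n" "h x2 (s r) \<noteq> 0"
    using nondeg_h[of n] r sg_V h_sym_0 unfolding nondegenerate_on_def by (metis IntD2)
  \<comment> \<open>V_n is not the union of two proper subspaces, here the complements of r and
    \<sigma> r.\<close>
  have "\<exists>x\<in>V n. h x r \<noteq> 0 \<and> h x (s r) \<noteq> 0"
  proof (cases "h x1 (s r) \<noteq> 0 \<or> h x2 r \<noteq> 0")
    case True then show ?thesis using x12 by blast
  next
    case False
    then have "h (x1 + x2) r \<noteq> 0" "h (x1 + x2) (s r) \<noteq> 0" using x12 by (simp_all add: h_add_left)
    then show ?thesis using subspace_add[OF V_subspace x12(1,3)] by blast
  qed
  then obtain x where x: "x \<in> V n" "h x r \<noteq> 0" "h x (s r) \<noteq> 0" by blast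
  define v where "v = perp x"
  have v: "v \<in> V n" "h v r \<noteq> 0" "h v (s r) \<noteq> 0" using x perp_V h_perp rad by (auto simp: v_def)
  have vW: "h v w = 0" "b v w = 0" "b w v = 0" if "w \<in> W" for w
    using T_perpD[OF h_perp_T that] by (auto simp: v_def)
  have vv: "b v v = 0" using assms by (rule b_self_0)
  have brv: "b r v \<noteq> 0" using v(3) b_sym[of r v] by (simp add: b_eq)
  let ?N = "\<lambda>x. sc (b x v) v"
  show ?thesis
  proof (rule not_open_if_nilpotent[OF g1 X Y W, of ?N r r])
    show "Vector_Spaces.linear sc sc ?N" by (simp add: linear_iff b_simps scale_left_distrib)
    show "?N (?N x) = 0" for x by (simp add: b_simps vv)
    show "?N x \<in> V n" for x using v(1) by (rule subspace_scale[OF V_subspace])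
    show "?N (e j) = 0" if "j \<in> I - S n" for j using b_V_outside[OF v(1) that] by simp
    show "b (?N x) y + b x (?N y) = 0" for x y using b_sym[of v y] assms by (simp add: b_simps)
    show "b (?N x) (?N y) = 0" for x y by (simp add: b_simps vv)
    show "h (?N r) r \<noteq> 0 \<or> h (?N r) (?N r) \<noteq> 0" using v brv by (simp add: h_simps)
  qed (use r vW in \<open>auto simp: h_simps\<close>)
qed

text \<open>N = b(-,u) v - b(-,v) u is skew for symmetric b, and N^2 = 0 because u and v span an
  isotropic plane. The normalization gives Nr = v; the rank grows through h(v,r') or, when r' = r,
  through h(v,v).\<close>

lemma not_open_if_isotropic_pair:
  assumes eps: "eps = 1" and u: "u \<in> V n" "v \<in> V n" and uv: "b u u = 0" "b v v = 0" "b u v = 0"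
    and T: "\<And>w. w \<in> W \<Longrightarrow> h u w = 0 \<and> b u w = 0" "\<And>w. w \<in> W \<Longrightarrow> h v w = 0 \<and> b v w = 0"
    and r': "r' \<in> Y \<inter> V n" "\<And>y. y \<in> Y \<Longrightarrow> h r' y = 0"
    and br: "b u r = 1" "b v r = 0" and nz: "h v r' \<noteq> 0 \<or> (r' = r \<and> h v v \<noteq> 0)"
  shows "\<not> openin (flag_topology D F) (orbit (G0 D) (act g1 F))"
proof -
  have sym: "b x y = b y x" for x y using b_sym[of x y] eps by simp
  let ?N = "\<lambda>x. sc (b x u) v - sc (b x v) u"
  have Nr: "?N r = v" using br sym[of r] by simp
  show ?thesis
  proof (rule not_open_if_nilpotent[OF g1 X Y W, of ?N r r'])
    show "Vector_Spaces.linear sc sc ?N"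
      by (simp add: linear_iff b_simps scale_left_distrib scale_right_diff_distrib)
    show "?N (?N x) = 0" for x using uv sym[of v u] by (simp add: b_simps)
    show "?N x \<in> V n" for x using u by (intro subspace_diff[OF V_subspace] subspace_scale[OF V_subspace])
    show "?N (e j) = 0" if "j \<in> I - S n" for j using b_V_outside[OF _ that] u by simp
    show "b (?N x) y + b x (?N y) = 0" for x y using sym[of u y] sym[of v y] by (simp add: b_simps)
    show "b (?N x) (?N y) = 0" for x y using uv sym[of v u] by (simp add: b_simps)
    show "?N w = 0" if "w \<in> W" for w using T[OF that] sym[of w] by simp
    show "h (?N r) w = 0" if "w \<in> W" for w unfolding Nr using T(2)[OF that] by blast
    show "h (?N r') w = 0" if "w \<in> W" for w using T[OF that] by (simp add: h_simps)
    show "h (?N r) r' \<noteq> 0 \<or> h (?N r) (?N r') \<noteq> 0" using nz Nr by auto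
  qed (use r r' in auto)
qed

text \<open>Here h(v,r') = b(v,q) with q = \<sigma> r', so v has to satisfy b(v,r) = 0 and b(v,q) =
  1. This is possible since r is not a multiple of q.\<close>

lemma not_open_if_independent:
  assumes eps: "eps = 1" and r': "r' \<in> Y \<inter> V n" "r' \<noteq> 0" "\<And>y. y \<in> Y \<Longrightarrow> h r' y = 0"
    and ind: "\<And>c. r \<noteq> sc c (s r')"
  shows "\<not> openin (flag_topology D F) (orbit (G0 D) (act g1 F))"
proof -
  have sym: "b x y = b y x" for x y using b_sym[of x y] eps by simp
  define q where "q = s r'"
  have rad: "h r w = 0" "h (s r) w = 0" "h r' w = 0" "h q w = 0" if "w \<in> T" for w
    using radical_T[OF r(1,3) that] radical_T[OF r'(1,3) that] by (auto simp: q_def)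
  have q: "q \<in> V n" using r' sg_V by (simp add: q_def)
  have qi: "\<exists>x\<in>V n. b x y = 1" if y: "y \<in> V n" "y \<noteq> 0" for y
  proof -
    obtain x where x: "x \<in> V n" "b x y \<noteq> 0"
      using nondeg_b[OF not_SU, of n] y sym unfolding nondegenerate_on_def by metis
    then show ?thesis using subspace_scale[OF V_subspace x(1), of "1 / b x y"]
      by (intro bexI[of _ "sc (1 / b x y) x"]) (auto simp: b_simps)
  qed
  have "s q = sc sig r'" by (simp add: q_def s_simps)
  then have "q \<noteq> 0" using r'(2) by (auto simp: scale_eq_0_iff)
  then obtain y1 where y1: "y1 \<in> V n" "b y1 q = 1" using qi[OF q] by blast
  \<comment> \<open>Elimination producing vectors x0 and y0 that are dual to r and q under
    b.\<close>
  define r2 where "r2 = r - sc (b y1 r) q"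
  have "r2 \<in> V n" unfolding r2_def using r q by (intro subspace_diff[OF V_subspace] subspace_scale[OF V_subspace]) auto
  moreover have "r2 \<noteq> 0" using ind by (simp add: r2_def q_def)
  ultimately obtain x1 where x1: "x1 \<in> V n" "b x1 r2 = 1" using qi by blast
  define x0 where "x0 = x1 - sc (b x1 q) y1"
  have x0q: "b x0 q = 0" using y1 by (simp add: x0_def b_simps)
  have "b x0 r2 = 1" using x1 y1 by (simp add: x0_def b_simps r2_def mult.commute)
  then have x0: "x0 \<in> V n" "b x0 q = 0" "b x0 r = 1"
    using x0q x1 y1 by (auto simp: x0_def r2_def b_simps intro!: subspace_diff[OF V_subspace] subspace_scale[OF V_subspace])
  define y0 where "y0 = y1 - sc (b y1 r) x0"
  have y0: "y0 \<in> V n" "b y0 q = 1" "b y0 r = 0"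
    using x0 y1 by (auto simp: y0_def b_simps intro!: subspace_diff[OF V_subspace] subspace_scale[OF V_subspace])
  have bperp: "b (perp x) r = b x r" "b (perp x) q = b x q" for x
    using h_perp[of "s r" x] h_perp[of r' x] rad by (simp_all add: b_eq q_def s_simps h_scale_right)
  have qq: "b q q = 0" and rq: "b r q = 0" and rr: "b r r = 0"
  proof -
    show "b r r = 0" using b_Y r by blast
    show "b r q = 0" using r r' by (simp add: q_def b_sg)
    have "b r' r' = 0" using b_Y r' by blast
    then have "h r' q = 0" by (simp add: b_eq q_def)
    then show "b q q = 0" using h_sym_0 by (simp add: q_def b_sg)
  qed
  have sym': "b q r = 0" using rq sym by simp
  \<comment> \<open>\<open>perp\<close> does not change the pairings with r and q. The multiples of
    r and q then make u and v isotropic and mutually orthogonal for b, and keep the pairings since r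
    and q span an isotropic plane.\<close>
  define v where "v = perp y0 - sc (b (perp y0) (perp y0) / 2) q"
  define u where "u = perp x0 - sc (b (perp x0) (perp x0) / 2) r - sc (b (perp x0) v) q"
  have vb: "b v v = 0" "b v q = 1" "b q v = 1" "b v r = 0" "b r v = 0"
    using y0 bperp qq rq sym' sym[of q "perp y0"] sym[of r "perp y0"] by (simp_all add: v_def b_simps)
  have ub: "b u v = 0" "b u u = 0" "b u r = 1"
  proof -
    show "b u v = 0" using vb by (simp add: u_def b_simps)
    show "b u r = 1" using x0 bperp rr sym' by (simp add: u_def b_simps)
    show "b u u = 0" using x0 bperp rr rq sym' qq sym[of q "perp x0"] sym[of r "perp x0"]
      by (simp add: u_def b_simps)
  qed
  have uvV: "u \<in> V n" "v \<in> V n"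
    unfolding u_def v_def using x0 y0 q r perp_V
    by (auto intro!: subspace_diff[OF V_subspace] subspace_scale[OF V_subspace])
  have "h u w = 0" "h v w = 0" if "w \<in> T" for w
    using h_perp_T[OF that] rad[OF that] by (simp_all add: u_def v_def h_simps)
  then have "h u w = 0 \<and> b u w = 0" "h v w = 0 \<and> b v w = 0" if "w \<in> W" for w
    using T_perpD[of u w] T_perpD[of v w] that by auto
  moreover have "h v r' = 1" using vb(2) b_sg[of v r'] by (simp add: q_def)
  ultimately show ?thesis
    using not_open_if_isotropic_pair[OF eps uvV ub(2) vb(1) ub(1) _ _ r'(1,3) ub(3) vb(4)] by simp
qed

text \<open>This covers the case that r is proportional to \<sigma> r, where b(v,r) = 0 implies
  h(v,r) = 0. The rank then grows through h(z,z), where z = Nr lies outside V_n: as Y is contained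
  in V_n, a larger level m offers room for z and leaves \<open>Y \<inter> V m\<close>
  unchanged.\<close>

lemma not_open_if_spare_vector:
  assumes eps: "eps = 1" and m: "n \<le> m" and YV: "Y \<subseteq> V n"
    and z: "z \<in> V m" "\<And>x. x \<in> V n \<Longrightarrow> h x z = 0" "b z z = 0" "h z z \<noteq> 0"
  shows "\<not> openin (flag_topology D F) (orbit (G0 D) (act g1 F))"
proof -
  have sym: "b x y = b y x" for x y using b_sym[of x y] eps by simp
  have rad: "h r w = 0" "h (s r) w = 0" if "w \<in> T" for w
    using radical_T[OF r(1,3) that] by auto
  obtain x where x: "x \<in> V n" "b x r \<noteq> 0"
    using nondeg_b[OF not_SU, of n] r sym unfolding nondegenerate_on_def by (metis IntD2)
  define x0 where "x0 = sc (1 / b x r) x"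
  have x0: "x0 \<in> V n" "b x0 r = 1" using x subspace_scale[OF V_subspace] by (auto simp: x0_def b_simps)
  have bx: "b (perp x0) r = 1" using h_perp[of "s r" x0] rad x0 by (simp add: b_eq)
  have rr: "b r r = 0" using b_Y r by blast
  define u where "u = perp x0 - sc (b (perp x0) (perp x0) / 2) r"
  have u: "u \<in> V n" "b u u = 0" "b u r = 1"
    using perp_V[OF x0(1)] r bx rr sym[of r "perp x0"]
    by (auto simp: u_def b_simps intro!: subspace_diff[OF V_subspace] subspace_scale[OF V_subspace])
  have "h u w = 0" if "w \<in> T" for w
    using h_perp_T[OF that] rad[OF that] by (simp add: u_def h_simps)
  then have uW: "h u w = 0 \<and> b u w = 0" if "w \<in> W" for w using T_perpD[of u w] that by auto
  have zV: "h z x = 0" "b x z = 0" "b z x = 0" if "x \<in> V n" for x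
  proof -
    show "h z x = 0" using z(2)[OF that] h_sym_0 by blast
    have "h z (s x) = 0" using z(2)[OF sg_V[OF that]] h_sym_0 by blast
    then show "b z x = 0" by (simp add: b_eq)
    then show "b x z = 0" using sym by simp
  qed
  have Vnm: "V n \<subseteq> V m" using V_mono[OF m] .
  have Ynm: "Y \<inter> V m = Y \<inter> V n" using YV Vnm by blast
  interpret M: degenerate_member D F g1 m X Y r W
    using G_level_mono[OF m g1] X Y r W Ynm by unfold_locales auto
  show ?thesis
  proof (rule M.not_open_if_isotropic_pair[OF eps, of u z r])
    show "u \<in> V m" "r \<in> Y \<inter> V m" using u r Vnm by auto
    show "b u z = 0" using zV u(1) by blast
    show "h u w = 0 \<and> b u w = 0" if "w \<in> W" for w using uW[OF that] .
    show "h z w = 0 \<and> b z w = 0" if "w \<in> W" for w using that W_Y(2) zV by blast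
    show "b z r = 0" using zV r by blast
  qed (use u z r in auto)
qed

end

context bilinear_flag begin

lemma SO_spare_vector:
  assumes SO: "form D = SO q"
  obtains z m where "n \<le> m" "z \<in> V m" "\<And>x. x \<in> V n \<Longrightarrow> h x z = 0" "b z z = 0" "h z z \<noteq> 0"
proof -
  obtain B where B: "0 \<le> B" "\<And>i. i \<in> S n \<Longrightarrow> \<bar>i\<bar> \<le> B"
  proof
    show "0 \<le> (\<Sum>i\<in>S n. \<bar>i\<bar>)" by (simp add: sum_nonneg)
    show "\<bar>i\<bar> \<le> (\<Sum>i\<in>S n. \<bar>i\<bar>)" if "i \<in> S n" for i
      using member_le_sum[of i "S n" abs] that S_finite by simp
  qed
  \<comment> \<open>Negative indices are available for every q. Each e_i involves only vectors of E'
    with index i or -i, so beyond the bound B the vectors of E' are orthogonal to V_n.\<close>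
  define a c where "a = - B - 1" and "c = - B - 2"
  have ac: "a \<in> I" "c \<in> I" "a \<noteq> c" "a < 0" "c < 0" using B by (auto simp: a_def c_def mem_I_SO[OF SO])
  let ?e' = "def_basis D"
  have gram: "h (?e' i) (?e' j) = h_gram i j" "b (?e' i) (?e' j) = h_gram i j" if "i \<in> I" "j \<in> I" for i j
  proof -
    have "\<forall>i\<in>I. \<forall>j\<in>I. h (?e' i) (?e' j) = h_gram i j" "\<forall>i\<in>I. \<forall>j\<in>I. b (?e' i) (?e' j) = b_gram (form D) i j"
      using setting not_SU by (simp_all add: flag_setting_def)
    then show "h (?e' i) (?e' j) = h_gram i j" "b (?e' i) (?e' j) = h_gram i j" using that SO by simp_all
  qed
  have orth: "h x (?e' j) = 0" if x: "x \<in> V n" and j: "j \<in> I" "B < \<bar>j\<bar>" for x j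
  proof -
    have "x \<in> span (e ` S n)" using x by (simp add: V_level_def)
    then show ?thesis
    proof (induction rule: span_induct)
      case base
      show ?case by (intro subspaceI) (auto simp: h_simps)
    next
      case (step x)
      then obtain i where i: "i \<in> S n" "x = e i" by blast
      have iI: "i \<in> I" using i S_sub by blast
      have ij: "i \<noteq> j" "- i \<noteq> j" using B(2)[OF i(1)] j by auto
      have e: "e = SO_flag_basis q sc ?e'" by (simp add: flag_basis_def SO)
      show ?case
      proof (cases "i < 0 \<and> q < enat (nat (- i))")
        case True
        then show ?thesis using gram(1)[OF iI j(1)] ij by (simp add: i e SO_flag_basis_def h_gram_def)
      next
        case False
        then have "- i \<in> I" using iI unfolding mem_I_SO[OF SO] by (cases "i < 0") auto
        then show ?thesis using gram(1)[OF iI j(1)] gram(1)[OF _ j(1), of "- i"] ij False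
          by (auto simp: i e SO_flag_basis_def h_gram_def h_simps)
      qed
    qed
  qed
  \<comment> \<open>The factor \<i> gives b(z,z) = 1 - 1 and h(z,z) = 1 + 1.\<close>
  define z where "z = ?e' a + sc \<i> (?e' c)"
  have "h x z = 0" if "x \<in> V n" for x
    using orth[OF that ac(1)] orth[OF that ac(2)] B(1) by (simp add: z_def h_simps a_def c_def)
  moreover have "b z z = 0" "h z z \<noteq> 0"
    using gram ac by (simp_all add: z_def h_simps b_simps h_gram_def)
  moreover obtain m0 where "z \<in> V m0" using V_UN by blast
  then have "z \<in> V (max n m0)" using V_mono[of m0 "max n m0"] by auto
  ultimately show ?thesis using that[of "max n m0" z] by auto
qed

text \<open>For \<open>SO_star\<close>, r is never a multiple of \<sigma> r. For SO(\<infinity>,q)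
  there are two cases. If X lies in V_n, a spare vector exists. Otherwise X contains a basis vector
  e_j outside V_n, fixed by the group element; it belongs to the radical as well and, unlike r, does
  not lie in V_n.\<close>

lemma degenerate_not_open:
  assumes g1: "g1 \<in> G_level D n0" and X: "X \<in> F" and Y: "Y = g1 ` X"
    and r: "r \<in> Y" "r \<noteq> 0" "\<And>y. y \<in> Y \<Longrightarrow> h r y = 0"
  shows "\<not> openin (flag_topology D F) (orbit (G0 D) (act g1 F))"
proof -
  obtain A where A: "A \<subseteq> I" "X = span (e ` A)" using F_span[OF X] by metis
  have subY: "subspace (Y \<inter> V n)" for n
    using subspace_GL_image[OF G_level_GL[OF g1]] V_subspace A(2) by (simp add: Y subspace_inter)
  have member: "\<exists>W. degenerate_member D F g1 n X Y r W" if n: "n0 \<le> n" "r \<in> V n" for n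
  proof -
    obtain W where "complete_system W (Y \<inter> V n)" using exists_complete_system[OF subY, of n n] by blast
    then have "degenerate_member D F g1 n X Y r W"
      using G_level_mono[OF n(1) g1] X Y r n by unfold_locales auto
    then show ?thesis by blast
  qed
  obtain n1 where "r \<in> V n1" using V_UN by blast
  define n where "n = max n0 n1"
  have n: "n0 \<le> n" "r \<in> V n" using \<open>r \<in> V n1\<close> V_mono[of n1 n] by (auto simp: n_def)
  obtain W where W: "degenerate_member D F g1 n X Y r W" using member[OF n] by blast
  show ?thesis
  proof (cases "symplectic (form D)")
    case True
    then show ?thesis using degenerate_member.not_open_if_symplectic[OF W] by (simp add: eps_def)
  next
    case False
    then have eps: "eps = 1" by (simp add: eps_def)
    consider "form D = SO_star" | q where "form D = SO q" using False not_SU by (cases "form D") auto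
    then show ?thesis
    proof cases
      case 1
      \<comment> \<open>Applying \<sigma> to r = c \<sigma> r gives r = \<open>sig\<close> |c|^2 r,
        which is impossible for \<open>sig\<close> = -1.\<close>
      have "r \<noteq> sc c (s r)" for c
      proof
        assume eq: "r = sc c (s r)"
        then have "s r = sc (cnj c) (s (s r))" by (metis s_simps(3))
        then have "r = sc c (sc (cnj c * sig) r)" using eq by (simp add: s_simps)
        then have "sc (1 - c * cnj c * sig) r = 0" by (simp add: scale_left_diff_distrib mult.assoc)
        then have "1 + c * cnj c = 0" using r(2) 1 by (simp add: scale_eq_0_iff sig_def)
        then have "complex_of_real (1 + (cmod c)\<^sup>2) = 0" by (simp only: complex_norm_square[symmetric] of_real_add of_real_1)
        then have "1 + (cmod c)\<^sup>2 = 0" by (simp only: of_real_eq_0_iff)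
        then show False by (smt (verit) zero_le_power2)
      qed
      then show ?thesis
        using degenerate_member.not_open_if_independent[OF W eps, of r] r n by blast
    next
      case (2 q)
      show ?thesis
      proof (cases "A \<subseteq> S n")
        case True
        have "Y \<subseteq> V n"
        proof -
          have "X \<subseteq> V n" unfolding A(2) V_level_def using True by (intro span_mono) auto
          then show ?thesis unfolding Y using GL_V_mem[OF GL_mono[OF n(1) G_level_GL[OF g1]]] by blast
        qed
        then have "?thesis" if "n \<le> m" "z \<in> V m" "\<And>x. x \<in> V n \<Longrightarrow> h x z = 0" "b z z = 0" "h z z \<noteq> 0" for z m
          using degenerate_member.not_open_if_spare_vector[OF W eps that(1) _ that(2-5)] by simp
        then show ?thesis by (rule SO_spare_vector[OF 2, of n])
      next
        case notsub: False
        then obtain j where j: "j \<in> A" "j \<notin> S n" by blast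
        have jI: "j \<in> I" using j A by blast
        obtain n2 where "j \<in> S n2" using S_I jI by blast
        define m where "m = max n n2"
        have jm: "j \<in> S m" using \<open>j \<in> S n2\<close> S_mono[of n2 m] by (auto simp: m_def)
        have m: "n \<le> m" "n0 \<le> m" "r \<in> V m" using n V_mono[of n m] by (auto simp: m_def)
        obtain W' where W': "degenerate_member D F g1 m X Y r W'" using member[OF m(2,3)] by blast
        have GLn: "g1 \<in> GL_level n" using GL_mono[OF n(1) G_level_GL[OF g1]] .
        have "e j \<in> span (e ` (A - S n))" using j by (auto intro: span_base)
        then have jY: "e j \<in> Y" using outside_subset_image[OF A(1) GLn] A(2) Y by blast
        have XU: "X \<noteq> UNIV"
        proof
          assume "X = UNIV"
          then have "Y = UNIV" using GL_bij[OF GLn] Y by (simp add: bij_def)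
          then show False using r h_nondeg by blast
        qed
        \<comment> \<open>For SO(\<infinity>,q) the forms h and b have the same values on E, so
          b-isotropy of X makes e_j orthogonal for h to all basis vectors in X.\<close>
        have null: "h (e j) z = 0" if z: "z \<in> span (e ` A)" for z
          using z
        proof (induction rule: span_induct)
          case base
          show ?case by (intro subspaceI) (auto simp: h_simps)
        next
          case (step x)
          then obtain i where i: "i \<in> A" "x = e i" by blast
          have iI: "i \<in> I" using i A by blast
          have "e j \<in> X" "e i \<in> X" using i j A(2) by (auto intro: span_base)
          then have "b (e j) (e i) = 0" using isotropic X XU by (auto simp: b_isotropic_def)
          then show ?case using b_basis[OF jI iI] 2 i by simp
        qed
        have rad: "h (e j) y = 0" if y: "y \<in> Y" for y
        proof -
          obtain y1 z where yz: "y = y1 + z" "y1 \<in> V n" "z \<in> span (e ` (A - S n))"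
            using image_span_split[OF A(1) GLn, of y] y Y A(2) by blast
          have "h (e j) y1 = 0" using h_V_outside(2)[OF yz(2)] j jI by blast
          moreover have "h (e j) z = 0" using null yz(3) span_mono[of "e ` (A - S n)" "e ` A"] by blast
          ultimately show ?thesis by (simp add: yz h_add_right)
        qed
        have "r \<noteq> sc c (s (e j))" for c
        proof
          assume "r = sc c (s (e j))"
          then have rj: "r = sc (c * mu j) (e j)" using sg_e[OF jI] 2 by (simp add: tw_def)
          have "co j r = 0" using n(2) V_iff j jI by blast
          then have "c * mu j = 0" using rj co_e[OF jI jI] by simp
          then show False using r(2) rj by simp
        qed
        moreover have "e j \<noteq> 0" using co_e[OF jI jI] by auto
        ultimately show ?thesis
          using degenerate_member.not_open_if_independent[OF W' eps, of "e j"] jY e_V[OF jm] rad by blast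
      qed
    qed
  qed
qed

end

section \<open>The star algebra of endomorphisms supported on one level\<close>

lemma sum_mult_le:
  fixes f g :: "'a \<Rightarrow> real"
  assumes "finite K" "\<And>k. k \<in> K \<Longrightarrow> 0 \<le> f k" "\<And>k. k \<in> K \<Longrightarrow> 0 \<le> g k"
  shows "(\<Sum>k\<in>K. f k * g k) \<le> sum f K * sum g K"
proof -
  have "(\<Sum>k\<in>K. f k * g k) \<le> (\<Sum>k\<in>K. sum f K * g k)"
    using assms by (intro sum_mono mult_right_mono member_le_sum) auto
  then show ?thesis by (simp add: sum_distrib_left)
qed

context flag_space begin

definition scalar :: "complex \<Rightarrow> 'v endo" where "scalar c = Endo (sc c)"

lemma app_scalar [simp]: "app (scalar c) x = sc c x"
  by (simp add: scalar_def app_Endo scale_right_distrib)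

definition alg :: "nat \<Rightarrow> 'v endo set" where
  "alg n = {a. Vector_Spaces.linear sc sc (app a) \<and> (\<forall>x. app a x \<in> V n) \<and> (\<forall>j\<in>I - S n. app a (e j) = 0)}"

text \<open>The entries are values of h and not coordinates, so that the adjoint merely transposes
  and conjugates them and has the same norm.\<close>

definition nrm :: "nat \<Rightarrow> 'v endo \<Rightarrow> real" where
  "nrm n a = (\<Sum>i\<in>S n. \<Sum>j\<in>S n. cmod (h (app a (e j)) (e i)))"

text \<open>The adjoint for h. The formula is obtained from the i-th coordinate of the adjoint at x,
  which is \<open>eta i\<close> times its value of h with e_(kap i), by moving a to the other
  side.\<close>

definition star :: "nat \<Rightarrow> 'v endo \<Rightarrow> 'v endo" where
  "star n a = Endo (\<lambda>x. \<Sum>i\<in>S n. sc (eta i * h x (app a (e (kap i)))) (e i))"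

lemma kap_bij: "bij_betw kap (S n) (S n)"
  by (rule bij_betw_byWitness[where f' = kap]) (auto intro: kap_S kap_kap[OF subsetD[OF S_sub]])

lemma algD:
  assumes "a \<in> alg n"
  shows "Vector_Spaces.linear sc sc (app a)" "app a x \<in> V n" "j \<in> I - S n \<Longrightarrow> app a (e j) = 0"
  using assms by (auto simp: alg_def)

lemma alg_scale: "a \<in> alg n \<Longrightarrow> app a (sc c x) = sc c (app a x)"
  by (rule linearD(2)[OF algD(1)])

lemma algI:
  assumes "\<And>c x. app a (sc c x) = sc c (app a x)" "\<And>x. app a x \<in> V n" "\<And>j. j \<in> I - S n \<Longrightarrow> app a (e j) = 0"
  shows "a \<in> alg n"
  using assms by (simp add: alg_def linear_iff app_add)

lemma alg_expand:
  assumes a: "a \<in> alg n"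
  shows "app a x = (\<Sum>i\<in>S n. sc (co i x) (app a (e i)))"
proof -
  have "x \<in> span (e ` I)" by (simp add: span_e)
  then obtain y z where yz: "x = y + z" "y \<in> V n" "z \<in> span (e ` (I - S n))"
    using split_level[of I x n] by blast
  have "app a z = 0" using yz(3)
  proof (induction rule: span_induct)
    case base
    show ?case by (intro subspaceI) (auto simp: app_add alg_scale[OF a])
  qed (use algD(3)[OF a] in auto)
  moreover have "co i z = 0" if "i \<in> S n" for i
    using co_span_0[OF _ yz(3)] that S_sub by blast
  moreover have "app a y = (\<Sum>i\<in>S n. sc (co i y) (app a (e i)))"
    by (subst V_expand[OF yz(2)]) (simp add: linearD(5)[OF algD(1)[OF a]] alg_scale[OF a])
  ultimately show ?thesis using yz(1) by (simp add: app_add)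
qed

lemma app_star: "app (star n a) x = (\<Sum>i\<in>S n. sc (eta i * h x (app a (e (kap i)))) (e i))"
  unfolding star_def
  by (subst app_Endo) (simp_all add: h_add_left distrib_left scale_left_distrib sum.distrib)

lemma star_alg:
  assumes a: "a \<in> alg n" shows "star n a \<in> alg n"
proof (rule algI)
  show "app (star n a) (sc c x) = sc c (app (star n a) x)" for c x
    by (simp add: app_star h_scale_left scale_sum_right mult_ac)
  show "app (star n a) x \<in> V n" for x
    unfolding app_star by (intro subspace_sum[OF V_subspace] subspace_scale[OF V_subspace] e_V)
  show "app (star n a) (e j) = 0" if "j \<in> I - S n" for j
    unfolding app_star using h_V_outside(2)[OF algD(2)[OF a] that] by simp
qed

lemma h_star:
  assumes a: "a \<in> alg n" shows "h (app a x) y = h x (app (star n a) y)"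
proof -
  have "h x (app (star n a) y) = (\<Sum>i\<in>S n. co (kap i) x * h (app a (e (kap i))) y)"
    unfolding app_star h_sum_right
  proof (intro sum.cong refl)
    fix i assume "i \<in> S n"
    then have i: "i \<in> I" using S_sub by blast
    show "h x (sc (eta i * h y (app a (e (kap i)))) (e i)) = co (kap i) x * h (app a (e (kap i))) y"
      using h_cnj[of "app a (e (kap i))" y] by (simp add: h_scale_right h_e[OF i] mult_ac)
  qed
  also have "\<dots> = (\<Sum>i\<in>S n. co i x * h (app a (e i)) y)"
    by (rule sum.reindex_bij_betw[OF kap_bij])
  also have "\<dots> = h (app a x) y"
    by (subst alg_expand[OF a]) (simp add: h_sum_left h_scale_left)
  finally show ?thesis by simp
qed

lemma h_star': "a \<in> alg n \<Longrightarrow> h (app (star n a) x) y = h x (app a y)"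
  using h_star[of a n y x] h_cnj by metis

lemma star_unique:
  assumes "a \<in> alg n" "\<And>x y. h (app a x) y = h x (app a' y)" shows "star n a = a'"
proof (rule endo_eqI)
  fix y
  have "h (app (star n a) y - app a' y) x = 0" for x
    using h_star[OF assms(1), of x y] assms(2)[of x y] h_sym_0 by (metis h_diff_right right_minus_eq)
  then show "app (star n a) y = app a' y" using h_nondeg by force
qed

lemma nrm_nonneg: "0 \<le> nrm n a"
  by (simp add: nrm_def sum_nonneg)

lemma nrm_entry: "i \<in> S n \<Longrightarrow> j \<in> S n \<Longrightarrow> cmod (h (app a (e j)) (e i)) \<le> nrm n a"
  unfolding nrm_def
  by (rule order_trans[OF member_le_sum[of j "S n"] member_le_sum[of i "S n"]])
    (auto simp: S_finite sum_nonneg)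

text \<open>Coordinates are values of h at indices shifted by \<open>kap\<close>, up to the sign
  \<open>eta\<close>. As \<open>kap\<close> permutes \<open>S n\<close>, the sum over the shifted
  indices is again the norm.\<close>

lemma nrm_mult:
  assumes a: "a \<in> alg n" and a': "a' \<in> alg n"
  shows "nrm n (a * a') \<le> nrm n a * nrm n a'"
proof -
  let ?f = "\<lambda>k. \<Sum>i\<in>S n. cmod (h (app a (e k)) (e i))"
  let ?g = "\<lambda>k. \<Sum>j\<in>S n. cmod (h (app a' (e j)) (e (kap k)))"
  have entry: "cmod (h (app (a * a') (e j)) (e i))
      \<le> (\<Sum>k\<in>S n. cmod (h (app a' (e j)) (e (kap k))) * cmod (h (app a (e k)) (e i)))" for i j
  proof -
    have "h (app (a * a') (e j)) (e i) = (\<Sum>k\<in>S n. co k (app a' (e j)) * h (app a (e k)) (e i))"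
      by (simp add: h_sum_left h_scale_left alg_expand[OF a, of "app a' (e j)"])
    then show ?thesis
      by (simp add: co_def norm_mult norm_sum order_trans[OF norm_sum])
  qed
  have "nrm n (a * a') \<le> (\<Sum>i\<in>S n. \<Sum>j\<in>S n. \<Sum>k\<in>S n. cmod (h (app a' (e j)) (e (kap k))) * cmod (h (app a (e k)) (e i)))"
    unfolding nrm_def by (intro sum_mono entry)
  also have "\<dots> = (\<Sum>i\<in>S n. \<Sum>k\<in>S n. \<Sum>j\<in>S n. cmod (h (app a' (e j)) (e (kap k))) * cmod (h (app a (e k)) (e i)))"
    by (intro sum.cong refl sum.swap)
  also have "\<dots> = (\<Sum>k\<in>S n. \<Sum>i\<in>S n. \<Sum>j\<in>S n. cmod (h (app a' (e j)) (e (kap k))) * cmod (h (app a (e k)) (e i)))"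
    by (rule sum.swap)
  also have "\<dots> = (\<Sum>k\<in>S n. ?f k * ?g k)"
    by (intro sum.cong refl) (simp add: sum_product mult.commute)
  also have "\<dots> \<le> sum ?f (S n) * sum ?g (S n)"
    by (rule sum_mult_le) (auto simp: S_finite sum_nonneg)
  also have "sum ?g (S n) = nrm n a'"
    using sum.reindex_bij_betw[OF kap_bij, of "\<lambda>k. \<Sum>j\<in>S n. cmod (h (app a' (e j)) (e k))"]
    by (simp add: nrm_def)
  also have "sum ?f (S n) = nrm n a" unfolding nrm_def by (rule sum.swap)
  finally show ?thesis .
qed

lemma nrm_eq_0:
  assumes a: "a \<in> alg n" and 0: "nrm n a = 0" shows "a = 0"
proof (rule endo_eqI)
  have "app a (e j) = 0" if j: "j \<in> S n" for j
  proof -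
    have z: "h (app a (e j)) (e i) = 0" if "i \<in> S n" for i
      using nrm_entry[OF that j, of a] 0 by simp
    have "h (app a (e j)) y = 0" if "y \<in> V n" for y
    proof -
      have "h (app a (e j)) y = h (app a (e j)) (\<Sum>i\<in>S n. sc (co i y) (e i))" using V_expand[OF that] by simp
      then show ?thesis using z by (simp add: h_sum_right h_scale_right)
    qed
    then show ?thesis using nondeg_h[of n] algD(2)[OF a] unfolding nondegenerate_on_def by blast
  qed
  then show "app a x = app 0 x" for x by (simp add: alg_expand[OF a, of x])
qed

lemma nrm_star: assumes a: "a \<in> alg n" shows "nrm n (star n a) = nrm n a"
proof -
  have "cmod (h (app (star n a) (e j)) (e i)) = cmod (h (app a (e i)) (e j))" for i j
    using h_star'[OF a, of "e j" "e i"] h_cnj[of "e j" "app a (e i)"] by simp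
  then show ?thesis unfolding nrm_def by (subst sum.swap) simp
qed

lemma nrm_complete:
  assumes y: "\<And>i::nat. y i \<in> alg n"
    and C: "\<And>r. 0 < r \<Longrightarrow> \<exists>M. \<forall>i\<ge>M. \<forall>j\<ge>M. nrm n (y i - y j) < r"
  shows "\<exists>a\<in>alg n. (\<lambda>i. nrm n (y i - a)) \<longlonglongrightarrow> 0"
proof -
  have "\<exists>l. (\<lambda>i. h (app (y i) (e q)) (e p)) \<longlonglongrightarrow> l" if pq: "p \<in> S n" "q \<in> S n" for p q
  proof -
    have "Cauchy (\<lambda>i. h (app (y i) (e q)) (e p))"
    proof (rule metric_CauchyI)
      fix r :: real assume "0 < r"
      then obtain M where M: "\<forall>i\<ge>M. \<forall>j\<ge>M. nrm n (y i - y j) < r" using C by blast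
      have "dist (h (app (y i) (e q)) (e p)) (h (app (y j) (e q)) (e p)) < r" if "i \<ge> M" "j \<ge> M" for i j
        using nrm_entry[OF pq, of "y i - y j"] M that by (force simp: dist_norm h_diff_left)
      then show "\<exists>M. \<forall>m\<ge>M. \<forall>k\<ge>M. dist (h (app (y m) (e q)) (e p)) (h (app (y k) (e q)) (e p)) < r" by blast
    qed
    then show ?thesis using Cauchy_convergent_iff convergent_def by blast
  qed
  then obtain L where L: "\<And>p q. p \<in> S n \<Longrightarrow> q \<in> S n \<Longrightarrow> (\<lambda>i. h (app (y i) (e q)) (e p)) \<longlonglongrightarrow> L p q"
    by metis
  \<comment> \<open>The limits belong to values of h, so the p-th coordinate of the image of e_q has
    to be \<open>eta p * L (kap p) q\<close>.\<close>
  define f where "f x = (\<Sum>q\<in>S n. \<Sum>p\<in>S n. sc (co q x * (eta p * L (kap p) q)) (e p))" for x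
  define a where "a = Endo f"
  have app: "app a = f" unfolding a_def f_def
    by (rule app_Endo) (simp add: distrib_right scale_left_distrib sum.distrib)
  have a: "a \<in> alg n"
  proof (rule algI)
    show "app a (sc c x) = sc c (app a x)" for c x
      by (simp add: app f_def scale_sum_right mult_ac)
    show "app a x \<in> V n" for x
      unfolding app f_def by (intro subspace_sum[OF V_subspace] subspace_scale[OF V_subspace] e_V)
    show "app a (e j) = 0" if "j \<in> I - S n" for j
    proof -
      have "co q (e j) = 0" if "q \<in> S n" for q using \<open>j \<in> I - S n\<close> that co_e[OF subsetD[OF S_sub that], of j] by auto
      then show ?thesis by (simp add: app f_def)
    qed
  qed
  have entry: "h (app a (e q)) (e p) = L p q" if pq: "p \<in> S n" "q \<in> S n" for p q
  proof -
    have pI: "p \<in> I" "q \<in> I" using pq S_sub by auto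
    have "f (e q) = (\<Sum>q'\<in>S n. if q' = q then (\<Sum>p\<in>S n. sc (eta p * L (kap p) q) (e p)) else 0)"
      unfolding f_def
    proof (intro sum.cong refl)
      fix q' assume "q' \<in> S n"
      then have "co q' (e q) = (if q' = q then 1 else 0)" by (rule co_e[OF subsetD[OF S_sub] pI(2)])
      then show "(\<Sum>p\<in>S n. sc (co q' (e q) * (eta p * L (kap p) q')) (e p))
          = (if q' = q then (\<Sum>p\<in>S n. sc (eta p * L (kap p) q) (e p)) else 0)" by simp
    qed
    also have "\<dots> = (\<Sum>p\<in>S n. sc (eta p * L (kap p) q) (e p))" using pq S_finite by simp
    finally have "h (f (e q)) (e p) = (\<Sum>p'\<in>S n. eta p' * L (kap p') q * h (e p') (e p))"
      by (simp add: h_sum_left h_scale_left)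
    also have "\<dots> = (\<Sum>p'\<in>S n. if p' = kap p then L p q else 0)"
    proof (intro sum.cong refl)
      fix p' assume "p' \<in> S n"
      then have p': "p' \<in> I" using S_sub by blast
      show "eta p' * L (kap p') q * h (e p') (e p) = (if p' = kap p then L p q else 0)"
        using h_basis[OF p' pI(1)] kap_kap[OF p'] kap_kap[OF pI(1)] by (auto simp: mult_ac)
    qed
    also have "\<dots> = L p q" using kap_S[OF pq(1)] S_finite by simp
    finally show ?thesis by (simp add: app)
  qed
  have "(\<lambda>i. nrm n (y i - a)) \<longlonglongrightarrow> (\<Sum>p\<in>S n. \<Sum>q\<in>S n. cmod (L p q - h (app a (e q)) (e p)))"
    unfolding nrm_def by (simp add: h_diff_left) (intro tendsto_intros L)
  then show ?thesis using a entry by (intro bexI[of _ a]) simp_all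
qed

sublocale alg: star_algebra "alg n" "nrm n" "star n" "scalar (1 / 2)" for n
proof
  show 0: "0 \<in> alg n"
    by (rule algI) (auto simp: subspace_0[OF V_subspace])
  show add: "a + a' \<in> alg n" if "a \<in> alg n" "a' \<in> alg n" for a a'
    using that by (intro algI) (auto simp: alg_scale scale_right_distrib algD subspace_add[OF V_subspace])
  show "- a \<in> alg n" if "a \<in> alg n" for a
    using that by (intro algI) (auto simp: alg_scale algD subspace_neg[OF V_subspace])
  show mult: "a * a' \<in> alg n" if "a \<in> alg n" "a' \<in> alg n" for a a'
    using that by (intro algI) (auto simp: alg_scale algD)
  show "scalar (1 / 2) * a \<in> alg n" if "a \<in> alg n" for a
    using that by (intro algI) (auto simp: alg_scale algD mult_ac subspace_scale[OF V_subspace])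
  show "scalar (1 / 2) + scalar (1 / 2) = 1"
    by (rule endo_eqI) (simp flip: scale_left_distrib)
  show "nrm n (a + a') \<le> nrm n a + nrm n a'" for a a'
    unfolding nrm_def by (simp add: h_add_left sum.distrib[symmetric] sum_mono norm_triangle_ineq)
  show "nrm n (- a) = nrm n a" for a
  proof -
    have "h (- x) y = - h x y" for x y using h_diff_left[of 0 x y] by simp
    then show ?thesis by (simp add: nrm_def)
  qed
  show "nrm n 0 = 0" by (simp add: nrm_def)
  show "nrm n (a * a') \<le> nrm n a * nrm n a'" if "a \<in> alg n" "a' \<in> alg n" for a a'
    using that by (rule nrm_mult)
  show "a = 0" if "a \<in> alg n" "nrm n a = 0" for a using that by (rule nrm_eq_0)
  show "nrm n (scalar (1 / 2) * a) \<le> nrm n a" for a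
    unfolding nrm_def by (intro sum_mono) (simp add: h_scale_left norm_mult norm_divide)
  show "\<exists>a\<in>alg n. (\<lambda>i. nrm n (y i - a)) \<longlonglongrightarrow> 0"
    if "\<And>i. y i \<in> alg n" "\<And>r. 0 < r \<Longrightarrow> \<exists>M. \<forall>i\<ge>M. \<forall>j\<ge>M. nrm n (y i - y j) < r" for y :: "nat \<Rightarrow> 'v endo"
    using that by (rule nrm_complete)
  show "star n a \<in> alg n" if "a \<in> alg n" for a using that by (rule star_alg)
  show "star n (a + a') = star n a + star n a'" if "a \<in> alg n" "a' \<in> alg n" for a a'
    using that by (intro star_unique add) (auto simp: h_add_left h_add_right h_star)
  show "star n (a * a') = star n a' * star n a" if "a \<in> alg n" "a' \<in> alg n" for a a'
    using that by (intro star_unique mult) (auto simp: h_star)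
  show "star n (star n a) = a" if "a \<in> alg n" for a
    using that by (intro star_unique star_alg) (auto simp: h_star')
  show "nrm n (star n a) = nrm n a" if "a \<in> alg n" for a using that by (rule nrm_star)
qed

text \<open>Nondegeneracy of the members of the flag enters here: for x in A the difference of x and
  its projection lies in the radical of h on A, hence is 0.\<close>

lemma exists_projection:
  assumes A: "subspace A" "A \<subseteq> V n" "nondegenerate_on h A"
  shows "\<exists>P\<in>alg n. star n P = P \<and> (\<forall>x. app P x \<in> A) \<and> (\<forall>x\<in>A. app P x = x)"
proof -
  obtain W where W: "complete_system W A" using exists_complete_system[OF A(1,2)] by blast
  then have oW: "orthogonal_system W" "W \<subseteq> A" by (auto simp: complete_system_def)
  have add: "proj W (x + y) = proj W x + proj W y" and scale: "proj W (sc c x) = sc c (proj W x)" for x y c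
    by (simp_all add: proj_def h_simps add_divide_distrib scale_left_distrib sum.distrib scale_sum_right)
  define P where "P = Endo (proj W)"
  have app: "app P = proj W" unfolding P_def using add by (rule app_Endo)
  have mem: "app P x \<in> A" for x unfolding app using A(1) oW(2) by (rule proj_mem)
  have P: "P \<in> alg n"
  proof (rule algI)
    show "app P (e j) = 0" if j: "j \<in> I - S n" for j
    proof -
      have "h (e j) w = 0" if "w \<in> W" for w using h_V_outside(2)[OF _ j] that oW(2) A(2) by blast
      then show ?thesis by (simp add: app proj_def)
    qed
  qed (use mem A(2) scale app in auto)
  have "h (app P x) y = h x (app P y)" for x y
  proof -
    have "h x w / h w w * h w y = cnj (h y w / h w w) * h x w" for w
    proof -
      have 1: "cnj (h y w) = h w y" by (rule h_cnj[symmetric])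
      show ?thesis by (simp add: 1 h_self_real)
    qed
    then show ?thesis
      by (simp add: app proj_def h_sum_left h_sum_right h_scale_left h_scale_right)
  qed
  then have "star n P = P" using P by (intro star_unique)
  moreover have "app P x = x" if x: "x \<in> A" for x
  proof -
    have "x - proj W x \<in> A" using x mem app A(1) by (metis subspace_diff)
    moreover have "h (x - proj W x) y = 0" if "y \<in> A" for y
      using W \<open>x - proj W x \<in> A\<close> h_diff_proj[OF oW(1)] that unfolding complete_system_def by blast
    ultimately have "x - proj W x = 0" using A(3) unfolding nondegenerate_on_def by blast
    then show ?thesis by (simp add: app)
  qed
  ultimately show ?thesis using P mem by blast
qed

end

context bilinear_space begin

text \<open>Conjugation by \<sigma>, whose inverse is \<open>sig\<close> times \<sigma>. Two
  antilinear factors make the result linear again; with \<open>star\<close> it gives the adjoint for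
  b.\<close>

definition twist :: "'v endo \<Rightarrow> 'v endo" where
  "twist a = sg * a * (scalar sig * sg)"

lemma app_twist: "app (twist a) x = s (app a (sc sig (s x)))"
  by (simp add: twist_def)

lemma twist_alg: assumes a: "a \<in> alg n" shows "twist a \<in> alg n"
proof (rule algI)
  show "app (twist a) (sc c x) = sc c (app (twist a) x)" for c x
    by (simp add: app_twist s_simps alg_scale[OF a] mult_ac)
  show "app (twist a) x \<in> V n" for x
    unfolding app_twist by (intro sg_V algD(2)[OF a])
  show "app (twist a) (e j) = 0" if j: "j \<in> I - S n" for j
  proof -
    have "tw j \<in> I - S n" using j tw_I[of j] tw_S[of "tw j" n] tw_tw[of j] by auto
    then have "app a (e (tw j)) = 0" by (rule algD(3)[OF a])
    then show ?thesis using j by (simp add: app_twist sg_e alg_scale[OF a])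
  qed
qed

lemma sg_inverse: "s (sc sig (s x)) = x" "sc sig (s (s x)) = x"
  by (simp_all add: s_simps)

lemma twist_mult: "twist (a * a') = twist a * twist a'"
  by (rule endo_eqI) (simp add: app_twist sg_inverse)

lemma twist_twist: "a \<in> alg n \<Longrightarrow> twist (twist a) = a"
  by (rule endo_eqI) (simp add: app_twist s_simps alg_scale)

lemma tw_bij: "bij_betw tw (S n) (S n)"
  by (rule bij_betw_byWitness[where f' = tw]) (auto intro: tw_S tw_tw[OF subsetD[OF S_sub]])

lemma cmod_sig [simp]: "cmod sig = 1" "cmod eps = 1"
  by (cases "form D"; simp add: sig_def eps_def)+

lemma nrm_twist: assumes a: "a \<in> alg n" shows "nrm n (twist a) = nrm n a"
proof -
  have "cmod (h (app (twist a) (e j)) (e i)) = cmod (h (app a (e (tw j))) (e (tw i)))"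
    if ij: "i \<in> S n" "j \<in> S n" for i j
  proof -
    have I: "i \<in> I" "j \<in> I" using ij S_sub by auto
    have "h (app (twist a) (e j)) (e i) = eps * h (s (e i)) (app a (sc sig (s (e j))))"
      unfolding app_twist by (rule h_sg_left)
    then have "cmod (h (app (twist a) (e j)) (e i)) = cmod (h (e (tw i)) (app a (e (tw j))))"
      using I by (simp add: sg_e alg_scale[OF a] h_simps norm_mult)
    then show ?thesis using h_cnj[of "e (tw i)" "app a (e (tw j))"] by simp
  qed
  then have "nrm n (twist a) = (\<Sum>i\<in>S n. \<Sum>j\<in>S n. cmod (h (app a (e (tw j))) (e (tw i))))"
    by (simp add: nrm_def)
  also have "\<dots> = (\<Sum>i\<in>S n. \<Sum>j\<in>S n. cmod (h (app a (e j)) (e (tw i))))"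
    by (intro sum.cong refl sum.reindex_bij_betw[OF tw_bij])
  also have "\<dots> = nrm n a"
    unfolding nrm_def by (rule sum.reindex_bij_betw[OF tw_bij])
  finally show ?thesis .
qed

lemma star_twist: assumes a: "a \<in> alg n" shows "star n (twist a) = twist (star n a)"
proof (rule star_unique[OF twist_alg[OF a]])
  fix x y
  let ?x = "sc sig (s x)" and ?y = "sc sig (s y)"
  have "h (app (twist a) x) (s ?y) = sig * eps * h ?y (app a ?x)"
    by (simp only: app_twist h_sg)
  also have "h ?y (app a ?x) = h (app (star n a) ?y) ?x" by (simp add: h_star'[OF a])
  also have "sig * eps * h (app (star n a) ?y) ?x = h (s ?x) (app (twist (star n a)) y)"
    by (simp only: app_twist h_sg)
  finally show "h (app (twist a) x) y = h x (app (twist (star n a)) y)" by (simp only: sg_inverse)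
qed

lemma twist_add: "twist (a + a') = twist a + twist a'"
  by (simp add: twist_def distrib_left distrib_right)

lemma b_twist: "a \<in> alg n \<Longrightarrow> b (app a x) y = b x (app (twist (star n a)) y)"
  by (simp add: b_eq app_twist s_simps h_star algD alg_scale[OF star_alg])

end

section \<open>Isometries near the identity\<close>

text \<open>The Gram matrix of a form in two guises, transformed by A on the left and B on the
  right. For h the matrix B is the conjugate of A, so that the determinant has modulus 1; for b it
  is A itself, so that the determinant squares to 1.\<close>

lemma det_on_gram:
  assumes S: "finite S" and M: "det_on S M \<noteq> 0"
    and eq: "\<And>i j. i \<in> S \<Longrightarrow> j \<in> S \<Longrightarrow> M i j = (\<Sum>k\<in>S. \<Sum>l\<in>S. A k i * M k l * B l j)"
  shows "det_on S A * det_on S B = 1"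
proof -
  have "det_on S M = det_on S (\<lambda>i j. \<Sum>k\<in>S. A k i * (\<Sum>l\<in>S. M k l * B l j))"
    using eq by (intro det_on_cong) (simp add: sum_distrib_left mult.assoc)
  also have "\<dots> = det_on S A * (det_on S M * det_on S B)"
    unfolding det_on_mult[OF S, of "\<lambda>i k. A k i" "\<lambda>k j. \<Sum>l\<in>S. M k l * B l j"]
      det_on_mult[OF S, of M B] det_on_transpose[OF S, of A] by (rule refl)
  finally show ?thesis using M by simp
qed

context flag_space begin

lemma endo_GL:
  assumes k: "k \<in> GL_level n"
  shows "Endo k - 1 \<in> alg n" "app (Endo k) = k"
proof -
  have app: "app (Endo k) = k" using linearD(1)[OF GL_linear[OF k]] by (rule app_Endo)
  show "Endo k - 1 \<in> alg n"
  proof (rule algI)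
    show "app (Endo k - 1) (sc c x) = sc c (app (Endo k - 1) x)" for c x
      by (simp add: app linearD(2)[OF GL_linear[OF k]] scale_right_diff_distrib)
    show "app (Endo k - 1) (e j) = 0" if "j \<in> I - S n" for j
      using GL_outside[OF k that] by (simp add: app)
    show "app (Endo k - 1) x \<in> V n" for x
    proof -
      have "x \<in> span (e ` I)" by (simp add: span_e)
      then obtain y z where yz: "x = y + z" "y \<in> V n" "z \<in> span (e ` (I - S n))"
        using split_level[of I x n] by blast
      have "k z = z" using GL_fixes_span[OF k _ yz(3)] by blast
      then have "app (Endo k - 1) x = k y - y" by (simp add: app yz linearD(1)[OF GL_linear[OF k]])
      then show ?thesis using GL_V_mem[OF k yz(2)] yz(2) by (simp add: subspace_diff[OF V_subspace])
    qed
  qed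
  show "app (Endo k) = k" by (rule app)
qed

lemma alg_GL:
  assumes a: "a \<in> alg n" and z: "z \<in> alg n" "(1 + a) * (1 + z) = 1" "(1 + z) * (1 + a) = 1"
  shows "app (1 + a) \<in> GL_level n"
proof -
  have lin: "Vector_Spaces.linear sc sc (app (1 + a))"
    unfolding linear_iff by (simp add: app_add alg_scale[OF a] scale_right_distrib)
  have inv: "app (1 + a) (app (1 + z) x) = x" "app (1 + z) (app (1 + a) x) = x" for x
    using z(2,3) by (metis app_simps(6) app_simps(2))+
  have "bij (app (1 + a))"
    by (rule o_bij[where g = "app (1 + z)"]) (simp_all only: fun_eq_iff o_apply inv id_apply simp_thms)
  moreover have V: "app (1 + a') x \<in> V n" if "a' \<in> alg n" "x \<in> V n" for a' x
    using that by (simp add: subspace_add[OF V_subspace] algD)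
  have "app (1 + a) ` V n = V n"
  proof
    show "V n \<subseteq> app (1 + a) ` V n"
    proof
      fix x assume "x \<in> V n"
      then show "x \<in> app (1 + a) ` V n" using inv(1)[of x] V[OF z(1), of x] by (metis imageI)
    qed
  qed (use V[OF a] in blast)
  ultimately show ?thesis using lin algD(3)[OF a] by (simp add: GL_level_def)
qed

lemma alg_small_GL: "a \<in> alg n \<Longrightarrow> nrm n a \<le> 1 / 2 \<Longrightarrow> app (1 + a) \<in> GL_level n"
  using alg.one_add_inverse[of a n] alg_GL by metis

lemma h_unitary:
  assumes a: "a \<in> alg n" and u: "(1 + star n a) * (1 + a) = 1"
  shows "h (app (1 + a) x) (app (1 + a) y) = h x y"
proof -
  have "h (app (1 + a) x) (app (1 + a) y) = h x (app ((1 + star n a) * (1 + a)) y)"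
    by (simp add: h_simps h_star[OF a] app_add algebra_simps)
  then show ?thesis by (simp add: u)
qed

text \<open>Write g' g^-1 - 1 as (g' - g) g^-1; the matrix topology controls g' - g, and g^-1 is
  fixed.\<close>

lemma nbhd_quotient:
  assumes g: "g \<in> GL_level n" and d: "0 < d"
  shows "\<exists>W. open W \<and> mat_entries D g \<in> W \<and>
    (\<forall>g'\<in>GL_level n. mat_entries D g' \<in> W \<longrightarrow> nrm n (Endo (g' \<circ> inv g) - 1) < d)"
proof -
  \<comment> \<open>Submultiplicativity holds in \<open>alg n\<close> only, so g^-1 is split as 1
    plus an element of \<open>alg n\<close>.\<close>
  define K where "K = 1 + nrm n (Endo (inv g) - 1)"
  have K: "0 < K" using nrm_nonneg[of n "Endo (inv g) - 1"] by (simp add: K_def)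
  \<comment> \<open>The shift by \<open>kap\<close> translates coordinates into the values of h of
    which \<open>nrm\<close> is made.\<close>
  define W where "W = {A. (\<Sum>i\<in>S n. \<Sum>j\<in>S n. cmod (A (kap i) j - mat_entries D g (kap i) j)) < d / K}"
  have coord: "continuous_on UNIV (\<lambda>A::int \<Rightarrow> int \<Rightarrow> complex. A k l)" for k l
    by (rule continuous_on_product_then_coordinatewise[OF continuous_on_product_then_coordinatewise[OF continuous_on_id]])
  have "open W" unfolding W_def
    by (intro open_Collect_less continuous_intros coord)
  moreover have "mat_entries D g \<in> W" using d K by (simp add: W_def)
  moreover have "nrm n (Endo (g' \<circ> inv g) - 1) < d" if g': "g' \<in> GL_level n" "mat_entries D g' \<in> W" for g'
  proof -
    note gi = GL_inv[OF g]
    have app: "app (Endo g) = g" "app (Endo g') = g'" "app (Endo (inv g)) = inv g" "app (Endo (g' \<circ> inv g)) = g' \<circ> inv g"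
      using endo_GL(2) g g'(1) gi GL_comp by blast+
    let ?c = "Endo g' - Endo g" and ?a = "Endo (inv g) - 1"
    have "?c = (Endo g' - 1) - (Endo g - 1)" by simp
    then have c: "?c \<in> alg n" using alg.A_diff[OF endo_GL(1)[OF g'(1)] endo_GL(1)[OF g]] by simp
    have a: "?a \<in> alg n" by (rule endo_GL(1)[OF gi])
    have ginv: "g (inv g x) = x" for x using GL_bij[OF g] by (simp add: bij_def surj_f_inv_f)
    have "Endo (g' \<circ> inv g) - 1 = ?c * Endo (inv g)"
      by (rule endo_eqI) (simp add: app ginv)
    also have "\<dots> = ?c + ?c * ?a" by (simp add: algebra_simps)
    finally have "nrm n (Endo (g' \<circ> inv g) - 1) \<le> nrm n ?c + nrm n ?c * nrm n ?a"
      using alg.N_add[of n ?c "?c * ?a"] alg.N_mult[OF c a] by simp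
    then have le: "nrm n (Endo (g' \<circ> inv g) - 1) \<le> nrm n ?c * K" by (simp add: K_def algebra_simps)
    have "nrm n ?c = (\<Sum>i\<in>S n. \<Sum>j\<in>S n. cmod (mat_entries D g' (kap i) j - mat_entries D g (kap i) j))"
      unfolding nrm_def
    proof (intro sum.cong refl)
      fix i j assume "i \<in> S n" "j \<in> S n"
      then have ij: "i \<in> I" "j \<in> I" using S_sub by auto
      have "h (app ?c (e j)) (e i) = eta i * (mat_entries D g' (kap i) j - mat_entries D g (kap i) j)"
        using ij kap_I[OF ij(1)] by (simp add: app h_e mat_entries_eq)
      then show "cmod (h (app ?c (e j)) (e i)) = cmod (mat_entries D g' (kap i) j - mat_entries D g (kap i) j)"
        by (simp add: norm_mult)
    qed
    then have "nrm n ?c < d / K" using g'(2) by (simp add: W_def)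
    then have "nrm n ?c * K < d" using K by (simp add: field_simps)
    then show ?thesis using le by simp
  qed
  ultimately show ?thesis by blast
qed

lemma gram_expand:
  assumes x: "x \<in> V n" and y: "y \<in> V n"
  shows "h x y = (\<Sum>k\<in>S n. \<Sum>l\<in>S n. co k x * h (e k) (e l) * cnj (co l y))"
proof -
  have "h x y = h (\<Sum>k\<in>S n. sc (co k x) (e k)) (\<Sum>l\<in>S n. sc (co l y) (e l))"
    using V_expand[OF x] V_expand[OF y] by simp
  also have "\<dots> = (\<Sum>l\<in>S n. \<Sum>k\<in>S n. co k x * h (e k) (e l) * cnj (co l y))"
    by (simp add: h_sum_left h_sum_right h_scale_left h_scale_right sum_distrib_left mult_ac)
  also have "\<dots> = (\<Sum>k\<in>S n. \<Sum>l\<in>S n. co k x * h (e k) (e l) * cnj (co l y))" by (rule sum.swap)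
  finally show ?thesis .
qed

text \<open>The Gram matrix is a signed permutation matrix of an involution with matching signs, so
  its square is the identity.\<close>

lemma det_h_gram: "det_on (S n) (\<lambda>i j. h (e i) (e j)) \<noteq> 0"
proof -
  let ?H = "\<lambda>i j. h (e i) (e j)"
  have "det_on (S n) ?H * det_on (S n) ?H = det_on (S n) (\<lambda>i j. \<Sum>k\<in>S n. ?H i k * ?H k j)"
    by (rule det_on_mult[OF S_finite, symmetric])
  also have "\<dots> = 1"
  proof (rule det_on_id[OF S_finite])
    fix i j assume ij: "i \<in> S n" "j \<in> S n"
    then have I: "i \<in> I" "j \<in> I" using S_sub by auto
    have "(\<Sum>k\<in>S n. ?H i k * ?H k j) = (\<Sum>k\<in>S n. if k = kap i then eta i * ?H (kap i) j else 0)"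
    proof (intro sum.cong refl)
      fix k assume "k \<in> S n"
      then have "k \<in> I" using S_sub by blast
      then show "?H i k * ?H k j = (if k = kap i then eta i * ?H (kap i) j else 0)" using h_basis[OF I(1)] by simp
    qed
    also have "\<dots> = eta i * ?H (kap i) j" using kap_S[OF ij(1)] S_finite by simp
    also have "\<dots> = (if i = j then 1 else 0)"
      using h_basis[OF kap_I[OF I(1)] I(2)] by (auto simp: kap_kap[OF I(1)] eta_kap[OF I(1)] eta_kap[OF I(2)])
    finally show "(\<Sum>k\<in>S n. ?H i k * ?H k j) = (if i = j then 1 else 0)" .
  qed
  finally show ?thesis by auto
qed

lemma det_unitary:
  assumes u: "u \<in> GL_level n" "\<And>x y. h (u x) (u y) = h x y"
  shows "cmod (det_on (S n) (mat_entries D u)) = 1"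
proof -
  let ?A = "mat_entries D u"
  have "det_on (S n) ?A * det_on (S n) (\<lambda>i j. cnj (?A i j)) = 1"
  proof (rule det_on_gram[OF S_finite det_h_gram])
    fix i j assume ij: "i \<in> S n" "j \<in> S n"
    have "h (e i) (e j) = h (u (e i)) (u (e j))" by (simp add: u)
    also have "\<dots> = (\<Sum>k\<in>S n. \<Sum>l\<in>S n. co k (u (e i)) * h (e k) (e l) * cnj (co l (u (e j))))"
      using ij by (intro gram_expand GL_V_mem[OF u(1)] e_V)
    also have "\<dots> = (\<Sum>k\<in>S n. \<Sum>l\<in>S n. ?A k i * h (e k) (e l) * cnj (?A l j))"
    proof (intro sum.cong refl)
      fix k l assume "k \<in> S n" "l \<in> S n"
      then show "co k (u (e i)) * h (e k) (e l) * cnj (co l (u (e j))) = ?A k i * h (e k) (e l) * cnj (?A l j)"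
        using ij S_sub[of n] by (simp add: mat_entries_eq subset_iff)
    qed
    finally show "h (e i) (e j) = (\<Sum>k\<in>S n. \<Sum>l\<in>S n. ?A k i * h (e k) (e l) * cnj (?A l j))" .
  qed
  then have "det_on (S n) ?A * cnj (det_on (S n) ?A) = 1" by (simp add: det_on_cnj)
  then have "complex_of_real ((cmod (det_on (S n) ?A))\<^sup>2) = 1" by (simp only: complex_norm_square)
  then have "(cmod (det_on (S n) ?A))\<^sup>2 = 1" by (simp only: of_real_eq_1_iff)
  then show ?thesis by (simp add: power2_eq_1_iff) (metis norm_ge_zero not_one_le_zero neg_0_le_iff_le)
qed

text \<open>Multiplication by c on V_n and the identity on its complement. It maps every subspace of
  V_n to itself when c is nonzero and thus corrects a determinant without moving the level part of a
  flag.\<close>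

definition level_scale :: "nat \<Rightarrow> complex \<Rightarrow> 'v \<Rightarrow> 'v" where
  "level_scale n c x = x + sc (c - 1) (\<Sum>i\<in>S n. sc (co i x) (e i))"

lemma level_scale_V: "x \<in> V n \<Longrightarrow> level_scale n c x = sc c x"
  using V_expand[of x n] by (simp add: level_scale_def scale_left_diff_distrib)

lemma level_scale_linear: "Vector_Spaces.linear sc sc (level_scale n c)"
  by (simp add: linear_iff level_scale_def scale_left_distrib sum.distrib scale_right_distrib scale_sum_right
      mult_ac add_ac)

lemma level_scale_e: "j \<in> I \<Longrightarrow> level_scale n c (e j) = (if j \<in> S n then sc c (e j) else e j)"
proof -
  assume j: "j \<in> I"
  have "co i (e j) = 0" if "i \<in> S n" "j \<notin> S n" for i
    using co_e[OF subsetD[OF S_sub that(1)] j] that by auto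
  then show ?thesis using level_scale_V[OF e_V] by (auto simp: level_scale_def)
qed

lemma level_scale_comp: "level_scale n c \<circ> level_scale n d = level_scale n (c * d)"
  by (rule linear_eqI[OF linear_comp[OF level_scale_linear level_scale_linear] level_scale_linear])
    (auto simp: level_scale_e linearD(2)[OF level_scale_linear])

lemma level_scale_1: "level_scale n 1 = id"
  by (simp add: level_scale_def fun_eq_iff)

lemma level_scale_GL: assumes "c \<noteq> 0" shows "level_scale n c \<in> GL_level n"
proof -
  have inv: "level_scale n c \<circ> level_scale n (1 / c) = id" "level_scale n (1 / c) \<circ> level_scale n c = id"
    using assms by (simp_all add: level_scale_comp level_scale_1)
  have "level_scale n c ` V n = V n"
  proof
    show "level_scale n c ` V n \<subseteq> V n" by (auto simp: level_scale_V subspace_scale[OF V_subspace])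
    show "V n \<subseteq> level_scale n c ` V n"
    proof
      fix x assume "x \<in> V n"
      then show "x \<in> level_scale n c ` V n"
        using assms subspace_scale[OF V_subspace, of x n "1 / c"]
        by (intro image_eqI[of _ _ "sc (1 / c) x"]) (auto simp: level_scale_V)
    qed
  qed
  then show ?thesis
    using level_scale_linear o_bij[OF inv(2,1)] by (simp add: GL_level_def level_scale_e)
qed

lemma level_scale_h: assumes "cmod c = 1" shows "h (level_scale n c x) (level_scale n c y) = h x y"
proof -
  define p where "p x = (\<Sum>i\<in>S n. sc (co i x) (e i))" for x
  have decomp: "h (p x) y = h (p x) (p y)" for x y
  proof -
    have "y \<in> span (e ` I)" by (simp add: span_e)
    then obtain y1 z where yz: "y = y1 + z" "y1 \<in> V n" "z \<in> span (e ` (I - S n))"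
      using split_level[of I y n] by blast
    have pV: "p x \<in> V n" unfolding p_def by (intro subspace_sum[OF V_subspace] subspace_scale[OF V_subspace] e_V)
    have "co i z = 0" if "i \<in> S n" for i using co_span_0[OF _ yz(3)] that S_sub by blast
    then have "p y = p y1" by (simp add: p_def yz)
    also have "\<dots> = y1" using V_expand[OF yz(2)] by (simp add: p_def)
    finally show ?thesis using h_V_span_outside[OF pV _ yz(3)] by (simp add: yz(1) h_add_right)
  qed
  have decomp': "h y (p x) = h (p y) (p x)" for x y
    using decomp[of x y] h_cnj by metis
  have "c * cnj c = 1" using assms by (simp add: complex_norm_square[symmetric])
  have "h (level_scale n c x) (level_scale n c y)
      = h x y + cnj (c - 1) * h x (p y) + (c - 1) * h (p x) y + (c - 1) * cnj (c - 1) * h (p x) (p y)"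
    unfolding level_scale_def p_def[symmetric] by (simp add: h_simps algebra_simps)
  also have "\<dots> = h x y + (c * cnj c - 1) * h (p x) (p y)"
    using decomp[of x y] decomp'[of x y] by (simp add: algebra_simps)
  finally show ?thesis using \<open>c * cnj c = 1\<close> by simp
qed

lemma unit_root:
  assumes "cmod d = 1" shows "\<exists>c. cmod c = 1 \<and> c ^ m * d = 1 \<or> m = 0"
proof -
  have "(cis (- Arg d / m)) ^ m * d = 1" if "m \<noteq> 0"
  proof -
    have "d = cis (Arg d)" using assms rcis_cmod_Arg[of d] by (simp add: rcis_def)
    moreover have "(cis (- Arg d / m)) ^ m = cis (- Arg d)" using Complex.DeMoivre[of "- Arg d / m" m] that by simp
    ultimately have "(cis (- Arg d / m)) ^ m * d = cis (- Arg d) * cis (Arg d)" by simp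
    then show ?thesis by (simp add: cis_mult)
  qed
  then show ?thesis by (metis norm_cis)
qed

lemma unitary_det_adjust:
  assumes u: "u \<in> GL_level n" "\<And>x y. h (u x) (u y) = h x y"
  obtains c where "cmod c = 1" "det_on (S n) (mat_entries D (level_scale n c \<circ> u)) = 1"
proof -
  let ?d = "det_on (S n) (mat_entries D u)"
  have d: "cmod ?d = 1" using det_unitary[OF u] .
  have det: "det_on (S n) (mat_entries D (level_scale n c \<circ> u)) = c ^ card (S n) * ?d" for c
  proof -
    have "det_on (S n) (mat_entries D (level_scale n c \<circ> u)) = det_on (S n) (\<lambda>i j. c * mat_entries D u i j)"
      using S_sub by (intro det_on_cong) (auto simp: mat_entries_eq level_scale_V GL_V_mem[OF u(1)] e_V)
    then show ?thesis by (simp add: det_on_scale)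
  qed
  show ?thesis
  proof (cases "card (S n) = 0")
    case True
    then have "S n = {}" using S_finite by simp
    then show ?thesis using that[of 1] by (simp add: det_on_def)
  next
    case False
    then show ?thesis using unit_root[OF d, of "card (S n)"] that det by metis
  qed
qed

lemma star_scalar: "a \<in> alg n \<Longrightarrow> star n (scalar (of_real r) * a) = scalar (of_real r) * star n a"
  and scalar_alg: "a \<in> alg n \<Longrightarrow> scalar c * a \<in> alg n"
  and nrm_scalar: "nrm n (scalar c * a) = cmod c * nrm n a"
  and scalar_comm: "a \<in> alg n \<Longrightarrow> a * scalar c = scalar c * a"
proof -
  show sa: "scalar c * a \<in> alg n" if "a \<in> alg n" for a c
    using that by (intro algI) (auto simp: alg_scale algD mult_ac subspace_scale[OF V_subspace])
  show "a \<in> alg n \<Longrightarrow> star n (scalar (of_real r) * a) = scalar (of_real r) * star n a"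
    by (intro star_unique sa) (simp_all add: h_scale_left h_scale_right h_star)
  show "nrm n (scalar c * a) = cmod c * nrm n a"
    by (simp add: nrm_def h_scale_left norm_mult sum_distrib_left)
  show "a \<in> alg n \<Longrightarrow> a * scalar c = scalar c * a"
    by (rule endo_eqI) (simp add: alg_scale)
qed

text \<open>Since v' v = - (v + v'), both sides are 1 plus the multiple p - p^2 of v + v', which is
  symmetric under p \<mapsto> 1 - p.\<close>

lemma interpolation_product:
  assumes v: "v \<in> alg n" "v' \<in> alg n" "(1 + v') * (1 + v) = 1"
  shows "(1 + scalar p * v') * (1 + scalar p * v) = (1 + scalar (1 - p) * v') * (1 + scalar (1 - p) * v)"
proof -
  have 1: "v' * v = - (v + v')"
  proof -
    have "v' * v + (v + v') = 0" using v(3) by (simp add: algebra_simps)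
    then show ?thesis by (rule eq_neg_iff_add_eq_0[THEN iffD2])
  qed
  have "(1 + scalar p * v') * (1 + scalar p * v) = 1 + scalar (p - p * p) * (v + v')" for p
  proof -
    have "scalar p * v' * (scalar p * v) = scalar p * scalar p * (v' * v)"
      using scalar_comm[OF v(2), of p] by (metis mult.assoc)
    then have "(1 + scalar p * v') * (1 + scalar p * v) = 1 + scalar p * (v + v') + scalar p * scalar p * (- (v + v'))"
      by (simp add: 1 algebra_simps)
    also have "\<dots> = 1 + scalar (p - p * p) * (v + v')"
      by (rule endo_eqI) (simp add: scale_left_diff_distrib scale_right_distrib scale_right_diff_distrib)
    finally show ?thesis .
  qed
  moreover have "p - p * p = (1 - p) - (1 - p) * (1 - p)" by (simp add: algebra_simps)
  ultimately show ?thesis by metis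
qed

end

context flag_space begin

text \<open>1 + w is the quotient of 1 + p v by 1 + (1 - p) v, and by the symmetry in p both have
  the same product with their adjoints. The operation \<open>st\<close> is \<open>star n\<close> for
  h and its composition with \<open>twist\<close> for b.\<close>

lemma interpolation_isometry:
  fixes st :: "'v endo \<Rightarrow> 'v endo"
  assumes st: "\<And>a. a \<in> alg n \<Longrightarrow> st a \<in> alg n" "\<And>a a'. a \<in> alg n \<Longrightarrow> a' \<in> alg n \<Longrightarrow> st (a + a') = st a + st a'"
      "\<And>a a'. a \<in> alg n \<Longrightarrow> a' \<in> alg n \<Longrightarrow> st (a * a') = st a' * st a"
      "\<And>a r. a \<in> alg n \<Longrightarrow> st (scalar (of_real r) * a) = scalar (of_real r) * st a"
    and v: "v \<in> alg n" "(1 + st v) * (1 + v) = 1"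
    and z: "z \<in> alg n" "(1 + scalar (of_real (1 - p)) * v) * (1 + z) = 1"
    and w: "w = scalar (of_real p) * v + z + scalar (of_real p) * v * z"
  shows "(1 + st w) * (1 + w) = 1"
proof -
  let ?a = "scalar (of_real p) * v" and ?b = "scalar (of_real (1 - p)) * v"
  have A: "?a \<in> alg n" "?b \<in> alg n" using scalar_alg v(1) by blast+
  have st0: "st 0 = 0" using st(2)[of 0 0] alg.A_zero by simp
  have 1: "1 + w = (1 + ?a) * (1 + z)" by (simp add: w algebra_simps)
  have "1 + st w = (1 + st z) * (1 + st ?a)"
  proof -
    have "st w = st ?a + st z + st z * st ?a"
      unfolding w by (simp add: st(2,3) alg.A_add alg.A_mult A(1) z(1))
    then show ?thesis by (simp add: algebra_simps)
  qed
  then have "(1 + st w) * (1 + w) = (1 + st z) * ((1 + st ?a) * (1 + ?a)) * (1 + z)"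
    using 1 by (simp only: mult.assoc)
  also have "(1 + st ?a) * (1 + ?a) = (1 + st ?b) * (1 + ?b)"
  proof -
    have s: "st ?a = scalar (of_real p) * st v" "st ?b = scalar (of_real (1 - p)) * st v"
      by (rule st(4)[OF v(1)])+
    show ?thesis unfolding s unfolding of_real_diff of_real_1
      by (rule interpolation_product[OF v(1) st(1)[OF v(1)] v(2)])
  qed
  also have "(1 + st z) * ((1 + st ?b) * (1 + ?b)) * (1 + z) = ((1 + st z) * (1 + st ?b)) * ((1 + ?b) * (1 + z))"
    by (simp only: mult.assoc)
  also have "(1 + st z) * (1 + st ?b) = 1"
  proof -
    have "?b + z + ?b * z = 0" using z(2) by (simp add: algebra_simps)
    then have "st (?b + z + ?b * z) = 0" using st0 by simp
    then have "st ?b + st z + st z * st ?b = 0" using A(2) z(1) by (simp add: st(2,3) alg.A_add alg.A_mult)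
    moreover have "(1 + st z) * (1 + st ?b) = 1 + (st ?b + st z + st z * st ?b)" by (simp add: algebra_simps)
    ultimately show ?thesis by simp
  qed
  finally show ?thesis using z(2) by simp
qed

lemma mat_entries_alg_diff:
  assumes w: "w \<in> alg n" "w' \<in> alg n"
  shows "cmod (mat_entries D (app (1 + w)) i j - mat_entries D (app (1 + w')) i j) \<le> nrm n (w - w')"
proof (cases "i \<in> I \<and> j \<in> I")
  case False
  then show ?thesis using nrm_nonneg by (auto simp: mat_entries_eq)
next
  case True
  have W: "w - w' \<in> alg n" using w by (rule alg.A_diff)
  have eq: "mat_entries D (app (1 + w)) i j - mat_entries D (app (1 + w')) i j = co i (app (w - w') (e j))"
    using True by (simp add: mat_entries_eq)
  show ?thesis
  proof (cases "i \<in> S n \<and> j \<in> S n")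
    case True
    then have "cmod (h (app (w - w') (e j)) (e (kap i))) \<le> nrm n (w - w')" by (intro nrm_entry kap_S) auto
    then show ?thesis unfolding eq by (simp add: co_def norm_mult)
  next
    case False
    then have "co i (app (w - w') (e j)) = 0"
      using algD(2)[OF W, of "e j"] algD(3)[OF W, of j] True V_iff[of "app (w - w') (e j)" n] by (cases "j \<in> S n") auto
    then show ?thesis unfolding eq using nrm_nonneg by simp
  qed
qed

end

context bilinear_space begin

text \<open>The Gram matrix of h is that of b times the matrix \<open>?M\<close> of \<sigma> on
  E.\<close>

lemma det_b_gram: "det_on (S n) (\<lambda>i j. b (e i) (e j)) \<noteq> 0"
proof -
  let ?M = "\<lambda>k j. if k = tw j then mu j else 0"
  have "det_on (S n) (\<lambda>i j. h (e i) (e j)) = det_on (S n) (\<lambda>i j. \<Sum>k\<in>S n. b (e i) (e k) * ?M k j)"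
  proof (rule det_on_cong)
    fix i j assume ij: "i \<in> S n" "j \<in> S n"
    have "(\<Sum>k\<in>S n. b (e i) (e k) * ?M k j) = (\<Sum>k\<in>S n. if k = tw j then mu j * b (e i) (e (tw j)) else 0)"
      by (intro sum.cong refl) auto
    also have "\<dots> = mu j * b (e i) (e (tw j))" using tw_S[OF ij(2)] S_finite by simp
    also have "\<dots> = h (e i) (e j)" using ij S_sub by (intro b_basis_tw) auto
    finally show "h (e i) (e j) = (\<Sum>k\<in>S n. b (e i) (e k) * ?M k j)" by simp
  qed
  also have "\<dots> = det_on (S n) (\<lambda>i j. b (e i) (e j)) * det_on (S n) ?M" by (rule det_on_mult[OF S_finite])
  finally show ?thesis using det_h_gram[of n] by auto
qed

lemma b_sum_left: "b (sum f K) y = (\<Sum>i\<in>K. b (f i) y)" and b_sum_right: "b y (sum f K) = (\<Sum>i\<in>K. b y (f i))"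
  by (induction K rule: infinite_finite_induct) (auto simp: b_simps)

lemma det_isometry:
  assumes u: "u \<in> GL_level n" "\<And>x y. b (u x) (u y) = b x y"
  shows "det_on (S n) (mat_entries D u) * det_on (S n) (mat_entries D u) = 1"
proof (rule det_on_gram[OF S_finite det_b_gram])
  let ?A = "mat_entries D u"
  fix i j assume ij: "i \<in> S n" "j \<in> S n"
  then have V: "u (e i) \<in> V n" "u (e j) \<in> V n" by (auto intro: GL_V_mem[OF u(1)] e_V)
  have "b (e i) (e j) = b (\<Sum>k\<in>S n. sc (co k (u (e i))) (e k)) (\<Sum>l\<in>S n. sc (co l (u (e j))) (e l))"
    using V_expand[OF V(1)] V_expand[OF V(2)] u(2) by simp
  also have "\<dots> = (\<Sum>k\<in>S n. \<Sum>l\<in>S n. co k (u (e i)) * b (e k) (e l) * co l (u (e j)))"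
    unfolding b_sum_left by (intro sum.cong refl) (simp add: b_sum_right b_simps sum_distrib_left mult_ac)
  also have "\<dots> = (\<Sum>k\<in>S n. \<Sum>l\<in>S n. ?A k i * b (e k) (e l) * ?A l j)"
  proof (intro sum.cong refl)
    fix k l assume "k \<in> S n" "l \<in> S n"
    then show "co k (u (e i)) * b (e k) (e l) * co l (u (e j)) = ?A k i * b (e k) (e l) * ?A l j"
      using ij S_sub[of n] by (simp add: mat_entries_eq subset_iff)
  qed
  finally show "b (e i) (e j) = (\<Sum>k\<in>S n. \<Sum>l\<in>S n. ?A k i * b (e k) (e l) * ?A l j)" .
qed

lemma b_product:
  "a \<in> alg n \<Longrightarrow> b (app (1 + a) x) (app (1 + a) y) = b x (app ((1 + twist (star n a)) * (1 + a)) y)"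
  by (simp add: b_simps b_twist app_add algebra_simps)

lemma b_isometry_twist:
  assumes k: "k \<in> GL_level n" "\<And>x y. b (k x) (k y) = b x y"
  defines "a \<equiv> Endo k - 1"
  shows "(1 + twist (star n a)) * (1 + a) = 1" "(1 + a) * (1 + twist (star n a)) = 1"
proof -
  have a: "a \<in> alg n" and app: "app (1 + a) = k" using endo_GL[OF k(1)] by (auto simp: a_def)
  let ?T = "1 + twist (star n a)"
  show T: "?T * (1 + a) = 1"
  proof (rule endo_eqI)
    fix y
    have "b x (app (?T * (1 + a)) y) = b x y" for x
      using b_product[OF a, of x y] unfolding app by (simp only: k(2))
    then have "app (?T * (1 + a)) y - y = 0" by (intro b_nondeg_right) (simp only: b_diff_right diff_self)
    then show "app (?T * (1 + a)) y = app 1 y" by simp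
  qed
  have "(1 + a) * Endo (inv k) = 1"
  proof (rule endo_eqI)
    have "k (inv k x) = x" for x using GL_bij[OF k(1)] by (simp add: bij_def surj_f_inv_f)
    then show "app ((1 + a) * Endo (inv k)) x = app 1 x" for x
      using endo_GL(2)[OF GL_inv[OF k(1)]] app by (simp only: app_simps)
  qed
  moreover have "?T = Endo (inv k)"
  proof -
    have "?T = ?T * ((1 + a) * Endo (inv k))" using \<open>(1 + a) * Endo (inv k) = 1\<close> by simp
    also have "\<dots> = ?T * (1 + a) * Endo (inv k)" by (simp only: mult.assoc)
    finally show ?thesis using T by simp
  qed
  ultimately show "(1 + a) * ?T = 1" by simp
qed

lemma twist_scalar: "a \<in> alg n \<Longrightarrow> twist (scalar (of_real r) * a) = scalar (of_real r) * twist a"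
  by (rule endo_eqI) (simp add: app_twist s_simps)

lemma twist_star:
  assumes "a \<in> alg n"
  shows "a' \<in> alg n \<Longrightarrow> twist (star n (a * a')) = twist (star n a') * twist (star n a)"
    and "twist (star n (scalar (of_real r) * a)) = scalar (of_real r) * twist (star n a)"
proof -
  show "twist (star n (a * a')) = twist (star n a') * twist (star n a)" if "a' \<in> alg n"
    using assms that by (simp add: alg.st_mult twist_mult)
  show "twist (star n (scalar (of_real r) * a)) = scalar (of_real r) * twist (star n a)"
    using star_scalar[OF assms] twist_scalar[OF star_alg[OF assms]] by simp
qed

text \<open>\<open>t \<mapsto> (\<alpha>u + \<beta>)(\<beta>u + \<alpha>)\<^sup>-\<^sup>1\<close> with \<open>\<alpha> = (1 + t)/2\<close>, \<open>\<beta> = (1 - t)/2\<close> (a Cayley transform) connects \<open>1\<close> to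
  \<open>u = 1 + v\<close> inside the group of isometries of \<open>b\<close> and \<open>h\<close>; \<open>det = \<plusminus>1\<close> is constant along it.\<close>

lemma small_isometry_G0:
  assumes v: "v \<in> alg n" "(1 + star n v) * (1 + v) = 1" "(1 + twist (star n v)) * (1 + v) = 1"
    and small: "nrm n v \<le> 1 / 8"
  shows "app (1 + v) \<in> G0 D"
proof -
  let ?T = "{0..1::real}"
  define a where "a t = scalar (of_real ((1 + t) / 2)) * v" for t
  define bb where "bb t = scalar (of_real (1 - (1 + t) / 2)) * v" for t
  have A: "a t \<in> alg n" "bb t \<in> alg n" for t unfolding a_def bb_def using scalar_alg v(1) by blast+
  have Na: "nrm n (a t) \<le> 1 / 8" "nrm n (bb t) \<le> 1 / 8" if "t \<in> ?T" for t
  proof -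
    have "\<bar>(1 + t) / 2\<bar> \<le> 1" "\<bar>1 - (1 + t) / 2\<bar> \<le> 1" using that by auto
    then have "\<bar>(1 + t) / 2\<bar> * nrm n v \<le> 1 * (1 / 8)" "\<bar>1 - (1 + t) / 2\<bar> * nrm n v \<le> 1 * (1 / 8)"
      using small nrm_nonneg by (intro mult_mono; simp)+
    then show "nrm n (a t) \<le> 1 / 8" "nrm n (bb t) \<le> 1 / 8" unfolding a_def bb_def nrm_scalar norm_of_real by simp_all
  qed
  have "\<forall>t\<in>?T. \<exists>z. z \<in> alg n \<and> (1 + bb t) * (1 + z) = 1 \<and> (1 + z) * (1 + bb t) = 1 \<and> nrm n z \<le> 2 * nrm n (bb t)"
  proof
    fix t assume "t \<in> ?T"
    then have "nrm n (bb t) \<le> 1 / 2" using Na(2)[of t] by simp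
    then show "\<exists>z. z \<in> alg n \<and> (1 + bb t) * (1 + z) = 1 \<and> (1 + z) * (1 + bb t) = 1 \<and> nrm n z \<le> 2 * nrm n (bb t)"
      using alg.one_add_inverse[OF A(2)[of t]] by metis
  qed
  then obtain z where z: "\<And>t. t \<in> ?T \<Longrightarrow> z t \<in> alg n" "\<And>t. t \<in> ?T \<Longrightarrow> (1 + bb t) * (1 + z t) = 1"
    "\<And>t. t \<in> ?T \<Longrightarrow> (1 + z t) * (1 + bb t) = 1" "\<And>t. t \<in> ?T \<Longrightarrow> nrm n (z t) \<le> 2 * nrm n (bb t)"
    by metis
  have Nz: "nrm n (z t) \<le> 1 / 4" if "t \<in> ?T" for t using z(4)[OF that] Na(2)[OF that] by simp
  define w where "w t = a t + z t + a t * z t" for t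
  have w: "w t \<in> alg n" if "t \<in> ?T" for t
    unfolding w_def using A(1) z(1)[OF that] by (intro alg.A_add alg.A_mult)
  have w1: "1 + w t = (1 + a t) * (1 + z t)" for t by (simp add: w_def algebra_simps)
  \<comment> \<open>The constant 1/8 is chosen for this: 1/8 + 1/4 + 1/32 is below the 1/2 required
    by \<open>alg_small_GL\<close>.\<close>
  have Nw: "nrm n (w t) \<le> 1 / 2" if t: "t \<in> ?T" for t
  proof -
    have "nrm n (w t) \<le> nrm n (a t) + nrm n (z t) + nrm n (a t) * nrm n (z t)"
      unfolding w_def
      using alg.N_add[of n "a t + z t" "a t * z t"] alg.N_add[of n "a t" "z t"] alg.N_mult[OF A(1) z(1)[OF t]]
      by (meson add_mono order_trans)
    also have "\<dots> \<le> 1 / 8 + 1 / 4 + 1 / 8 * (1 / 4)"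
      using Na[OF t] Nz[OF t] nrm_nonneg by (intro add_mono mult_mono) auto
    finally show ?thesis by simp
  qed
  define p where "p t = app (1 + w t)" for t
  have GL: "p t \<in> GL_level n" if "t \<in> ?T" for t unfolding p_def by (rule alg_small_GL[OF w[OF that] Nw[OF that]])
  have ph: "h (p t x) (p t y) = h x y" if t: "t \<in> ?T" for t x y
  proof -
    have "(1 + star n (w t)) * (1 + w t) = 1"
      by (rule interpolation_isometry[where n = n and st = "star n" and v = v and z = "z t" and p = "(1 + t) / 2"])
        (use v z(1,2)[OF t] in \<open>simp_all add: star_alg alg.st_add alg.st_mult star_scalar w_def a_def bb_def\<close>)
    then show ?thesis unfolding p_def by (rule h_unitary[OF w[OF t]])
  qed
  have pb: "b (p t x) (p t y) = b x y" if t: "t \<in> ?T" for t x y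
  proof -
    have "(1 + twist (star n (w t))) * (1 + w t) = 1"
      by (rule interpolation_isometry[where n = n and st = "\<lambda>a. twist (star n a)" and v = v and z = "z t" and p = "(1 + t) / 2"])
        (use v z(1,2)[OF t] in \<open>simp_all add: twist_alg star_alg alg.st_add twist_add twist_star w_def a_def bb_def\<close>)
    then show ?thesis unfolding p_def b_product[OF w[OF t]] by simp
  qed
  have diff: "nrm n (w t - w t') \<le> 10 * \<bar>t - t'\<bar>" if t: "t \<in> ?T" "t' \<in> ?T" for t t'
  proof -
    have half: "a t - a t' = scalar (of_real ((t - t') / 2)) * v" "bb t' - bb t = scalar (of_real ((t - t') / 2)) * v"
      unfolding a_def bb_def by (rule endo_eqI; simp flip: scale_left_diff_distrib add: field_simps)+
    have N1: "nrm n (scalar (of_real ((t - t') / 2)) * v) \<le> \<bar>t - t'\<bar>"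
    proof -
      have "nrm n (scalar (of_real ((t - t') / 2)) * v) = \<bar>(t - t') / 2\<bar> * nrm n v" unfolding nrm_scalar norm_of_real ..
      also have "\<dots> \<le> \<bar>t - t'\<bar> * 1" using small nrm_nonneg by (intro mult_mono) auto
      finally show ?thesis by simp
    qed
    let ?d = "scalar (of_real ((t - t') / 2)) * v"
    have dA: "?d \<in> alg n" by (rule scalar_alg[OF v(1)])
    have mul: "nrm n (x + x * y) \<le> 2 * nrm n x" "nrm n (x + y * x) \<le> 2 * nrm n x"
      if "x \<in> alg n" "y \<in> alg n" "nrm n y \<le> 1" for x y
    proof -
      have "nrm n x * nrm n y \<le> nrm n x" "nrm n y * nrm n x \<le> nrm n x"
        using that(3) nrm_nonneg[of n x] by (simp_all add: mult_left_le mult_left_le_one_le nrm_nonneg)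
      then show "nrm n (x + x * y) \<le> 2 * nrm n x" "nrm n (x + y * x) \<le> 2 * nrm n x"
        using alg.N_add[of n x "x * y"] alg.N_add[of n x "y * x"] alg.N_mult[OF that(1,2)] alg.N_mult[OF that(2,1)] by linarith+
    qed
    \<comment> \<open>The resolvent identity: a difference of inverses is the product of one
      inverse, the difference of the elements and the other inverse.\<close>
    have zz: "z t - z t' = (?d + z t * ?d) + (?d + z t * ?d) * z t'"
    proof -
      have "z t - z t' = (1 + z t) * ((1 + bb t') * (1 + z t')) - ((1 + z t) * (1 + bb t)) * (1 + z t')"
        using z(2)[OF t(2)] z(3)[OF t(1)] by simp
      also have "\<dots> = (1 + z t) * (bb t' - bb t) * (1 + z t')" by (simp add: algebra_simps)
      finally show ?thesis unfolding half by (simp add: algebra_simps)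
    qed
    have zA: "z t \<in> alg n" "z t' \<in> alg n" "nrm n (z t) \<le> 1" "nrm n (z t') \<le> 1"
      using z(1) t Nz[OF t(1)] Nz[OF t(2)] by auto
    have "nrm n (z t - z t') \<le> 2 * (2 * nrm n ?d)"
      unfolding zz using mul(1)[of "?d + z t * ?d" "z t'"] mul(2)[OF dA zA(1,3)] zA dA
      by (smt (verit) alg.A_add alg.A_mult)
    then have Nzz: "nrm n (z t - z t') \<le> 4 * \<bar>t - t'\<bar>" using N1 by simp
    have "w t - w t' = (?d + ?d * z t) + ((z t - z t') + a t' * (z t - z t'))"
      unfolding w_def half(1)[symmetric] by (simp add: algebra_simps)
    then have "nrm n (w t - w t') \<le> nrm n (?d + ?d * z t) + nrm n ((z t - z t') + a t' * (z t - z t'))"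
      using alg.N_add by simp
    also have "\<dots> \<le> 2 * nrm n ?d + 2 * nrm n (z t - z t')"
      using mul(1)[OF dA zA(1,3)] mul(2)[OF alg.A_diff[OF zA(1,2)] A(1)[of t']] Na(1)[OF t(2)] by simp
    finally show ?thesis using N1 Nzz by simp
  qed
  have cont: "continuous_on ?T (\<lambda>t. mat_entries D (p t) i j)" for i j
    unfolding continuous_on_iff
  proof (intro ballI allI impI)
    fix t r assume t: "t \<in> ?T" and r: "0 < (r::real)"
    have "dist (mat_entries D (p t') i j) (mat_entries D (p t) i j) < r" if "t' \<in> ?T" "dist t' t < r / 10" for t'
      using mat_entries_alg_diff[OF w[OF that(1)] w[OF t], of i j] diff[OF that(1) t] that(2)
      unfolding p_def dist_norm by simp
    then show "\<exists>d>0. \<forall>t'\<in>?T. dist t' t < d \<longrightarrow> dist (mat_entries D (p t') i j) (mat_entries D (p t) i j) < r"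
      using r by (intro exI[of _ "r / 10"]) auto
  qed
  have p0: "p 0 = id"
  proof -
    have "a 0 = bb 0" by (simp add: a_def bb_def)
    then have "1 + w 0 = 1" using w1[of 0] z(2)[of 0] by simp
    then show ?thesis by (simp add: p_def fun_eq_iff)
  qed
  have p1: "p 1 = app (1 + v)"
  proof -
    have "bb 1 = 0" by (rule endo_eqI) (simp add: bb_def)
    then have "1 + z 1 = 1" using z(2)[of 1] by simp
    moreover have "a 1 = v" by (rule endo_eqI) (simp add: a_def)
    ultimately show ?thesis using w1[of 1] by (simp add: p_def)
  qed
  let ?det = "\<lambda>t. det_on (S n) (mat_entries D (p t))"
  have "continuous_on ?T ?det" by (intro continuous_on_det_on cont)
  moreover have "?det ` ?T \<subseteq> {1, - 1}"
  proof
    fix y assume "y \<in> ?det ` ?T"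
    then obtain t where "t \<in> ?T" "y = ?det t" by blast
    then have "y * y = 1" using det_isometry[OF GL pb] by blast
    then show "y \<in> {1, - 1}" by (simp add: square_eq_1_iff)
  qed
  then have "finite (?det ` ?T)" by (rule finite_subset) simp
  ultimately have "?det constant_on ?T" by (intro continuous_finite_range_constant) auto
  then have det: "?det t = 1" if "t \<in> ?T" for t
    using that det_id[of n] p0 unfolding constant_on_def by (metis atLeastAtMost_iff order_refl zero_le_one)
  have pH: "p t \<in> h_preserving_level D n" if "t \<in> ?T" for t
    unfolding H_iff G_level_iff using GL ph pb det that by blast
  have "continuous_map (top_of_set ?T) HT p"
    unfolding continuous_map
  proof (intro conjI allI impI)
    show "p ` topspace (top_of_set ?T) \<subseteq> topspace HT"
    proof
      fix g assume "g \<in> p ` topspace (top_of_set ?T)"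
      then obtain t where "t \<in> ?T" "g = p t" by auto
      then have "g \<in> h_preserving_level D n" using pH by blast
      then show "g \<in> topspace HT" unfolding topspace_group_topology by blast
    qed
    fix U assume "openin HT U"
    then obtain W where W: "open W" "U \<inter> h_preserving_level D n = {g \<in> h_preserving_level D n. mat_entries D g \<in> W}"
      unfolding openin_group_topology openin_level_topology by blast
    have "continuous_on ?T (\<lambda>t. mat_entries D (p t))"
      by (intro continuous_on_coordinatewise_then_product cont)
    then have "openin (top_of_set ?T) (?T \<inter> (\<lambda>t. mat_entries D (p t)) -` W)"
      using W(1) by (rule continuous_openin_preimage_gen)
    moreover have "{t \<in> topspace (top_of_set ?T). p t \<in> U} = ?T \<inter> (\<lambda>t. mat_entries D (p t)) -` W"
    proof -
      have "p t \<in> U \<longleftrightarrow> mat_entries D (p t) \<in> W" if "t \<in> ?T" for t using pH[OF that] W(2) by blast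
      then show ?thesis by auto
    qed
    ultimately show "openin (top_of_set ?T) {t \<in> topspace (top_of_set ?T). p t \<in> U}" by simp
  qed
  moreover have "connectedin (top_of_set ?T) ?T" by (simp add: connectedin_subtopology)
  ultimately have "connectedin HT (p ` ?T)" by (rule connectedin_continuous_map_image)
  moreover have "id \<in> p ` ?T" "app (1 + v) \<in> p ` ?T"
    using p0 p1 by (metis atLeastAtMost_iff imageI order_refl zero_le_one)+
  ultimately have "connected_component_of HT id (app (1 + v))" unfolding connected_component_of_def by blast
  then show ?thesis using pH[of 1] p1 by (auto simp: G0_def)
qed

end

section \<open>Nondegenerate flags have open orbits\<close>

text \<open>The smallest element Z is put in front, so that the projection of index 0 will be 0.
  Repetitions are allowed; they only produce empty blocks.\<close>

lemma finite_chain_enumeration: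
  assumes "finite C" "\<And>X Y. X \<in> C \<Longrightarrow> Y \<in> C \<Longrightarrow> X \<subseteq> Y \<or> Y \<subseteq> X" "\<And>X. X \<in> C \<Longrightarrow> Z \<subseteq> X"
  shows "\<exists>(m::nat) Y. Y 0 = Z \<and> (\<forall>i j. i \<le> j \<longrightarrow> j \<le> m \<longrightarrow> Y i \<subseteq> Y j) \<and> C \<subseteq> Y ` {..m} \<and> Y ` {..m} \<subseteq> insert Z C"
  using assms
proof (induction C rule: finite_psubset_induct)
  case (psubset C)
  show ?case
  proof (cases "C = {}")
    case True
    then show ?thesis by (intro exI[of _ 0] exI[of _ "\<lambda>_. Z"]) auto
  next
    case False
    then obtain M where M: "M \<in> C" "\<And>X. X \<in> C \<Longrightarrow> M \<subseteq> X \<Longrightarrow> M = X"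
      using finite_has_maximal[OF psubset.hyps] by metis
    have top: "X \<subseteq> M" if "X \<in> C" for X using M psubset.prems(1)[OF that M(1)] that by blast
    have "C - {M} \<subset> C" using M by blast
    then have "\<exists>(m::nat) Y. Y 0 = Z \<and> (\<forall>i j. i \<le> j \<longrightarrow> j \<le> m \<longrightarrow> Y i \<subseteq> Y j) \<and>
        C - {M} \<subseteq> Y ` {..m} \<and> Y ` {..m} \<subseteq> insert Z (C - {M})"
      by (rule psubset.IH) (use psubset.prems in blast)+
    then obtain m :: nat and Y where Y': "Y 0 = Z" "\<forall>i j. i \<le> j \<longrightarrow> j \<le> m \<longrightarrow> Y i \<subseteq> Y j"
      "C - {M} \<subseteq> Y ` {..m}" "Y ` {..m} \<subseteq> insert Z (C - {M})"
      by (elim exE conjE) (rule that, assumption+)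
    note Y = Y'(1) Y'(2)[rule_format] Y'(3,4)
    define Y1 where "Y1 = Y(Suc m := M)"
    have le: "Y i \<subseteq> M" if "i \<le> m" for i using Y(4) that top psubset.prems(2)[OF M(1)] by blast
    show ?thesis
    proof (intro exI[of _ "Suc m"] exI[of _ Y1] conjI allI impI)
      show "Y1 0 = Z" using Y(1) by (simp add: Y1_def)
      show "Y1 i \<subseteq> Y1 j" if "i \<le> j" "j \<le> Suc m" for i j
        using that Y(2)[of i j] le[of i] by (auto simp: Y1_def le_Suc_eq)
      have im: "Y1 ` {..Suc m} = insert M (Y ` {..m})"
        unfolding atMost_Suc image_insert by (auto simp: Y1_def image_iff)
      show "C \<subseteq> Y1 ` {..Suc m}" unfolding im using Y(3) by blast
      show "Y1 ` {..Suc m} \<subseteq> insert Z C" unfolding im using Y(4) M(1) by blast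
    qed
  qed
qed

context flag_space begin

lemma projections:
  fixes m :: nat
  assumes Ym: "\<forall>i\<le>m. subspace (Y i) \<and> Y i \<subseteq> V n \<and> nondegenerate_on h (Y i)"
    and mono': "\<forall>i j. i \<le> j \<longrightarrow> j \<le> m \<longrightarrow> Y i \<subseteq> Y j"
  shows "\<exists>P. (\<forall>i\<le>m. P i \<in> alg n \<and> star n (P i) = P i \<and> (\<forall>x. app (P i) x \<in> Y i) \<and> (\<forall>x\<in>Y i. app (P i) x = x)) \<and>
    (\<forall>j\<le>m. \<forall>i\<le>j. P i * P j = P i \<and> P j * P i = P i)"
proof -
  have Y: "subspace (Y i)" "Y i \<subseteq> V n" "nondegenerate_on h (Y i)" if "i \<le> m" for i
    using Ym that by blast+
  note mono = mono'[rule_format]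
  have "\<forall>i\<in>{..m}. \<exists>P. P \<in> alg n \<and> star n P = P \<and> (\<forall>x. app P x \<in> Y i) \<and> (\<forall>x\<in>Y i. app P x = x)"
    using exists_projection Y by (metis atMost_iff)
  then obtain P where P: "\<And>i. i \<le> m \<Longrightarrow> P i \<in> alg n" "\<And>i. i \<le> m \<Longrightarrow> star n (P i) = P i"
    "\<And>i x. i \<le> m \<Longrightarrow> app (P i) x \<in> Y i" "\<And>i x. i \<le> m \<Longrightarrow> x \<in> Y i \<Longrightarrow> app (P i) x = x"
    by (metis atMost_iff)
  have PP: "P j * P i = P i" if "i \<le> j" "j \<le> m" for i j
  proof (rule endo_eqI)
    fix x
    have "i \<le> m" using that by simp
    then show "app (P j * P i) x = app (P i) x"
      using P(3)[of i x] P(4)[OF that(2)] mono[OF that] by auto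
  qed
  have PP': "P i * P j = P i" if "i \<le> j" "j \<le> m" for i j
  proof -
    have "star n (P j * P i) = star n (P i)" using PP[OF that] by simp
    then show ?thesis using P(1,2) that by (simp add: alg.st_mult)
  qed
  show ?thesis using P PP PP' by (intro exI[of _ P]) simp
qed

definition level_id :: "nat \<Rightarrow> 'v endo" where
  "level_id n = (SOME P. P \<in> alg n \<and> star n P = P \<and> (\<forall>x. app P x \<in> V n) \<and> (\<forall>x\<in>V n. app P x = x))"

lemma level_id: "level_id n \<in> alg n" "star n (level_id n) = level_id n" "x \<in> V n \<Longrightarrow> app (level_id n) x = x"
proof -
  have "\<exists>P. P \<in> alg n \<and> star n P = P \<and> (\<forall>x. app P x \<in> V n) \<and> (\<forall>x\<in>V n. app P x = x)"
    using exists_projection[OF V_subspace subset_refl nondeg_h[of n]] by blast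
  from someI_ex[OF this] show "level_id n \<in> alg n" "star n (level_id n) = level_id n" "x \<in> V n \<Longrightarrow> app (level_id n) x = x"
    unfolding level_id_def[symmetric] by blast+
qed

lemma level_id_unit:
  assumes a: "a \<in> alg n" shows "level_id n * a = a" "a * level_id n = a"
proof -
  have l: "level_id n * c = c" if "c \<in> alg n" for c
    using level_id(3) algD(2)[OF that] by (intro endo_eqI) simp
  show "level_id n * a = a" using l[OF a] .
  have "star n (level_id n * star n a) = star n (star n a)" using l[OF star_alg[OF a]] by simp
  then show "a * level_id n = a" using a by (simp add: alg.st_mult level_id star_alg alg.st_st)
qed

lemma same_range_image:
  assumes PC: "projection_chain (alg n) (nrm n) (star n) (scalar (1 / 2)) P m"
    and sr: "projection_chain.same_range P m u k" and i: "i \<le> m"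
    and Y: "\<And>x. app (P i) x \<in> Y" "\<And>x. x \<in> Y \<Longrightarrow> app (P i) x = x"
  shows "app (1 + u) ` Y = app (1 + k) ` Y"
proof -
  interpret projection_chain "alg n" "nrm n" "star n" "scalar (1 / 2)" P m by (rule PC)
  obtain s t where st: "(1 + u) * P i = (1 + k) * P i * s" "(1 + k) * P i = (1 + u) * P i * t"
    using sr i unfolding same_range_def by blast
  have sub: "app u' ` Y \<subseteq> app k' ` Y" if eq: "u' * P i = k' * P i * s" for u' k' s :: "'v endo"
  proof
    fix y assume "y \<in> app u' ` Y"
    then obtain x where x: "x \<in> Y" "y = app u' x" by blast
    then have "y = app (u' * P i) x" using Y(2) by simp
    also have "\<dots> = app k' (app (P i) (app s x))" unfolding eq by simp
    finally show "y \<in> app k' ` Y" using Y(1) by blast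
  qed
  show ?thesis using sub[OF st(1)] sub[OF st(2)] by blast
qed

end

context flag_setting_chain begin

lemma act_eqI:
  assumes g: "g \<in> GL_level n" "u \<in> GL_level n" "k \<in> GL_level n"
    and eq: "\<And>X. X \<in> F \<Longrightarrow> X \<noteq> UNIV \<Longrightarrow> u ` (g ` X \<inter> V n) = k ` (g ` X \<inter> V n)"
  shows "act u (act g F) = act k (act g F)"
proof -
  have "u ` g ` X = k ` g ` X" if X: "X \<in> F" for X
  proof (cases "X = UNIV")
    case True
    then show ?thesis using GL_bij g by (metis bij_def)
  next
    case False
    obtain A where A: "A \<subseteq> I" "X = span (e ` A)" using F_span[OF X] by metis
    have "u ` g ` (X \<inter> V n) = k ` g ` (X \<inter> V n)"
      using eq[OF X False] unfolding GL_image_Int_V[OF g(1), of X] .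
    then have "(u \<circ> g) ` (X \<inter> V n) = (k \<circ> g) ` (X \<inter> V n)" by (simp only: image_comp)
    then have "(u \<circ> g) ` X = (k \<circ> g) ` X"
      unfolding A(2) by (intro GL_image_eqI[OF A(1) GL_comp[OF g(2,1)] GL_comp[OF g(3,1)]])
    then show ?thesis by (simp only: image_comp)
  qed
  then show ?thesis by (simp add: act_def image_image)
qed

text \<open>The image of X is spanned by its part in V_n and basis vectors outside V_n. The latter
  are orthogonal to V_n, so a radical vector of the level part is radical for the whole
  image.\<close>

lemma level_part:
  assumes g: "g \<in> GL_level n" and X: "X \<in> F" and nd: "nondegenerate_on h (g ` X)"
  shows "subspace (g ` X \<inter> V n)" "nondegenerate_on h (g ` X \<inter> V n)"
proof -
  obtain A where A: "A \<subseteq> I" "X = span (e ` A)" using F_span[OF X] by metis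
  show "subspace (g ` X \<inter> V n)"
    using subspace_GL_image[OF g, of X] V_subspace A(2) by (simp add: subspace_inter)
  show "nondegenerate_on h (g ` X \<inter> V n)"
    unfolding nondegenerate_on_def
  proof (intro ballI impI)
    fix r assume r: "r \<in> g ` X \<inter> V n" "\<forall>y\<in>g ` X \<inter> V n. h r y = 0"
    have "h r y = 0" if y: "y \<in> g ` X" for y
    proof -
      obtain y1 z where yz: "y = y1 + z" "y1 \<in> g ` X \<inter> V n" "z \<in> span (e ` (A - S n))"
        using image_span_split[OF A(1) g, of y] y A(2) by blast
      have "h r z = 0" using h_V_span_outside[OF _ _ yz(3), of r n] r(1) A(1) by blast
      then show ?thesis using r(2) yz by (simp add: h_add_right)
    qed
    then show "r = 0" using nd r(1) unfolding nondegenerate_on_def by blast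
  qed
qed

text \<open>F may be infinite, but the parts in V_n are images of spans of subsets of the finite set
  \<open>S n\<close>.\<close>

lemma finite_level_parts: "finite ((\<lambda>X. g ` X \<inter> V n) ` F)" if g: "g \<in> GL_level n"
proof (rule finite_subset)
  show "(\<lambda>X. g ` X \<inter> V n) ` F \<subseteq> (\<lambda>B. g ` span (e ` B)) ` Pow (S n)"
  proof
    fix Y assume "Y \<in> (\<lambda>X. g ` X \<inter> V n) ` F"
    then obtain X where X: "X \<in> F" "Y = g ` X \<inter> V n" by blast
    obtain A where A: "A \<subseteq> I" "X = span (e ` A)" using F_span[OF X(1)] by metis
    have "Y = g ` span (e ` (A \<inter> S n))"
      using X(2) GL_image_Int_V[OF g, of X] span_Int[OF A(1) S_sub, of n] by (simp add: A(2) V_level_def)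
    then show "Y \<in> (\<lambda>B. g ` span (e ` B)) ` Pow (S n)" by blast
  qed
  show "finite ((\<lambda>B. g ` span (e ` B)) ` Pow (S n))" using S_finite by simp
qed

text \<open>The isometry u1 obtained from the chain has a determinant of modulus 1 only. Composition
  with \<open>level_scale\<close> corrects it to 1, and it neither destroys invariance of h nor
  moves subspaces of V_n.\<close>

lemma small_move_SU:
  assumes SU: "is_SU (form D)" and g: "g \<in> G_level D n" and nd: "nondegenerate_flag D (act g F)"
  shows "\<exists>d>0. \<forall>k\<in>G_level D n. nrm n (Endo k - 1) \<le> d \<longrightarrow> (\<exists>u\<in>G0 D. act u (act g F) = act k (act g F))"
proof -
  have gGL: "g \<in> GL_level n" using G_level_GL[OF g] .
  have ndX: "nondegenerate_on h (g ` X)" if "X \<in> F" for X using nd that by (auto simp: nondegenerate_flag_def act_def)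
  \<comment> \<open>V_n is added as the largest member, so that the last projection is the unit of
    \<open>alg n\<close>.\<close>
  let ?C = "insert (V n) ((\<lambda>X. g ` X \<inter> V n) ` F)"
  have C: "subspace Y" "nondegenerate_on h Y" "Y \<subseteq> V n" if "Y \<in> ?C" for Y
    using that level_part[OF gGL _ ndX] V_subspace nondeg_h by auto
  have "\<exists>(m::nat) Y. Y 0 = {0} \<and> (\<forall>i j. i \<le> j \<longrightarrow> j \<le> m \<longrightarrow> Y i \<subseteq> Y j) \<and> ?C \<subseteq> Y ` {..m} \<and> Y ` {..m} \<subseteq> insert {0} ?C"
  proof (rule finite_chain_enumeration)
    show "finite ?C" using finite_level_parts[OF gGL] by simp
    show "X \<subseteq> Y \<or> Y \<subseteq> X" if XY: "X \<in> ?C" "Y \<in> ?C" for X Y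
    proof (cases "X = V n \<or> Y = V n")
      case True
      then show ?thesis using C(3)[OF XY(1)] C(3)[OF XY(2)] by auto
    next
      case False
      then obtain A B where "A \<in> F" "B \<in> F" "X = g ` A \<inter> V n" "Y = g ` B \<inter> V n" using XY by blast
      then show ?thesis using F_chain[of A B] by blast
    qed
    show "{0} \<subseteq> X" if "X \<in> ?C" for X using subspace_0[OF C(1)[OF that]] by blast
  qed
  then obtain m :: nat and Y where Y': "Y 0 = {0}" "\<forall>i j. i \<le> j \<longrightarrow> j \<le> m \<longrightarrow> Y i \<subseteq> Y j"
    "?C \<subseteq> Y ` {..m}" "Y ` {..m} \<subseteq> insert {0} ?C"
    by (elim exE conjE) (rule that, assumption+)
  note Y = Y'(1) Y'(2)[rule_format] Y'(3,4)
  have zero: "subspace {0}" "nondegenerate_on h {0}" "{0} \<subseteq> V n"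
    by (auto simp: nondegenerate_on_def subspace_0[OF V_subspace])
  have Yi: "subspace (Y i)" "nondegenerate_on h (Y i)" "Y i \<subseteq> V n" if "i \<le> m" for i
  proof -
    have "Y i \<in> Y ` {..m}" using that by simp
    then have Yi: "Y i = {0} \<or> Y i \<in> ?C" using Y(4) by blast
    show "subspace (Y i)" using Yi zero(1) C(1)[of "Y i"] by metis
    show "nondegenerate_on h (Y i)" using Yi zero(2) C(2)[of "Y i"] by metis
    show "Y i \<subseteq> V n" using Yi zero(3) C(3)[of "Y i"] by metis
  qed
  have Ym: "Y m = V n"
  proof -
    have "V n \<in> Y ` {..m}" using Y(3) by blast
    then obtain j where "j \<le> m" "Y j = V n" by auto
    then show ?thesis using Y(2)[of j m] Yi(3)[of m] by auto
  qed
  have Yall: "\<forall>i\<le>m. subspace (Y i) \<and> Y i \<subseteq> V n \<and> nondegenerate_on h (Y i)" using Yi by simp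
  obtain P where P': "\<forall>i\<le>m. P i \<in> alg n \<and> star n (P i) = P i \<and> (\<forall>x. app (P i) x \<in> Y i) \<and> (\<forall>x\<in>Y i. app (P i) x = x)"
    "\<forall>j\<le>m. \<forall>i\<le>j. P i * P j = P i \<and> P j * P i = P i"
    using projections[OF Yall Y'(2)] by (elim exE conjE) (rule that, assumption+)
  have P: "\<And>i. i \<le> m \<Longrightarrow> P i \<in> alg n" "\<And>i. i \<le> m \<Longrightarrow> star n (P i) = P i"
    "\<And>i x. i \<le> m \<Longrightarrow> app (P i) x \<in> Y i" "\<And>i x. i \<le> m \<Longrightarrow> x \<in> Y i \<Longrightarrow> app (P i) x = x"
    "\<And>i j. i \<le> j \<Longrightarrow> j \<le> m \<Longrightarrow> P i * P j = P i" "\<And>i j. i \<le> j \<Longrightarrow> j \<le> m \<Longrightarrow> P j * P i = P i"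
    using P' by simp_all
  have Pm: "P m * a = a" "a * P m = a" if "a \<in> alg n" for a
  proof -
    have l: "P m * c = c" if "c \<in> alg n" for c
      using P(4)[of m] algD(2)[OF that] Ym by (intro endo_eqI) simp
    show "P m * a = a" using l[OF that] .
    have "star n (P m * star n a) = star n (star n a)" using l[OF star_alg[OF that]] by simp
    then show "a * P m = a" using that P(1,2)[of m] by (simp add: alg.st_mult star_alg alg.st_st)
  qed
  have P0: "P 0 = 0" using P(3)[of 0] Y(1) by (intro endo_eqI) simp
  interpret PC: projection_chain "alg n" "nrm n" "star n" "scalar (1 / 2)" P m
    by unfold_locales (use P Pm P0 in auto)
  obtain d where d: "0 < d" "\<And>k. k \<in> alg n \<Longrightarrow> nrm n k \<le> d \<Longrightarrow>
      \<exists>u\<in>alg n. nrm n u < 1 / 2 \<and> (1 + star n u) * (1 + u) = 1 \<and> PC.same_range u k"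
    using PC.unitary_same_range[of "1 / 2"] by auto
  show ?thesis
  proof (intro exI[of _ d] conjI ballI impI d(1))
    fix k assume k: "k \<in> G_level D n" "nrm n (Endo k - 1) \<le> d"
    have kGL: "k \<in> GL_level n" using G_level_GL[OF k(1)] .
    obtain u0 where u0: "u0 \<in> alg n" "nrm n u0 < 1 / 2" "(1 + star n u0) * (1 + u0) = 1"
      "PC.same_range u0 (Endo k - 1)"
      using d(2)[OF endo_GL(1)[OF kGL] k(2)] by blast
    define u1 where "u1 = app (1 + u0)"
    have u1: "u1 \<in> GL_level n" "h (u1 x) (u1 y) = h x y" for x y
      unfolding u1_def using alg_small_GL[OF u0(1)] u0(2) h_unitary[OF u0(1,3)] by simp_all
    obtain c where c: "cmod c = 1" "det_on (S n) (mat_entries D (level_scale n c \<circ> u1)) = 1"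
      using unitary_det_adjust[OF u1] by metis
    define u where "u = level_scale n c \<circ> u1"
    have c0: "c \<noteq> 0" using c(1) by auto
    have uGL: "u \<in> GL_level n" unfolding u_def by (intro GL_comp level_scale_GL c0 u1(1))
    have "h (u x) (u y) = h x y" for x y unfolding u_def by (simp add: level_scale_h[OF c(1)] u1)
    then have "u \<in> h_preserving_level D n"
      using uGL c(2) SU by (simp add: H_iff G_level_iff u_def)
    moreover have "\<not> is_SO (form D)" using SU by (cases "form D") auto
    ultimately have "u \<in> G0 D" by (auto simp: G0_def)
    moreover have "act u (act g F) = act k (act g F)"
    proof (rule act_eqI[OF gGL uGL kGL])
      fix X assume X: "X \<in> F"
      let ?Y = "g ` X \<inter> V n"
      have "?Y \<in> Y ` {..m}" using Y(3) X by blast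
      then obtain i where i: "i \<le> m" "Y i = ?Y" by (auto simp: image_iff)
      have u1k: "u1 ` ?Y = k ` ?Y"
        using same_range_image[OF PC.projection_chain_axioms u0(4) i(1), of ?Y] P(3,4)[OF i(1)] i(2)
          endo_GL(2)[OF kGL] by (simp add: u1_def)
      have sub: "subspace (k ` ?Y)" using subspace_GL_image[OF kGL] level_part(1)[OF gGL X ndX[OF X]] by blast
      have kV: "k ` ?Y \<subseteq> V n" using GL_V_mem[OF kGL] by blast
      have "level_scale n c ` (k ` ?Y) = k ` ?Y"
      proof
        show "level_scale n c ` (k ` ?Y) \<subseteq> k ` ?Y"
        proof
          fix z assume "z \<in> level_scale n c ` (k ` ?Y)"
          then obtain y where y: "y \<in> k ` ?Y" "z = level_scale n c y" by blast
          then have "z = sc c y" using kV level_scale_V by blast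
          then show "z \<in> k ` ?Y" using subspace_scale[OF sub y(1)] by simp
        qed
        show "k ` ?Y \<subseteq> level_scale n c ` (k ` ?Y)"
        proof
          fix y assume y: "y \<in> k ` ?Y"
          have y': "sc (1 / c) y \<in> k ` ?Y" using subspace_scale[OF sub y] .
          have "level_scale n c (sc (1 / c) y) = sc c (sc (1 / c) y)" using y' kV by (intro level_scale_V) blast
          then have "y = level_scale n c (sc (1 / c) y)" using c0 by simp
          then show "y \<in> level_scale n c ` (k ` ?Y)" using y' by blast
        qed
      qed
      then have "level_scale n c ` u1 ` ?Y = k ` ?Y" using u1k by simp
      then show "u ` ?Y = k ` ?Y" by (simp only: u_def image_comp)
    qed
    ultimately show "\<exists>u\<in>G0 D. act u (act g F) = act k (act g F)" by blast
  qed
qed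

text \<open>Openness is checked at each g with gF in the orbit. That flag is again nondegenerate, as
  an isometry takes F1 to it, and elements of the level near g are kg with k near 1; so
  \<open>key\<close> at gF suffices.\<close>

lemma open_orbit:
  assumes key: "\<And>n g. g \<in> G_level D n \<Longrightarrow> nondegenerate_flag D (act g F) \<Longrightarrow>
      \<exists>d>0. \<forall>k\<in>G_level D n. nrm n (Endo k - 1) \<le> d \<longrightarrow> (\<exists>u\<in>G0 D. act u (act g F) = act k (act g F))"
    and F1: "F1 \<in> flag_manifold D F" "nondegenerate_flag D F1"
  shows "openin (flag_topology D F) (orbit (G0 D) F1)"
  unfolding openin_flag_topology
proof (intro conjI allI)
  obtain g1 m where g1: "g1 \<in> G_level D m" "F1 = act g1 F"
    using F1(1) by (auto simp: flag_manifold_def orbit_def G_def)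
  show "orbit (G0 D) F1 \<subseteq> flag_manifold D F"
  proof
    fix F2 assume "F2 \<in> orbit (G0 D) F1"
    then obtain u where u0: "u \<in> G0 D" "F2 = act u F1" by (auto simp: orbit_def)
    obtain l where "u \<in> h_preserving_level D l" using G0_level[OF u0(1)] by blast
    then have u: "u \<in> h_preserving_level D l" "F2 = act u F1" using u0(2) by auto
    have "u \<circ> g1 \<in> G_level D (max l m)"
      using G_level_mono[of l "max l m" u] G_level_mono[of m "max l m" g1] u(1) g1(1) by (intro G_level_comp) (auto simp: H_iff)
    then show "F2 \<in> flag_manifold D F"
      unfolding flag_manifold_def orbit_def G_def using u(2) g1(2) act_comp by (intro image_eqI[of _ _ "u \<circ> g1"]) auto
  qed
  fix n
  show "openin (level_topology D (G_level D n)) {g \<in> G_level D n. act g F \<in> orbit (G0 D) F1}"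
  proof (rule openin_level_topologyI)
    fix g assume "g \<in> {g \<in> G_level D n. act g F \<in> orbit (G0 D) F1}"
    then obtain u0 where g: "g \<in> G_level D n" and u0: "u0 \<in> G0 D" "act g F = act u0 F1"
      by (auto simp: orbit_def)
    obtain l where l: "u0 \<in> h_preserving_level D l" using G0_level[OF u0(1)] by blast
    have "nondegenerate_on h (u0 ` X)" if X: "nondegenerate_on h X" for X
      unfolding nondegenerate_on_def
    proof (intro ballI impI)
      fix r assume r: "r \<in> u0 ` X" "\<forall>y\<in>u0 ` X. h r y = 0"
      then obtain x where x: "x \<in> X" "r = u0 x" by blast
      have "h x y = 0" if "y \<in> X" for y using r(2) that x(2) l by (auto simp: H_iff)
      then have "x = 0" using X x(1) unfolding nondegenerate_on_def by blast
      then show "r = 0" using x(2) l linearD(3)[OF GL_linear[OF G_level_GL]] by (auto simp: H_iff)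
    qed
    then have nd: "nondegenerate_flag D (act g F)"
      using F1(2) unfolding u0(2) by (auto simp: nondegenerate_flag_def act_def)
    obtain d where d: "0 < d" "\<And>k. k \<in> G_level D n \<Longrightarrow> nrm n (Endo k - 1) \<le> d \<Longrightarrow>
        \<exists>u\<in>G0 D. act u (act g F) = act k (act g F)"
      using key[OF g nd] by blast
    obtain W where W: "open W" "mat_entries D g \<in> W"
      "\<And>g'. g' \<in> GL_level n \<Longrightarrow> mat_entries D g' \<in> W \<Longrightarrow> nrm n (Endo (g' \<circ> inv g) - 1) < d"
      using nbhd_quotient[OF G_level_GL[OF g] d(1)] by blast
    have "act g' F \<in> orbit (G0 D) F1" if g': "g' \<in> G_level D n" "mat_entries D g' \<in> W" for g'
    proof -
      have "g' \<circ> inv g \<in> G_level D n" by (rule G_level_comp[OF g'(1) G_level_inv[OF g]])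
      moreover have "nrm n (Endo (g' \<circ> inv g) - 1) \<le> d" using W(3)[OF G_level_GL[OF g'(1)] g'(2)] by simp
      ultimately obtain u where u: "u \<in> G0 D" "act u (act g F) = act (g' \<circ> inv g) (act g F)" using d(2) by blast
      have "inv g \<circ> g = id" using GL_bij[OF G_level_GL[OF g]] by (simp add: bij_def inj_iff)
      then have "act (g' \<circ> inv g) (act g F) = act g' F" by (simp add: act_comp[symmetric] comp_assoc)
      then have "act g' F = act (u \<circ> u0) F1" using u(2) u0(2) by (simp add: act_comp)
      then show ?thesis using G0_comp[OF u(1) u0(1)] by (auto simp: orbit_def)
    qed
    then show "\<exists>W. open W \<and> mat_entries D g \<in> W \<and> (\<forall>g'\<in>G_level D n. mat_entries D g' \<in> W \<longrightarrow>
        g' \<in> {g \<in> G_level D n. act g F \<in> orbit (G0 D) F1})"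
      using W(1,2) by blast
  qed blast
qed

end

context bilinear_flag begin

text \<open>\<open>sig\<close> is 1 or -1, so this holds for all additive maps. It gives
  \<open>twist (twist a) = a\<close> on the whole type, the form in which
  \<open>twisted_chain\<close> asks for it.\<close>

lemma app_sig: "app a (sc sig x) = sc sig (app a x)"
  by (cases "form D") (simp_all add: sig_def app_minus_right)

lemma twist_twist_endo: "twist (twist a) = a"
  by (rule endo_eqI) (simp add: app_twist s_simps app_sig)

lemma twist_level_id: "twist (level_id n) = level_id n"
proof -
  have "twist (level_id n) * level_id n = twist (level_id n * twist (level_id n))"
    by (simp add: twist_mult twist_twist[OF level_id(1)])
  also have "level_id n * twist (level_id n) = twist (level_id n)" by (rule level_id_unit(1)[OF twist_alg[OF level_id(1)]])
  also have "twist (twist (level_id n)) = level_id n" by (rule twist_twist[OF level_id(1)])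
  finally show ?thesis using level_id_unit(2)[OF twist_alg[OF level_id(1)], of n] by simp
qed

text \<open>The chain of level parts is continued by its b-orthogonal complements in V_n in reverse
  order. The result is stable under the duality, and the twisted factorization yields isometries of
  both forms, which lie in the identity component by the Cayley path.\<close>

lemma small_move:
  assumes g: "g \<in> G_level D n" and nd: "nondegenerate_flag D (act g F)"
  shows "\<exists>d>0. \<forall>k\<in>G_level D n. nrm n (Endo k - 1) \<le> d \<longrightarrow> (\<exists>u\<in>G0 D. act u (act g F) = act k (act g F))"
proof -
  have gGL: "g \<in> GL_level n" using G_level_GL[OF g] .
  have ndX: "nondegenerate_on h (g ` X)" if "X \<in> F" for X using nd that by (auto simp: nondegenerate_flag_def act_def)
  \<comment> \<open>Only proper members are b-isotropic; the full space is preserved by every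
    bijection.\<close>
  let ?C = "(\<lambda>X. g ` X \<inter> V n) ` (F - {UNIV})"
  have C: "subspace Y" "nondegenerate_on h Y" "Y \<subseteq> V n" if "Y \<in> ?C" for Y
    using that level_part[OF gGL _ ndX] by auto
  have Cb: "b x y = 0" if "Y \<in> ?C" "x \<in> Y" "y \<in> Y" for x y Y
    using that isotropic g not_SU by (auto simp: b_isotropic_def G_level_iff)
  have "\<exists>(m::nat) Y. Y 0 = {0} \<and> (\<forall>i j. i \<le> j \<longrightarrow> j \<le> m \<longrightarrow> Y i \<subseteq> Y j) \<and> ?C \<subseteq> Y ` {..m} \<and> Y ` {..m} \<subseteq> insert {0} ?C"
  proof (rule finite_chain_enumeration)
    show "finite ?C" by (rule finite_subset[OF _ finite_level_parts[OF gGL]]) blast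
    show "X \<subseteq> Y \<or> Y \<subseteq> X" if XY: "X \<in> ?C" "Y \<in> ?C" for X Y
    proof -
      obtain A B where "A \<in> F" "B \<in> F" "X = g ` A \<inter> V n" "Y = g ` B \<inter> V n" using XY by blast
      then show ?thesis using F_chain[of A B] by blast
    qed
    show "{0} \<subseteq> X" if "X \<in> ?C" for X using subspace_0[OF C(1)[OF that]] by blast
  qed
  then obtain m :: nat and Y where Y': "Y 0 = {0}" "\<forall>i j. i \<le> j \<longrightarrow> j \<le> m \<longrightarrow> Y i \<subseteq> Y j"
    "?C \<subseteq> Y ` {..m}" "Y ` {..m} \<subseteq> insert {0} ?C"
    by (elim exE conjE) (rule that, assumption+)
  note Y = Y'(1) Y'(2)[rule_format] Y'(3,4)
  have zero: "subspace {0}" "nondegenerate_on h {0}" "{0} \<subseteq> V n"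
    by (auto simp: nondegenerate_on_def subspace_0[OF V_subspace])
  have Yi: "subspace (Y i)" "nondegenerate_on h (Y i)" "Y i \<subseteq> V n" if "i \<le> m" for i
  proof -
    have "Y i \<in> Y ` {..m}" using that by simp
    then have Yi: "Y i = {0} \<or> Y i \<in> ?C" using Y(4) by blast
    show "subspace (Y i)" using Yi zero(1) C(1)[of "Y i"] by metis
    show "nondegenerate_on h (Y i)" using Yi zero(2) C(2)[of "Y i"] by metis
    show "Y i \<subseteq> V n" using Yi zero(3) C(3)[of "Y i"] by metis
  qed
  have Yb: "b x y = 0" if "i \<le> m" "x \<in> Y i" "y \<in> Y i" for i x y
  proof -
    have "Y i \<in> Y ` {..m}" using that by simp
    then consider "Y i = {0}" | "Y i \<in> ?C" using Y(4) by blast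
    then show ?thesis
    proof cases
      case 1
      then show ?thesis using that by simp
    next
      case 2
      then show ?thesis using Cb that(2,3) by blast
    qed
  qed
  have Yall: "\<forall>i\<le>m. subspace (Y i) \<and> Y i \<subseteq> V n \<and> nondegenerate_on h (Y i)" using Yi by simp
  obtain P0 where P': "\<forall>i\<le>m. P0 i \<in> alg n \<and> star n (P0 i) = P0 i \<and> (\<forall>x. app (P0 i) x \<in> Y i) \<and> (\<forall>x\<in>Y i. app (P0 i) x = x)"
    "\<forall>j\<le>m. \<forall>i\<le>j. P0 i * P0 j = P0 i \<and> P0 j * P0 i = P0 i"
    using projections[OF Yall Y'(2)] by (elim exE conjE) (rule that, assumption+)
  have P: "\<And>i. i \<le> m \<Longrightarrow> P0 i \<in> alg n" "\<And>i. i \<le> m \<Longrightarrow> star n (P0 i) = P0 i"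
    "\<And>i x. i \<le> m \<Longrightarrow> app (P0 i) x \<in> Y i" "\<And>i x. i \<le> m \<Longrightarrow> x \<in> Y i \<Longrightarrow> app (P0 i) x = x"
    "\<And>i j. i \<le> j \<Longrightarrow> j \<le> m \<Longrightarrow> P0 i * P0 j = P0 i" "\<And>i j. i \<le> j \<Longrightarrow> j \<le> m \<Longrightarrow> P0 j * P0 i = P0 i"
    using P' by simp_all
  have P00: "P0 0 = 0" using P(3)[of 0] Y(1) by (intro endo_eqI) simp
  let ?M = "2 * m + 1" and ?e = "level_id n"
  define T where "T i = twist (P0 i)" for i
  have T: "T i \<in> alg n" "star n (T i) = T i" if "i \<le> m" for i
    using P(1,2)[OF that] by (simp_all add: T_def twist_alg star_twist)
  have TT: "T i * T j = T i" "T j * T i = T i" if "i \<le> j" "j \<le> m" for i j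
    using P(5,6)[OF that] by (simp_all add: T_def twist_mult[symmetric])
  \<comment> \<open>\<open>T j\<close> projects to the image of \<open>Y j\<close> under \<sigma>.
    Isotropy makes it orthogonal to \<open>Y i\<close>, since both lie below the larger of the two
    members.\<close>
  have cross: "P0 i * T j = 0" "T j * P0 i = 0" if ij: "i \<le> m" "j \<le> m" for i j
  proof -
    have orth: "h (s u) v = 0" if "u \<in> Y j" "v \<in> Y i" for u v
    proof -
      have "u \<in> Y (max i j)" "v \<in> Y (max i j)" using that ij Y(2)[of i "max i j"] Y(2)[of j "max i j"] by auto
      then have "b v u = 0" using Yb[of "max i j"] ij by auto
      then have "h v (s u) = 0" by (simp add: b_eq)
      then show ?thesis using h_sym_0 by blast
    qed
    show "P0 i * T j = 0"
    proof (rule endo_eqI)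
      fix x
      have "h (app (P0 i * T j) x) y = 0" for y
      proof -
        have "h (app (P0 i * T j) x) y = h (app (T j) x) (app (P0 i) y)"
          using h_star[OF P(1)[OF ij(1)], of "app (T j) x" y] P(2)[OF ij(1)] by simp
        also have "\<dots> = 0" unfolding T_def app_twist by (rule orth[OF P(3)[OF ij(2)] P(3)[OF ij(1)]])
        finally show ?thesis .
      qed
      then show "app (P0 i * T j) x = app 0 x" using h_nondeg by simp
    qed
    then have "star n (P0 i * T j) = 0" using alg.st_zero by simp
    then show "T j * P0 i = 0" using P(1,2)[OF ij(1)] T[OF ij(2)] by (simp add: alg.st_mult)
  qed
  \<comment> \<open>\<open>?e - T j\<close> projects to the b-orthogonal complement of
    \<open>Y j\<close> in V_n. The indices 0 to \<open>?M\<close> = 2 m + 1 hold the m + 1 members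
    followed by their m + 1 complements, and i \<mapsto> \<open>?M - i\<close> exchanges the two
    halves.\<close>
  define Q where "Q i = (if i \<le> m then P0 i else ?e - T (?M - i))" for i
  have unit: "?e * a = a" "a * ?e = a" if "a \<in> alg n" for a using level_id_unit[OF that] by blast+
  have ee: "?e * ?e = ?e" using unit level_id(1) by blast
  have QA: "Q i \<in> alg n" "star n (Q i) = Q i" for i
  proof -
    have "?M - i \<le> m" if "\<not> i \<le> m" using that by simp
    then show "Q i \<in> alg n" "star n (Q i) = Q i"
      using P(1,2)[of i] T[of "?M - i"] level_id by (auto simp: Q_def alg.A_diff alg.st_diff)
  qed
  have QQ: "Q i * Q j = Q i" "Q j * Q i = Q i" if ij: "i \<le> j" "j \<le> ?M" for i j
  proof -
    consider "j \<le> m" | "i \<le> m" "m < j" | "m < i" by linarith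
    then have "Q i * Q j = Q i \<and> Q j * Q i = Q i"
    proof cases
      case 1
      then show ?thesis using P(5,6) ij by (simp add: Q_def)
    next
      case 2
      then have "?M - j \<le> m" by simp
      then show ?thesis using 2 cross[of i "?M - j"] unit[OF P(1)[of i]]
        by (simp add: Q_def left_diff_distrib right_diff_distrib)
    next
      case 3
      then have a: "?M - j \<le> ?M - i" "?M - i \<le> m" "?M - j \<le> m" using ij by auto
      then show ?thesis using 3 ij TT[OF a(1,2)] unit[OF T(1)[OF a(2)]] unit[OF T(1)[OF a(3)]] ee
        by (simp add: Q_def left_diff_distrib right_diff_distrib)
    qed
    then show "Q i * Q j = Q i" "Q j * Q i = Q i" by auto
  qed
  have Q0: "Q 0 = 0" by (simp add: Q_def P00)
  have T0: "T 0 = 0" by (simp add: T_def P00 twist_def)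
  have QM: "Q ?M = ?e" by (simp add: Q_def T0)
  interpret TC: twisted_chain "alg n" "nrm n" "star n" "scalar (1 / 2)" Q ?M twist
  proof unfold_locales
    show "Q j \<in> alg n" "star n (Q j) = Q j" for j by (rule QA)+
    show "Q i * Q j = Q i" "Q j * Q i = Q i" if "i \<le> j" "j \<le> ?M" for i j using QQ[OF that] by blast+
    show "Q 0 = 0" by (rule Q0)
    show "Q ?M * a = a" "a * Q ?M = a" if "a \<in> alg n" for a unfolding QM using unit[OF that] by blast+
    show "twist a \<in> alg n" "nrm n (twist a) = nrm n a" "star n (twist a) = twist (star n a)" if "a \<in> alg n" for a
      using that by (simp_all add: twist_alg nrm_twist star_twist)
    show "twist (a + a') = twist a + twist a'" "twist (a * a') = twist a * twist a'" "twist (twist a) = a" for a a'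
      by (simp_all add: twist_add twist_mult twist_twist_endo)
    have tdiff: "twist (a - a') = twist a - twist a'" for a a'
      using twist_add[of "a - a'" a'] by (simp add: eq_diff_eq)
    show "twist (Q i) = Q ?M - Q (?M - i)" if "i \<le> ?M" for i
    proof (cases "i \<le> m")
      case True
      then have "\<not> ?M - i \<le> m" "?M - (?M - i) = i" by simp_all
      then have "Q (?M - i) = ?e - T i" by (simp add: Q_def del: diff_diff_cancel)
      then show ?thesis unfolding QM using True by (simp add: Q_def T_def)
    next
      case False
      then have "?M - i \<le> m" by simp
      then have "Q (?M - i) = P0 (?M - i)" by (simp add: Q_def)
      then show ?thesis unfolding QM using False by (simp add: Q_def T_def tdiff twist_level_id twist_twist_endo)
    qed
  qed
  obtain d where d: "0 < d" "\<And>k. k \<in> alg n \<Longrightarrow> nrm n k \<le> d \<Longrightarrow> (1 + twist (star n k)) * (1 + k) = 1 \<Longrightarrow>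
      (1 + k) * (1 + twist (star n k)) = 1 \<Longrightarrow> \<exists>u\<in>alg n. nrm n u < 1 / 8 \<and> (1 + star n u) * (1 + u) = 1 \<and>
      (1 + twist (star n u)) * (1 + u) = 1 \<and> TC.same_range u k"
    using TC.unitary_same_range_twisted[of "1 / 8"] by auto
  show ?thesis
  proof (intro exI[of _ d] conjI ballI impI d(1))
    fix k assume k: "k \<in> G_level D n" "nrm n (Endo k - 1) \<le> d"
    have kGL: "k \<in> GL_level n" using G_level_GL[OF k(1)] .
    have kb: "b (k x) (k y) = b x y" for x y using k(1) not_SU by (simp add: G_level_iff)
    obtain u0 where u0: "u0 \<in> alg n" "nrm n u0 < 1 / 8" "(1 + star n u0) * (1 + u0) = 1"
      "(1 + twist (star n u0)) * (1 + u0) = 1" "TC.same_range u0 (Endo k - 1)"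
      using d(2)[OF endo_GL(1)[OF kGL] k(2) b_isometry_twist[OF kGL kb]] by blast
    have uGL: "app (1 + u0) \<in> GL_level n" using alg_small_GL[OF u0(1)] u0(2) by simp
    have "app (1 + u0) \<in> G0 D" using small_isometry_G0[OF u0(1,3,4)] u0(2) by simp
    moreover have "act (app (1 + u0)) (act g F) = act k (act g F)"
    proof (rule act_eqI[OF gGL uGL kGL])
      fix X assume X: "X \<in> F" "X \<noteq> UNIV"
      let ?Y = "g ` X \<inter> V n"
      have "?Y \<in> Y ` {..m}" using Y(3) X by blast
      then obtain i where i: "i \<le> m" "Y i = ?Y" by (auto simp: image_iff)
      have "Q i = P0 i" using i(1) by (simp add: Q_def)
      then show "app (1 + u0) ` ?Y = k ` ?Y"
        using same_range_image[OF TC.projection_chain_axioms u0(5), of i ?Y] P(3,4)[OF i(1)] i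
          endo_GL(2)[OF kGL] by simp
    qed
    ultimately show "\<exists>u\<in>G0 D. act u (act g F) = act k (act g F)" by blast
  qed
qed

end

theorem theorem3p7p2:
  fixes D :: "'v::ab_group_add flag_data" and F F1 :: "'v set set"
  assumes "flag_setting D"
    and "flag D F"
    and "compatible D F"
    and "\<not> is_SU (form D) \<longrightarrow> b_isotropic D F"
    and "F1 \<in> flag_manifold D F"
  shows "openin (flag_topology D F) (orbit (G0 D) F1) \<longleftrightarrow> nondegenerate_flag D F1"
proof -
  interpret flag_setting_chain D F
    using assms(1-3) by unfold_locales
  obtain g1 n where g1: "g1 \<in> G_level D n" "F1 = act g1 F"
    using assms(5) by (auto simp: flag_manifold_def orbit_def G_def)
  have degenerate: "\<exists>X\<in>F. \<exists>r\<in>g1 ` X. r \<noteq> 0 \<and> (\<forall>y\<in>g1 ` X. h r y = 0)" if "\<not> nondegenerate_flag D F1"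
    using that unfolding g1(2) nondegenerate_flag_def act_def nondegenerate_on_def by blast
  show ?thesis
  proof (cases "is_SU (form D)")
    case True
    show ?thesis
    proof
      assume op: "openin (flag_topology D F) (orbit (G0 D) F1)"
      show "nondegenerate_flag D F1"
      proof (rule ccontr)
        assume "\<not> nondegenerate_flag D F1"
        then obtain X r where X: "X \<in> F" "r \<in> g1 ` X" "r \<noteq> 0" "\<And>y. y \<in> g1 ` X \<Longrightarrow> h r y = 0"
          using degenerate by blast
        obtain m where "r \<in> V m" using V_UN by blast
        then have "r \<in> V (max n m)" using V_mono[of m "max n m"] by auto
        moreover have "g1 \<in> G_level D (max n m)" using G_level_mono[OF _ g1(1)] by simp
        ultimately show False
          using degenerate_not_open_SU[OF True _ X(1) refl _ X(3,4)] X(2) op g1(2) by blast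
      qed
    next
      assume "nondegenerate_flag D F1"
      then show "openin (flag_topology D F) (orbit (G0 D) F1)"
        using open_orbit[OF small_move_SU[OF True] assms(5)] by blast
    qed
  next
    case False
    interpret bilinear_flag D F
      using False assms(4) by unfold_locales auto
    show ?thesis
    proof
      assume op: "openin (flag_topology D F) (orbit (G0 D) F1)"
      show "nondegenerate_flag D F1"
      proof (rule ccontr)
        assume "\<not> nondegenerate_flag D F1"
        then obtain X r where X: "X \<in> F" "r \<in> g1 ` X" "r \<noteq> 0" "\<And>y. y \<in> g1 ` X \<Longrightarrow> h r y = 0"
          using degenerate by blast
        then show False using degenerate_not_open[OF g1(1) X(1) refl X(2,3,4)] op g1(2) by blast
      qed
    next
      assume "nondegenerate_flag D F1"
      then show "openin (flag_topology D F) (orbit (G0 D) F1)"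
        using open_orbit[OF small_move assms(5)] by blast
    qed
  qed
qed

end
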